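(* Let $R(t)\in SO(3)$ satisfy $\dot R=R\,\omega(t)^\times$, and consider the hybrid system $\mathcal H_2$ with state $x_2=(\tilde R,\eta,\mathsf x,\tau)\in SO(3)\times\mathbb R^3\times\mathbb R^6\times[0,T_M]$ given by $$\begin{cases}\dot{\tilde R}=\tilde R(-\eta)^\times,\quad \dot\eta=0_{3\times1},\quad \dot{\mathsf x}=A_t\mathsf x+\bar\delta_g,\quad \dot\tau=-1, & \tau\in[0,T_M],\\ \tilde R^+=\tilde R,\quad \eta^+=k_R\,\psi(M\tilde R),\quad \mathsf x^+=(I_6-KC)\mathsf x,\quad \tau^+\in[T_m,T_M], & \tau\in\{0\},\end{cases}$$ where $k_R>0$, $\bar\delta_g=[0_{1\times3},\ g^\top(R-\hat R)]^\top$ with $\hat R=\tilde R^\top R$, $$A_t=\begin{bmatrix}-\omega(t)^\times&I_3\\0_{3\times3}&-\omega(t)^\times\end{bmatrix},\qquad C=[I_3\ \ 0_{3\times3}],\qquad K=PC^\top(CPC^\top+Q_t)^{-1},$$ and $P\in\mathbb R^{6\times 6}$ is the solution of the continuous-discrete Riccati equation $$\dot P=A_tP+PA_t^\top+V_t\ \ (\tau\in[0,T_M]),\qquad P^+=P-PC^\top(CPC^\top+Q_t)^{-1}CP\ \ (\tau\in\{0\}),$$ with $P(0)$ positive definite. Suppose that $0<T_m\le T_M<\infty$ and that at least three of the $N\ge3$ landmarks $p_1,\dots,p_N\in\mathbb R^3$ are non-collinear. Assume that $\omega(t)$ and $V_t$ are continuous and bounded, $Q_t$ is bounded, and $V_t,Q_t$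 are uniformly positive definite. Then, for any $0<\epsilon<1$, there exist constants $\eta^*,k_R^*>0$ such that, for any $0<k_R<k_R^*$, the closed set $$\mathcal A=\{(\tilde R,\eta,\mathsf x,\tau)\in SO(3)\times\mathbb R^3\times\mathbb R^6\times[0,T_M]:\ \tilde R=I_3,\ \|\eta\|=0,\ \|\mathsf x\|=0\}$$ is exponentially stable for $\mathcal H_2$ for all initial conditions with $|\tilde R(0)|_I\le\epsilon\sqrt{\varsigma_M}$, $\|\eta(0)\|\le\eta^*$ and $\mathsf x(0)\in\mathbb R^6$ (with $\tau(0)\in[0,T_M]$); that is, there exist $\kappa,\lambda>0$ such that every maximal solution $x_2$ of $\mathcal H_2$ from such an initial condition is complete and satisfies $|x_2(t,j)|_{\mathcal A}\le\kappa e^{-\lambda(t+j)}|x_2(0,0)|_{\mathcal A}$ for all $(t,j)\in\operatorname{dom}x_2$.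
   Context: Notation. For $x\in\mathbb R^3$, $x^\times$ is the skew-symmetric $3\times3$ matrix with $x^\times y=x\times y$ for all $y$. For $B=[b_{ij}]\in\mathbb R^{3\times3}$, $\psi(B)=\tfrac12[b_{32}-b_{23},\,b_{13}-b_{31},\,b_{21}-b_{12}]^\top$. For $R\in SO(3)$, $|R|_I\in[0,1]$ is defined by $|R|_I^2=\tfrac14\operatorname{tr}(I_3-R)$. $g\in\mathbb R^3$ is the constant gravity vector. Positive definite matrices are symmetric; $V_t\in\mathbb R^{6\times6}$ and $Q_t\in\mathbb R^{3\times3}$ are matrix-valued functions of time $t\ge0$, and uniformly positive definite means bounded below by $cI$ for some constant $c>0$ independent of $t$. $P$ flows and jumps at the same hybrid times as $x_2$; in $K$ and in the jump rule of $P$, the value of $P$ just before the jump is used. Landmarks. $p_1,\dots,p_N\in\mathbb R^3$ are fixed points; $k_1,\dots,k_N>0$ are scalars with $\sum_{i=1}^Nk_i=1$; $p_c=\sum_{i=1}^Nk_ip_i$; $M=\sum_{i=1}^Nk_i(p_i-p_c)(p_i-p_c)^\top$; $\bar M=\tfrac12(\operatorname{tr}(M)I_3-M)$ (positive definite); $\varsigma_M=\lambda_{\min}(\bar M)/\lambda_{\max}(\bar M)$. Timer. $\tau$ models sampling instants $t_j$ with $0\le t_1\le T_M$ and $T_m\le t_{j+1}-t_j\le T_M$. Hybrid systems. A hybrid time domain is a set $E\subset\mathbb R_{\ge0}\times\mathbb N$ which is a union of intervals $[t_j,t_{j+1}]\times\{j\}$ with $0=t_0\le t_1\le\cdots$ (finitely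 or infinitely many, the last one, if any, possibly of the form $[t_j,T)\times\{j\}$ with $T$ finite or $+\infty$). A solution is a function $x$ on a hybrid time domain $\operatorname{dom}x$, locally absolutely continuous in $t$ for each fixed $j$, satisfying the differential equation for almost all $t$ while staying in the flow set (here $\tau\in[0,T_M]$), and with $x^+=x(t,j+1)$ obtained from $x=x(t,j)$ in the jump set (here $\tau=0$) by the jump rule. It is maximal if it cannot be extended, and complete if its domain is unbounded. $x(0)$ denotes the value at $(t,j)=(0,0)$. Distance: $|x_2|_{\mathcal A}=\big(|\tilde R|_I^2+\|\eta\|^2+\|\mathsf x\|^2\big)^{1/2}$. Origin of the system (for information). $\mathcal H_2$ is the estimation-error system for the kinematics $\dot R=R\omega^\times$, $\dot p=v$, $\dot v=g+Ra$ with landmark measurements $y_i=R^\top(p_i-p)$ and the observer that flows according to $\dot{\hat R}=\hat R(\omega+\hat R^\top\eta)^\times$, $\dot\eta=0$, $\dot{\hat p}=\eta^\times(\hat p-p_c)+\hat v$, $\dot{\hat v}=\eta^\times\hat v+g+\hat Ra$ and jumps according to $\hat R^+=\hat R$, $\eta^+=k_R\sigma_R$, $\hat p^+=\hat p+\hat RK_p\hat R^\top y$, $\hat v^+=\hat v+\hat RK_v\hat R^\top y$, where $K=[K_p^\top,K_v^\top]^\top$, $\sigma_R=\tfrac12\sum_ik_i(p_i-p_c)^\times(p_i-\hat p-\hat Ry_i)$ and $y=\sum_ik_i(p_i-\hat p-\hat Ry_i)$. The errors are $\tilde R=R\hat R^\top$, $\tilde p=p-\tilde R\hat p-(I_3-\tilde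 R)p_c$, $\tilde v=v-\tilde R\hat v$, and $\mathsf x=[\tilde p^\top R,\tilde v^\top R]^\top$. *)

theory Defs
  imports "HOL-Analysis.Analysis"
begin

section \<open>Vectors and matrices\<close>

text \<open>Six-dimensional vectors are indexed by the six-element type \<open>3 + 3\<close>: \<open>Inl\<close> and \<open>Inr\<close>
  select the upper and the lower block.\<close>

type_synonym vec3 = "real ^ 3"
type_synonym mat3 = "real ^ 3 ^ 3"
type_synonym vec6 = "real ^ (3 + 3)"
type_synonym mat6 = "real ^ (3 + 3) ^ (3 + 3)"

definition block_vec :: "vec3 \<Rightarrow> vec3 \<Rightarrow> vec6" where
  "block_vec u v = (\<chi> i. case i of Inl a \<Rightarrow> u $ a | Inr a \<Rightarrow> v $ a)"

definition block_mat :: "mat3 \<Rightarrow> mat3 \<Rightarrow> mat3 \<Rightarrow> mat3 \<Rightarrow> mat6" where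
  "block_mat A11 A12 A21 A22 =
     (\<chi> i j. case (i, j) of
        (Inl a, Inl b) \<Rightarrow> A11 $ a $ b
      | (Inl a, Inr b) \<Rightarrow> A12 $ a $ b
      | (Inr a, Inl b) \<Rightarrow> A21 $ a $ b
      | (Inr a, Inr b) \<Rightarrow> A22 $ a $ b)"

definition skew :: "vec3 \<Rightarrow> mat3" where
  "skew x = matrix (cross3 x)"

lemma skew_mult: "skew x *v y = cross3 x y"
proof -
  have "Vector_Spaces.linear (*s) (*s) (cross3 x)"
    unfolding linear_matrix_vector_mul_eq
    by (intro linearI) (simp_all add: cross_add_right cross_mult_right)
  then show ?thesis
    unfolding skew_def by (rule matrix_works)
qed

definition psi :: "mat3 \<Rightarrow> vec3" where
  "psi B = (1 / 2) *\<^sub>R vector [B$3$2 - B$2$3, B$1$3 - B$3$1, B$2$1 - B$1$2]"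

definition rot_norm :: "mat3 \<Rightarrow> real" where
  "rot_norm R = sqrt ((1 / 4) * trace (mat 1 - R))"

lemma trace_rotation:
  assumes "rotation_matrix (R :: mat3)"
  shows "trace (mat 1 - R) = (1 / 2) * (\<Sum>i\<in>UNIV. \<Sum>j\<in>UNIV. ((mat 1 - R) $ i $ j)\<^sup>2)"
proof -
  have "transpose R ** R = mat 1"
    using assms by (simp add: rotation_matrix_def orthogonal_matrix_def)
  then have "\<forall>i. (transpose R ** R) $ i $ i = 1"
    by (simp add: mat_def)
  then have "R$1$1 * R$1$1 + R$2$1 * R$2$1 + R$3$1 * R$3$1 = 1"
    "R$1$2 * R$1$2 + R$2$2 * R$2$2 + R$3$2 * R$3$2 = 1"
    "R$1$3 * R$1$3 + R$2$3 * R$2$3 + R$3$3 * R$3$3 = 1"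
    by (simp_all add: forall_3 matrix_matrix_mult_def transpose_def sum_3)
  then show ?thesis
    by (simp add: trace_def sum_3 mat_def power2_eq_square algebra_simps)
qed

lemma rot_norm_eq_0_iff:
  assumes "rotation_matrix R"
  shows "rot_norm R = 0 \<longleftrightarrow> R = mat 1"
proof -
  have "rot_norm R = 0 \<longleftrightarrow> (\<Sum>i\<in>UNIV. \<Sum>j\<in>UNIV. ((mat 1 - R) $ i $ j)\<^sup>2) = 0"
    by (simp add: rot_norm_def trace_rotation[OF assms])
  also have "\<dots> \<longleftrightarrow> (\<forall>i j. (mat 1 - R) $ i $ j = 0)"
    by (simp add: sum_nonneg_eq_0_iff sum_nonneg)
  also have "\<dots> \<longleftrightarrow> R = mat 1"
    by (auto simp: vec_eq_iff)
  finally show ?thesis .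
qed

definition outer :: "vec3 \<Rightarrow> vec3 \<Rightarrow> mat3" where
  "outer u v = (\<chi> i j. u $ i * v $ j)"

definition pos_def :: "real ^ 'n ^ 'n \<Rightarrow> bool" where
  "pos_def B \<longleftrightarrow> transpose B = B \<and> (\<forall>x. x \<noteq> 0 \<longrightarrow> x \<bullet> (B *v x) > 0)"

definition uniformly_pos_def :: "(real \<Rightarrow> real ^ 'n ^ 'n) \<Rightarrow> bool" where
  "uniformly_pos_def B \<longleftrightarrow>
     (\<exists>c>0. \<forall>t\<ge>0. transpose (B t) = B t \<and> (\<forall>x. x \<bullet> (B t *v x) \<ge> c * (x \<bullet> x)))"

definition eigenvalues :: "real ^ 'n ^ 'n \<Rightarrow> real set" where
  "eigenvalues B = {l. \<exists>v. v \<noteq> 0 \<and> B *v v = l *\<^sub>R v}"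

definition lambda_min :: "real ^ 'n ^ 'n \<Rightarrow> real" where
  "lambda_min B = Min (eigenvalues B)"

definition lambda_max :: "real ^ 'n ^ 'n \<Rightarrow> real" where
  "lambda_max B = Max (eigenvalues B)"

section \<open>Landmarks\<close>

definition landmark_center :: "nat \<Rightarrow> (nat \<Rightarrow> real) \<Rightarrow> (nat \<Rightarrow> vec3) \<Rightarrow> vec3" where
  "landmark_center N k p = (\<Sum>i=1..N. k i *\<^sub>R p i)"

definition landmark_mat :: "nat \<Rightarrow> (nat \<Rightarrow> real) \<Rightarrow> (nat \<Rightarrow> vec3) \<Rightarrow> mat3" where
  "landmark_mat N k p =
     (let pc = landmark_center N k p in \<Sum>i=1..N. k i *\<^sub>R outer (p i - pc) (p i - pc))"

definition bar_mat :: "mat3 \<Rightarrow> mat3" where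
  "bar_mat M = (1 / 2) *\<^sub>R (trace M *\<^sub>R mat 1 - M)"

definition varsigma :: "mat3 \<Rightarrow> real" where
  "varsigma M = lambda_min (bar_mat M) / lambda_max (bar_mat M)"

section \<open>Hybrid systems\<close>

text \<open>The case distinction covers, in this order: infinitely many intervals; finitely many closed
  intervals; finitely many intervals of which the last one is \<open>[t\<^sub>J, T) \<times> {J}\<close>,
  where \<open>T\<close> is finite or \<open>\<infinity>\<close>.\<close>

definition hybrid_time_domain :: "(real \<times> nat) set \<Rightarrow> bool" where
  "hybrid_time_domain E \<longleftrightarrow>
     (\<exists>t :: nat \<Rightarrow> real. t 0 = 0 \<and> incseq t \<and>
        (E = (\<Union>j. {t j..t (Suc j)} \<times> {j}) \<or>
         (\<exists>J. E = (\<Union>j\<le>J. {t j..t (Suc j)} \<times> {j})) \<or>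
         (\<exists>J (T :: ereal). ereal (t J) < T \<and>
            E = (\<Union>j<J. {t j..t (Suc j)} \<times> {j}) \<union> {s. t J \<le> s \<and> ereal s < T} \<times> {J})))"

definition abs_continuous_on :: "real set \<Rightarrow> (real \<Rightarrow> 'a::metric_space) \<Rightarrow> bool" where
  "abs_continuous_on S f \<longleftrightarrow>
     (\<forall>\<epsilon>>0. \<exists>\<delta>>0. \<forall>D :: (real \<times> real) set.
        finite D \<and> (\<forall>(a, b)\<in>D. a \<le> b \<and> {a..b} \<subseteq> S) \<and>
        pairwise (\<lambda>(a, b) (c, d). {a<..<b} \<inter> {c<..<d} = {}) D \<and>
        (\<Sum>(a, b)\<in>D. b - a) < \<delta>
        \<longrightarrow> (\<Sum>(a, b)\<in>D. dist (f a) (f b)) < \<epsilon>)"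

definition locally_abs_continuous_on :: "real set \<Rightarrow> (real \<Rightarrow> 'a::metric_space) \<Rightarrow> bool" where
  "locally_abs_continuous_on I f \<longleftrightarrow> (\<forall>a b. {a..b} \<subseteq> I \<longrightarrow> abs_continuous_on {a..b} f)"

text \<open>Solutions of the time-varying hybrid inclusion
  \<open>x' = F t x\<close> on the flow set \<open>C\<close>, \<open>x\<^sup>+ \<in> G t x\<close> on the jump set \<open>D\<close>.
  The constraint to \<open>C\<close> is imposed on all of \<open>E\<close>, so the definition is intended for systems
  whose flow set \<open>C\<close> is the whole state space, in particular contains \<open>D\<close>.
  On intervals of length zero the differential equation is void.\<close>

definition hybrid_solution ::
  "(real \<Rightarrow> 'a \<Rightarrow> 'a) \<Rightarrow> 'a set \<Rightarrow> (real \<Rightarrow> 'a \<Rightarrow> 'a set) \<Rightarrow> 'a set \<Rightarrow>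
   (real \<times> nat) set \<Rightarrow> (real \<times> nat \<Rightarrow> 'a::real_normed_vector) \<Rightarrow> bool" where
  "hybrid_solution F C G D E x \<longleftrightarrow>
     hybrid_time_domain E \<and>
     (\<forall>s\<in>E. x s \<in> C) \<and>
     (\<forall>j. let I = {t. (t, j) \<in> E} in
        locally_abs_continuous_on I (\<lambda>t. x (t, j)) \<and>
        (AE t in lebesgue. t \<in> I \<longrightarrow>
           ((\<lambda>s. x (s, j)) has_vector_derivative F t (x (t, j))) (at t within I))) \<and>
     (\<forall>t j. (t, j) \<in> E \<and> (t, Suc j) \<in> E \<longrightarrow>
        x (t, j) \<in> D \<and> x (t, Suc j) \<in> G t (x (t, j)))"

definition complete_domain :: "(real \<times> nat) set \<Rightarrow> bool" where
  "complete_domain E \<longleftrightarrow> (\<forall>B. \<exists>(t, j)\<in>E. t + real j > B)"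

section \<open>The estimation-error system\<close>

text \<open>Components: attitude error, \<open>\<eta>\<close>, stacked position and velocity errors, timer.\<close>

type_synonym h2_state = "mat3 \<times> vec3 \<times> vec6 \<times> real"

definition A_mat :: "vec3 \<Rightarrow> mat6" where
  "A_mat w = block_mat (- skew w) (mat 1) 0 (- skew w)"

definition C_mat :: "real ^ (3 + 3) ^ 3" where
  "C_mat = (\<chi> i j. case j of Inl b \<Rightarrow> mat 1 $ i $ b | Inr b \<Rightarrow> 0)"

definition gain :: "mat6 \<Rightarrow> mat3 \<Rightarrow> real ^ 3 ^ (3 + 3)" where
  "gain P Q = P ** transpose C_mat ** matrix_inv (C_mat ** P ** transpose C_mat + Q)"

definition riccati_flow :: "mat6 \<Rightarrow> mat6 \<Rightarrow> mat6 \<Rightarrow> mat6" where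
  "riccati_flow A V P = A ** P + P ** transpose A + V"

definition riccati_jump :: "mat3 \<Rightarrow> mat6 \<Rightarrow> mat6" where
  "riccati_jump Q P =
     P - P ** transpose C_mat ** matrix_inv (C_mat ** P ** transpose C_mat + Q) ** C_mat ** P"

definition h2_space :: "real \<Rightarrow> h2_state set" where
  "h2_space TM = {R. rotation_matrix R} \<times> UNIV \<times> UNIV \<times> {0..TM}"

definition h2_flow ::
  "vec3 \<Rightarrow> (real \<Rightarrow> mat3) \<Rightarrow> (real \<Rightarrow> vec3) \<Rightarrow> real \<Rightarrow> h2_state \<Rightarrow> h2_state" where
  "h2_flow g R \<omega> t = (\<lambda>(Rt, \<eta>, X, \<tau>).
     let Rhat = transpose Rt ** R t in
     (Rt ** skew (- \<eta>),
      0,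
      A_mat (\<omega> t) *v X + block_vec 0 (transpose (R t - Rhat) *v g),
      - 1))"

definition h2_jump ::
  "real \<Rightarrow> mat3 \<Rightarrow> (real \<Rightarrow> mat3) \<Rightarrow> real \<Rightarrow> real \<Rightarrow> real \<Rightarrow> mat6 \<Rightarrow> h2_state \<Rightarrow> h2_state set" where
  "h2_jump kR M Q Tm TM t P = (\<lambda>(Rt, \<eta>, X, \<tau>).
     {(Rt, kR *\<^sub>R psi (M ** Rt), (mat 1 - gain P (Q t) ** C_mat) *v X, \<tau>') | \<tau>'. \<tau>' \<in> {Tm..TM}})"

text \<open>The gain matrix couples the state to the matrix \<open>P\<close>, which evolves on the
  same hybrid time domain, starting from \<open>P0\<close>.\<close>

definition h2_solution ::
  "vec3 \<Rightarrow> (real \<Rightarrow> mat3) \<Rightarrow> (real \<Rightarrow> vec3) \<Rightarrow> (real \<Rightarrow> mat6) \<Rightarrow> (real \<Rightarrow> mat3) \<Rightarrow> mat6 \<Rightarrow>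
   mat3 \<Rightarrow> real \<Rightarrow> real \<Rightarrow> real \<Rightarrow> (real \<times> nat) set \<Rightarrow> (real \<times> nat \<Rightarrow> h2_state) \<Rightarrow> bool" where
  "h2_solution g R \<omega> V Q P0 M Tm TM kR E x \<longleftrightarrow>
     (\<exists>P :: real \<times> nat \<Rightarrow> mat6. P (0, 0) = P0 \<and>
        hybrid_solution
          (\<lambda>t (z, S). (h2_flow g R \<omega> t z, riccati_flow (A_mat (\<omega> t)) (V t) S))
          (h2_space TM \<times> UNIV)
          (\<lambda>t (z, S). h2_jump kR M Q Tm TM t S z \<times> {riccati_jump (Q t) S})
          {((Rt, \<eta>, X, \<tau>), S). (Rt, \<eta>, X, \<tau>) \<in> h2_space TM \<and> \<tau> = 0}
          E (\<lambda>s. (x s, P s)))"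

definition h2_maximal_solution ::
  "vec3 \<Rightarrow> (real \<Rightarrow> mat3) \<Rightarrow> (real \<Rightarrow> vec3) \<Rightarrow> (real \<Rightarrow> mat6) \<Rightarrow> (real \<Rightarrow> mat3) \<Rightarrow> mat6 \<Rightarrow>
   mat3 \<Rightarrow> real \<Rightarrow> real \<Rightarrow> real \<Rightarrow> (real \<times> nat) set \<Rightarrow> (real \<times> nat \<Rightarrow> h2_state) \<Rightarrow> bool" where
  "h2_maximal_solution g R \<omega> V Q P0 M Tm TM kR E x \<longleftrightarrow>
     h2_solution g R \<omega> V Q P0 M Tm TM kR E x \<and>
     \<not> (\<exists>E' x'. h2_solution g R \<omega> V Q P0 M Tm TM kR E' x' \<and> E \<subset> E' \<and> (\<forall>s\<in>E. x' s = x s))"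

definition h2_target :: "real \<Rightarrow> h2_state set" where
  "h2_target TM = {(Rt, \<eta>, X, \<tau>). (Rt, \<eta>, X, \<tau>) \<in> h2_space TM \<and> Rt = mat 1 \<and> norm \<eta> = 0 \<and> norm X = 0}"

definition h2_dist :: "h2_state \<Rightarrow> real" where
  "h2_dist = (\<lambda>(Rt, \<eta>, X, \<tau>). sqrt ((rot_norm Rt)\<^sup>2 + (norm \<eta>)\<^sup>2 + (norm X)\<^sup>2))"

lemma h2_dist_eq_0_iff:
  assumes "x \<in> h2_space TM"
  shows "h2_dist x = 0 \<longleftrightarrow> x \<in> h2_target TM"
  using assms
  by (cases x)
     (auto simp: h2_dist_def h2_target_def h2_space_def rot_norm_eq_0_iff[symmetric]
       add_nonneg_eq_0_iff)

end

theory Submission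
  imports Defs
begin

text \<open>
  The error system is a cascade: attitude and \<open>\<eta>\<close> evolve independently of the position and velocity errors and
  enter those through \<open>\<delta>\<^sub>g\<close>, whose norm is bounded by a multiple of \<open>rot_norm\<close>.

  For the attitude, \<open>L = trace ((mat 1 - R) ** M)\<close> has derivative \<open>-2 \<psi> \<bullet> \<eta>\<close> with \<open>\<psi> = psi (M ** R)\<close>. Since \<open>\<eta>\<close>
  is \<open>k\<^sub>R\<close> times the sampled \<open>\<psi>\<close> and \<open>\<psi>\<close> changes little between samples if \<open>k\<^sub>R\<close> is small, \<open>L\<close> decreases by a
  multiple of \<open>k\<^sub>R |\<psi>|\<^sup>2\<close> per interval, and \<open>|\<psi>|\<^sup>2\<close> dominates \<open>L\<close> as long as \<open>rot_norm\<close> stays below a constant less than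
  \<open>1\<close>; the sublevel set \<open>L \<le> 4 e\<^sup>2 \<lambda>\<^sub>m\<^sub>i\<^sub>n\<close> guarantees this, and a small \<open>\<eta>(0)\<close> does not leave it before the first jump.

  For the remaining errors, let \<open>z\<close> solve the adjoint equation backwards in time. Along the flow \<open>z\<^sup>T P z\<close> has
  derivative \<open>z\<^sup>T V z\<close> and \<open>z\<^sup>T x\<close> has derivative \<open>z\<^sup>T \<delta>\<^sub>g\<close>, and the jump of \<open>P\<close> is the minimum over \<open>k\<close> of
  \<open>(z - C\<^sup>T k)\<^sup>T P (z - C\<^sup>T k) + k\<^sup>T Q k\<close>. Steering \<open>z\<close> to zero with two impulses bounds \<open>P\<close> from above uniformly, and
  then the smallest \<open>w\<close> with \<open>(z\<^sup>T x)\<^sup>2 \<le> w z\<^sup>T P z\<close> for all \<open>z\<close> decays exponentially up to the contribution of \<open>\<delta>\<^sub>g\<close>.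

  A maximal solution has infinitely many jumps, because on its last interval the (linear) flow could be continued
  until the timer expires. Hence it is complete, and decay in the number of jumps is decay in \<open>t + j\<close>.
\<close>

section \<open>Absolutely continuous solutions of differential equations\<close>

text \<open>Hybrid solutions satisfy their equation only almost everywhere. Along a solution the
  right-hand sides are continuous, so a fundamental theorem for absolutely continuous functions
  makes all derivatives classical; from then on mean value estimates suffice. The radius
  \<open>\<epsilon> * sqrt (varsigma M)\<close> reflects the gap between the two Rayleigh bounds of
  \<open>L\<close>: the ball of that radius lies in the sublevel set \<open>L \<le> 4
  \<epsilon>\<^sup>2 \<lambda>\<^sub>m\<^sub>i\<^sub>n\<close>, and the margin between \<epsilon>
  and \<open>e\<close> pays for the growth caused by \<eta>(0). The interval before the first jump
  is exceptional throughout: \<eta>(0) is not a sampled value of \<open>psi\<close>, and the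
  interval may have length zero. Neither decrease nor contraction is available there, so every
  recursion starts at the first jump and the first interval only costs a constant factor. All
  constants must precede the solution. This is why \<open>P\<close> enters only through an upper
  bound that depends on \<open>P0\<close> and the data, and through \<open>lambda_min P0\<close> at
  the initial time. A contraction forced by a geometric sequence is again geometric, with a ratio
  above both given ones; this closes the cascade.\<close>

lemma abs_continuous_onD:
  fixes f :: "real \<Rightarrow> 'a::metric_space"
  assumes "abs_continuous_on S f" "\<epsilon> > 0"
  obtains \<delta> where "\<delta> > 0"
    "\<And>D. \<lbrakk>finite D; \<And>a b. (a, b) \<in> D \<Longrightarrow> a \<le> b \<and> {a..b} \<subseteq> S;
      \<And>a b c d. \<lbrakk>(a, b) \<in> D; (c, d) \<in> D; (a, b) \<noteq> (c, d)\<rbrakk> \<Longrightarrow> {a<..<b} \<inter> {c<..<d} = {};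
      (\<Sum>(a, b)\<in>D. b - a) < \<delta>\<rbrakk> \<Longrightarrow> (\<Sum>(a, b)\<in>D. dist (f a) (f b)) < \<epsilon>"
proof -
  from assms(1)[unfolded abs_continuous_on_def, THEN spec, THEN mp, OF assms(2)]
  show thesis
  proof (elim exE conjE)
    fix \<delta> :: real
    assume d: "\<delta> > 0" and h: "\<forall>D :: (real \<times> real) set.
        finite D \<and> (\<forall>(a, b)\<in>D. a \<le> b \<and> {a..b} \<subseteq> S) \<and>
        pairwise (\<lambda>(a, b) (c, d). {a<..<b} \<inter> {c<..<d} = {}) D \<and>
        (\<Sum>(a, b)\<in>D. b - a) < \<delta>
        \<longrightarrow> (\<Sum>(a, b)\<in>D. dist (f a) (f b)) < \<epsilon>"
  show thesis
  proof (rule that[OF d])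
    fix D :: "(real \<times> real) set"
    assume D: "finite D" "\<And>a b. (a, b) \<in> D \<Longrightarrow> a \<le> b \<and> {a..b} \<subseteq> S"
      "\<And>a b c d. \<lbrakk>(a, b) \<in> D; (c, d) \<in> D; (a, b) \<noteq> (c, d)\<rbrakk> \<Longrightarrow> {a<..<b} \<inter> {c<..<d} = {}"
      "(\<Sum>(a, b)\<in>D. b - a) < \<delta>"
    have p: "pairwise (\<lambda>(a, b) (c, d). {a<..<b} \<inter> {c<..<d} = {}) D"
    proof (rule pairwiseI)
      fix x y assume "x \<in> D" "y \<in> D" "x \<noteq> y"
      then show "(\<lambda>(a, b) (c, d). {a<..<b} \<inter> {c<..<d} = {}) x y"
        using D(3)[of "fst x" "snd x" "fst y" "snd y"] by (cases x; cases y) (simp only: split_conv fst_conv snd_conv)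
    qed
    show "(\<Sum>(a, b)\<in>D. dist (f a) (f b)) < \<epsilon>"
      using h[rule_format, of D] D(1,2,4) p by blast
  qed
  qed
qed

lemma abs_continuous_on_subset:
  assumes "abs_continuous_on S f" "T \<subseteq> S"
  shows "abs_continuous_on T f"
  unfolding abs_continuous_on_def
proof (intro allI impI)
  fix e :: real assume "e > 0"
  from assms(1)[unfolded abs_continuous_on_def, THEN spec, THEN mp, OF this]
  show "\<exists>\<delta>>0. \<forall>D. finite D \<and> (\<forall>(a, b)\<in>D. a \<le> b \<and> {a..b} \<subseteq> T) \<and>
        pairwise (\<lambda>(a, b) (c, d). {a<..<b} \<inter> {c<..<d} = {}) D \<and> (\<Sum>(a, b)\<in>D. b - a) < \<delta>
        \<longrightarrow> (\<Sum>(a, b)\<in>D. dist (f a) (f b)) < e"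
  proof (elim exE conjE)
    fix \<delta> :: real
    assume d: "\<delta> > 0" and h: "\<forall>D. finite D \<and> (\<forall>(a, b)\<in>D. a \<le> b \<and> {a..b} \<subseteq> S) \<and>
        pairwise (\<lambda>(a, b) (c, d). {a<..<b} \<inter> {c<..<d} = {}) D \<and> (\<Sum>(a, b)\<in>D. b - a) < \<delta>
        \<longrightarrow> (\<Sum>(a, b)\<in>D. dist (f a) (f b)) < e"
    show ?thesis
    proof (intro exI[of _ \<delta>] conjI d allI impI, elim conjE)
      fix D :: "(real \<times> real) set"
      assume D: "finite D" "\<forall>(a, b)\<in>D. a \<le> b \<and> {a..b} \<subseteq> T"
        "pairwise (\<lambda>(a, b) (c, d). {a<..<b} \<inter> {c<..<d} = {}) D" "(\<Sum>(a, b)\<in>D. b - a) < \<delta>"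
      have "\<forall>(a, b)\<in>D. a \<le> b \<and> {a..b} \<subseteq> S" using D(2) assms(2) by (auto simp only: split_beta) blast
      then show "(\<Sum>(a, b)\<in>D. dist (f a) (f b)) < e" by (intro h[THEN spec, THEN mp] conjI D)
    qed
  qed
qed

lemma abs_continuous_on_imp_continuous_on:
  assumes "abs_continuous_on {a..b} f"
  shows "continuous_on {a..b} f"
proof (rule continuous_on_iff[THEN iffD2], intro ballI allI impI)
  fix x and e :: real assume x: "x \<in> {a..b}" and e: "e > 0"
  obtain d where d: "d > 0" and h: "\<And>D. \<lbrakk>finite D; \<And>u v. (u, v) \<in> D \<Longrightarrow> u \<le> v \<and> {u..v} \<subseteq> {a..b};
      \<And>a b c d. \<lbrakk>(a, b) \<in> D; (c, d) \<in> D; (a, b) \<noteq> (c, d)\<rbrakk> \<Longrightarrow> {a<..<b} \<inter> {c<..<d} = {};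
      (\<Sum>(a, b)\<in>D. b - a) < d\<rbrakk> \<Longrightarrow> (\<Sum>(a, b)\<in>D. dist (f a) (f b)) < e"
    by (rule abs_continuous_onD[OF assms e]) metis
  show "\<exists>d>0. \<forall>x'\<in>{a..b}. dist x' x < d \<longrightarrow> dist (f x') (f x) < e"
  proof (intro exI[of _ d] conjI d ballI impI)
    fix y assume y: "y \<in> {a..b}" "dist y x < d"
    have "(\<Sum>(u, v)\<in>{(min x y, max x y)}. dist (f u) (f v)) < e"
      by (rule h) (use x y in \<open>auto simp: dist_real_def min_def max_def split: if_splits\<close>)
    then show "dist (f y) (f x) < e"
      by (auto simp: min_def max_def dist_commute split: if_splits)
  qed
qed

lemma Lipschitz_imp_abs_continuous_on:
  fixes f :: "real \<Rightarrow> 'a::metric_space"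
  assumes "\<And>x y. \<lbrakk>x \<in> S; y \<in> S\<rbrakk> \<Longrightarrow> dist (f x) (f y) \<le> B * \<bar>x - y\<bar>"
  shows "abs_continuous_on S f"
  unfolding abs_continuous_on_def
proof (intro allI impI)
  fix e :: real assume e: "e > 0"
  \<comment> \<open>The sign of \<open>B\<close> is unknown; \<open>B'\<close> dominates it and is
    positive, so \<open>e / B'\<close> is admissible.\<close>
  define B' where "B' = \<bar>B\<bar> + 1"
  have B': "B' > 0" by (simp add: B'_def)
  show "\<exists>\<delta>>0. \<forall>D. finite D \<and> (\<forall>(a, b)\<in>D. a \<le> b \<and> {a..b} \<subseteq> S) \<and>
        pairwise (\<lambda>(a, b) (c, d). {a<..<b} \<inter> {c<..<d} = {}) D \<and> (\<Sum>(a, b)\<in>D. b - a) < \<delta>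
        \<longrightarrow> (\<Sum>(a, b)\<in>D. dist (f a) (f b)) < e"
  proof (intro exI[of _ "e / B'"] conjI allI impI)
    fix D :: "(real \<times> real) set"
    assume D: "finite D \<and> (\<forall>(a, b)\<in>D. a \<le> b \<and> {a..b} \<subseteq> S) \<and>
        pairwise (\<lambda>(a, b) (c, d). {a<..<b} \<inter> {c<..<d} = {}) D \<and> (\<Sum>(a, b)\<in>D. b - a) < e / B'"
    have "(\<Sum>(a, b)\<in>D. dist (f a) (f b)) \<le> (\<Sum>(a, b)\<in>D. B' * (b - a))"
    proof (rule sum_mono, clarify)
      fix u v assume "(u, v) \<in> D"
      then have "u \<le> v" "{u..v} \<subseteq> S" using D by auto
      then have "u \<in> S" "v \<in> S" by auto
      then have "dist (f u) (f v) \<le> B * \<bar>u - v\<bar>" by (rule assms)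
      also have "\<dots> \<le> B' * (v - u)"
        using \<open>u \<le> v\<close> by (auto simp: B'_def intro!: mult_right_mono)
      finally show "dist (f u) (f v) \<le> B' * (v - u)" .
    qed
    also have "\<dots> = B' * (\<Sum>(a, b)\<in>D. b - a)"
      by (simp add: sum_distrib_left case_prod_unfold)
    also have "\<dots> < B' * (e / B')"
      using D B' by (intro mult_strict_left_mono) auto
    finally show "(\<Sum>(a, b)\<in>D. dist (f a) (f b)) < e" using B' by simp
  qed (use e B' in simp)
qed

text \<open>The gauge is the one of the fundamental theorem of calculus outside \<open>N\<close>; at points of \<open>N\<close> it is an open
  superset of \<open>N\<close> of small measure, so that absolute continuity bounds the increments there.\<close>

lemma abs_continuous_has_integral_deriv:
  fixes f :: "real \<Rightarrow> 'a::real_normed_vector"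
  assumes ab: "a \<le> b" and ac: "abs_continuous_on {a..b} f" and N: "negligible N"
    and der: "\<And>t. t \<in> {a..b} - N \<Longrightarrow> (f has_vector_derivative f' t) (at t within {a..b})"
  shows "((\<lambda>t. if t \<in> N then 0 else f' t) has_integral (f b - f a)) {a..b}"
  unfolding has_integral_real
proof (intro allI impI)
  fix e :: real assume e: "e > 0"
  \<comment> \<open>Tags outside \<open>N\<close> may cost \<open>e / 2\<close> in total; the
    \<open>+ 1\<close> keeps the denominator positive when \<open>a = b\<close>.\<close>
  define e' where "e' = e / (2 * (b - a + 1))"
  have e': "e' > 0" using e ab by (simp add: e'_def)
  obtain d where d: "d > 0" and dh: "\<And>D. \<lbrakk>finite D; \<And>u v. (u, v) \<in> D \<Longrightarrow> u \<le> v \<and> {u..v} \<subseteq> {a..b};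
      \<And>a b c d. \<lbrakk>(a, b) \<in> D; (c, d) \<in> D; (a, b) \<noteq> (c, d)\<rbrakk> \<Longrightarrow> {a<..<b} \<inter> {c<..<d} = {};
      (\<Sum>(a, b)\<in>D. b - a) < d\<rbrakk> \<Longrightarrow> (\<Sum>(a, b)\<in>D. dist (f a) (f b)) < e / 2"
    by (rule abs_continuous_onD[OF ac half_gt_zero[OF e]]) metis
  have Ns: "N \<in> sets lebesgue" "N \<in> null_sets lebesgue" using N negligible_iff_null_sets by auto
  \<comment> \<open>\<open>N\<close> is null, so \<open>U\<close> itself has measure below
    \<open>d\<close>, the threshold of absolute continuity for \<open>e / 2\<close>.\<close>
  obtain U where U: "open U" "N \<subseteq> U" "U - N \<in> lmeasurable" "emeasure lebesgue (U - N) < ennreal d"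
    using sets_lebesgue_outer_open[OF Ns(1) d] by metis
  have Ul: "U \<in> sets lebesgue" using U(1) by (simp add: borel_open)
  have "emeasure lebesgue U = emeasure lebesgue (U - N)"
    using emeasure_Diff_null_set[OF Ns(2) Ul] by simp
  then have Ue: "emeasure lebesgue U < ennreal d" using U(4) by simp
  then have Um: "U \<in> lmeasurable" using Ul by (metis fmeasurableI infinity_ennreal_def order_less_trans ennreal_less_top top.not_eq_extremum)
  have Ud: "measure lebesgue U < d"
    using Ue d by (simp add: Um emeasure_eq_measure2 ennreal_less_iff)
  have "\<exists>r>0. \<forall>y\<in>{a..b}. norm (y - x) < r \<longrightarrow> norm (f y - f x - (y - x) *\<^sub>R f' x) \<le> e' * norm (y - x)"
    if "x \<in> {a..b} - N" for x
    using der[OF that] e' unfolding has_vector_derivative_def has_derivative_within_alt by blast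
  then obtain r where r: "\<And>x. x \<in> {a..b} - N \<Longrightarrow> r x > 0"
    "\<And>x y. \<lbrakk>x \<in> {a..b} - N; y \<in> {a..b}; norm (y - x) < r x\<rbrakk> \<Longrightarrow> norm (f y - f x - (y - x) *\<^sub>R f' x) \<le> e' * norm (y - x)"
    by metis
  define \<gamma> where "\<gamma> x = (if x \<in> N then U else if x \<in> {a..b} then ball x (r x) else UNIV)" for x
  have gauge: "gauge \<gamma>"
    unfolding gauge_def \<gamma>_def using U r(1) by auto
  show "\<exists>\<gamma>. gauge \<gamma> \<and> (\<forall>D. D tagged_division_of {a..b} \<and> \<gamma> fine D \<longrightarrow>
          norm ((\<Sum>(x, k)\<in>D. measure lborel k *\<^sub>R (if x \<in> N then 0 else f' x)) - (f b - f a)) < e)"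
  proof (intro exI[of _ \<gamma>] conjI gauge allI impI, elim conjE)
    fix D assume D: "D tagged_division_of {a..b}" and fine: "\<gamma> fine D"
    note Dd = tagged_division_ofD[OF D]
    have int: "\<exists>u v. K = {u..v} \<and> u \<le> x \<and> x \<le> v \<and> a \<le> u \<and> v \<le> b \<and> K \<subseteq> \<gamma> x" if xK: "(x, K) \<in> D" for x K
    proof -
      obtain u v where K: "K = {u..v}" using Dd(4)[OF xK] by auto
      then show ?thesis using Dd(2)[OF xK] Dd(3)[OF xK] fineD[OF fine xK] by auto
    qed
    \<comment> \<open>Degenerate intervals are left out: they contribute nothing, and without them
      disjoint interiors make the map to endpoint pairs injective, so that sums over tagged
      intervals become sums over sets of pairs.\<close>
    define D1 where "D1 = {(x, K)\<in>D. x \<in> N \<and> Inf K < Sup K}"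
    define I where "I = (\<lambda>(x::real, K::real set). (Inf K, Sup K))"
    have I_D1: "K = {Inf K..Sup K}" "Inf K < Sup K" "a \<le> Inf K" "Sup K \<le> b" "K \<subseteq> U"
      if "(x, K) \<in> D1" for x K
      using int[of x K] that by (auto simp: D1_def \<gamma>_def)
    have finD1: "finite D1" using Dd(1) unfolding D1_def by (rule rev_finite_subset) auto
    have disj: "{Inf K<..<Sup K} \<inter> {Inf K'<..<Sup K'} = {}"
      if "(x, K) \<in> D1" "(x', K') \<in> D1" "(x, K) \<noteq> (x', K')" for x K x' K'
    proof -
      have "interior K \<inter> interior K' = {}"
        using Dd(5)[of x K x' K'] that unfolding D1_def by blast
      then show ?thesis using I_D1(1)[OF that(1)] I_D1(1)[OF that(2)]
        by (metis interior_atLeastAtMost_real)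
    qed
    have injI: "inj_on I D1"
    proof (rule inj_onI)
      fix y y' assume y: "y \<in> D1" "y' \<in> D1" "I y = I y'"
      obtain x K x' K' where e: "y = (x, K)" "y' = (x', K')" by (cases y; cases y') auto
      show "y = y'"
      proof (rule ccontr)
        assume "y \<noteq> y'"
        then have "{Inf K<..<Sup K} \<inter> {Inf K'<..<Sup K'} = {}" using disj y e by blast
        moreover have "Inf K = Inf K'" "Sup K = Sup K'" using y(3) e by (auto simp: I_def)
        moreover have "Inf K < Sup K" using I_D1 y(1) e by blast
        ultimately show False using dense by fastforce
      qed
    qed
    have "(\<Sum>(u, v)\<in>I ` D1. v - u) = (\<Sum>(x, K)\<in>D1. Sup K - Inf K)"
      by (subst sum.reindex[OF injI]) (auto simp: I_def case_prod_unfold)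
    also have "\<dots> = (\<Sum>y\<in>D1. measure lebesgue {Inf (snd y)<..<Sup (snd y)})"
    proof (rule sum.cong)
      fix y assume "y \<in> D1"
      then have "Inf (snd y) < Sup (snd y)" by (metis I_D1(2) prod.collapse)
      then show "(\<lambda>(x, K). Sup K - Inf K) y = measure lebesgue {Inf (snd y)<..<Sup (snd y)}"
        by (simp add: case_prod_unfold)
    qed simp
    also have "\<dots> = measure lebesgue (\<Union>y\<in>D1. {Inf (snd y)<..<Sup (snd y)})"
    proof (rule measure_finite_Union[symmetric, OF finD1])
      show "disjoint_family_on (\<lambda>y. {Inf (snd y)<..<Sup (snd y)}) D1"
        unfolding disjoint_family_on_def using disj by force
    qed (auto simp: emeasure_eq_measure2)
    also have "\<dots> \<le> measure lebesgue U"
    proof (rule measure_mono_fmeasurable[OF _ _ Um])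
      show "(\<Union>y\<in>D1. {Inf (snd y)<..<Sup (snd y)}) \<subseteq> U"
      proof clarsimp
        fix x K z assume h: "(x, K) \<in> D1" "Inf K < z" "z < Sup K"
        then have "z \<in> K" using I_D1(1)[OF h(1)] by (metis atLeastAtMost_iff less_imp_le)
        then show "z \<in> U" using I_D1(5)[OF h(1)] by blast
      qed
    qed (use finD1 in \<open>auto intro!: sets.finite_UN\<close>)
    also have "\<dots> < d" by (rule Ud)
    finally have sd: "(\<Sum>(u, v)\<in>I ` D1. v - u) < d" .
    have "(\<Sum>(u, v)\<in>I ` D1. dist (f u) (f v)) < e / 2"
    proof (rule dh[OF _ _ _ sd])
      show "finite (I ` D1)" using finD1 by simp
      show "u \<le> v \<and> {u..v} \<subseteq> {a..b}" if uv: "(u, v) \<in> I ` D1" for u v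
      proof -
        obtain x K where "(x, K) \<in> D1" "u = Inf K" "v = Sup K" using uv by (auto simp: I_def)
        then show ?thesis using I_D1(2-4)[of x K] by auto
      qed
      show "{u<..<v} \<inter> {u'<..<v'} = {}" if h: "(u, v) \<in> I ` D1" "(u', v') \<in> I ` D1" "(u, v) \<noteq> (u', v')" for u v u' v'
      proof -
        obtain x K where 1: "(x, K) \<in> D1" "u = Inf K" "v = Sup K" using h(1) by (auto simp: I_def)
        obtain x' K' where 2: "(x', K') \<in> D1" "u' = Inf K'" "v' = Sup K'" using h(2) by (auto simp: I_def)
        show ?thesis using disj[OF 1(1) 2(1)] 1 2 h(3) by auto
      qed
    qed
    moreover have "(\<Sum>(u, v)\<in>I ` D1. dist (f u) (f v)) = (\<Sum>(x, K)\<in>D1. norm (f (Sup K) - f (Inf K)))"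
      by (subst sum.reindex[OF injI]) (auto simp: I_def case_prod_unfold dist_norm norm_minus_commute)
    ultimately have s1: "(\<Sum>(x, K)\<in>D1. norm (f (Sup K) - f (Inf K))) < e / 2" by simp
    have tel: "(\<Sum>(x, K)\<in>D. f (Sup K) - f (Inf K)) = f b - f a"
      using additive_tagged_division_1[OF ab D] .
    have bound: "norm (measure lborel K *\<^sub>R (if x \<in> N then 0 else f' x) - (f (Sup K) - f (Inf K)))
      \<le> e' * measure lborel K + (if (x, K) \<in> D1 then norm (f (Sup K) - f (Inf K)) else 0)"
      if xK: "(x, K) \<in> D" for x K
    proof -
      obtain u v where K: "K = {u..v}" "u \<le> x" "x \<le> v" "a \<le> u" "v \<le> b" "K \<subseteq> \<gamma> x" using int[OF xK] by blast
      have IS: "Inf K = u" "Sup K = v" "measure lborel K = v - u" using K by auto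
      show ?thesis
      proof (cases "x \<in> N")
        case True
        show ?thesis
        proof (cases "u < v")
          case True
          then have "(x, K) \<in> D1" using \<open>x \<in> N\<close> xK IS by (auto simp: D1_def)
          then show ?thesis using \<open>x \<in> N\<close> e' True IS by (simp add: norm_minus_commute)
        next
          case False
          then have "u = v" using K by auto
          then show ?thesis using \<open>x \<in> N\<close> e' IS by simp
        qed
      next
        case False
        have xab: "x \<in> {a..b} - N" using False K by auto
        have "u \<in> K" "v \<in> K" using K by auto
        then have b: "norm (u - x) < r x" "norm (v - x) < r x"
          using K(6) xab by (auto simp: \<gamma>_def dist_norm norm_minus_commute subset_iff)
        \<comment> \<open>The tag lies between \<open>u\<close> and \<open>v\<close>, so the errors
          of the two linear approximations at the endpoints add up to
          \<open>e' * (v - u)\<close>.\<close>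
        have "norm (f v - f x - (v - x) *\<^sub>R f' x) \<le> e' * norm (v - x)"
          using r(2)[OF xab _ b(2)] K by auto
        moreover have "norm (f u - f x - (u - x) *\<^sub>R f' x) \<le> e' * norm (u - x)"
          using r(2)[OF xab _ b(1)] K by auto
        moreover have "(v - u) *\<^sub>R f' x - (f v - f u) = (f u - f x - (u - x) *\<^sub>R f' x) - (f v - f x - (v - x) *\<^sub>R f' x)"
          by (simp add: algebra_simps)
        ultimately have "norm ((v - u) *\<^sub>R f' x - (f v - f u)) \<le> e' * norm (u - x) + e' * norm (v - x)"
          by (smt (verit) norm_triangle_ineq4)
        also have "\<dots> = e' * (v - u)" using K by (simp add: algebra_simps)
        finally show ?thesis using False IS by (auto simp: D1_def)
      qed
    qed
    have "norm ((\<Sum>(x, k)\<in>D. measure lborel k *\<^sub>R (if x \<in> N then 0 else f' x)) - (f b - f a))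
      = norm (\<Sum>(x, K)\<in>D. measure lborel K *\<^sub>R (if x \<in> N then 0 else f' x) - (f (Sup K) - f (Inf K)))"
      by (simp add: tel[symmetric] sum_subtractf case_prod_unfold)
    also have "\<dots> \<le> (\<Sum>(x, K)\<in>D. e' * measure lborel K + (if (x, K) \<in> D1 then norm (f (Sup K) - f (Inf K)) else 0))"
      by (rule sum_norm_le) (use bound in auto)
    also have "\<dots> = e' * (\<Sum>(x, K)\<in>D. measure lborel K) + (\<Sum>(x, K)\<in>D. if (x, K) \<in> D1 then norm (f (Sup K) - f (Inf K)) else 0)"
      by (simp add: sum.distrib sum_distrib_left case_prod_unfold)
    also have "(\<Sum>(x, K)\<in>D. measure lborel K) = b - a"
      using additive_content_tagged_division[of D a b] D ab by simp
    also have "(\<Sum>(x, K)\<in>D. if (x, K) \<in> D1 then norm (f (Sup K) - f (Inf K)) else 0)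
      = (\<Sum>(x, K)\<in>D1. norm (f (Sup K) - f (Inf K)))"
      using Dd(1) by (auto intro!: sum.mono_neutral_cong_right simp: D1_def split: if_splits)
    also have "e' * (b - a) + (\<Sum>(x, K)\<in>D1. norm (f (Sup K) - f (Inf K))) < e"
    proof -
      have "e' * (b - a) \<le> e / 2" using ab e by (simp add: e'_def field_simps)
      then show ?thesis using s1 by linarith
    qed
    finally show "norm ((\<Sum>(x, k)\<in>D. measure lborel k *\<^sub>R (if x \<in> N then 0 else f' x)) - (f b - f a)) < e" .
  qed
qed

text \<open>Continuity of \<open>f'\<close> upgrades the equation from almost every time to every
  time: \<open>f\<close> is an integral of \<open>f'\<close>, and such an integral is differentiable
  everywhere.\<close>

lemma abs_continuous_ode_imp_has_vector_derivative:
  fixes f :: "real \<Rightarrow> 'a::banach"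
  assumes ac: "abs_continuous_on {a..b} f" and f': "continuous_on {a..b} f'"
    and der: "AE t in lebesgue. t \<in> {a..b} \<longrightarrow> (f has_vector_derivative f' t) (at t within {a..b})"
    and t: "t \<in> {a..b}"
  shows "(f has_vector_derivative f' t) (at t within {a..b})"
proof -
  obtain N where N: "N \<in> null_sets lebesgue"
    "{t \<in> space lebesgue. \<not> (t \<in> {a..b} \<longrightarrow> (f has_vector_derivative f' t) (at t within {a..b}))} \<subseteq> N"
    using der unfolding eventually_ae_filter by blast
  have neg: "negligible N" using N(1) negligible_iff_null_sets by blast
  have eq: "f s = f a + integral {a..s} f'" if s: "s \<in> {a..b}" for s
  proof -
    have acs: "abs_continuous_on {a..s} f"
      by (rule abs_continuous_on_subset[OF ac]) (use s in auto)
    have "((\<lambda>t. if t \<in> N then 0 else f' t) has_integral (f s - f a)) {a..s}"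
    proof (rule abs_continuous_has_integral_deriv[OF _ acs neg])
      fix t assume "t \<in> {a..s} - N"
      then have "(f has_vector_derivative f' t) (at t within {a..b})" using N(2) s by auto
      then show "(f has_vector_derivative f' t) (at t within {a..s})"
        by (rule has_vector_derivative_within_subset) (use s in auto)
    qed (use s in auto)
    then have "(f' has_integral (f s - f a)) {a..s}"
      by (rule has_integral_spike[OF neg, rotated]) auto
    then show ?thesis by (simp add: integral_unique)
  qed
  have "((\<lambda>s. integral {a..s} f') has_vector_derivative f' t) (at t within {a..b})"
    by (rule integral_has_vector_derivative[OF f' t])
  then have "((\<lambda>s. f a + integral {a..s} f') has_vector_derivative f' t) (at t within {a..b})"
    by (auto intro!: derivative_eq_intros)
  then show ?thesis
    by (rule has_vector_derivative_transform[OF t eq, rotated])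
qed

section \<open>Matrices and block vectors\<close>

text \<open>The norm of a matrix is here the Frobenius norm, the Euclidean norm of the vector of its
  rows; Cauchy-Schwarz is applied to each row.\<close>

lemma norm_matrix_vector_mult_le: "norm (A *v x) \<le> norm A * norm (x :: real ^ 'n)"
  for A :: "real ^ 'n ^ 'm"
proof -
  have "norm (A *v x) = L2_set (\<lambda>i. norm (A $ i \<bullet> x)) UNIV"
    by (simp add: norm_vec_def matrix_mult_dot)
  also have "\<dots> \<le> L2_set (\<lambda>i. norm (A $ i) * norm x) UNIV"
    by (rule L2_set_mono) (auto simp: Cauchy_Schwarz_ineq2)
  also have "\<dots> = norm A * norm x"
    by (simp add: norm_vec_def[of A] L2_set_left_distrib)
  finally show ?thesis .
qed

lemma norm_transpose: "norm (transpose A) = norm (A :: real ^ 'n ^ 'm)"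
proof -
  have "(norm (transpose A))\<^sup>2 = (\<Sum>i\<in>UNIV. \<Sum>j\<in>UNIV. (A $ j $ i)\<^sup>2)"
    by (simp add: norm_vec_def transpose_def L2_set_def sum_nonneg)
  also have "\<dots> = (\<Sum>j\<in>UNIV. \<Sum>i\<in>UNIV. (A $ j $ i)\<^sup>2)" by (rule sum.swap)
  also have "\<dots> = (norm A)\<^sup>2"
    by (simp add: norm_vec_def L2_set_def sum_nonneg)
  finally show ?thesis by (simp add: power2_eq_iff_nonneg)
qed

lemma norm_matrix_matrix_mult_le: "norm (A ** B) \<le> norm A * norm B"
  for A :: "real ^ 'n ^ 'm" and B :: "real ^ 'k ^ 'n"
proof -
  have row: "(A ** B) $ i = transpose B *v (A $ i)" for i
    by (simp add: vec_eq_iff matrix_matrix_mult_def matrix_vector_mult_def transpose_def mult.commute)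
  have "norm (A ** B) = L2_set (\<lambda>i. norm (transpose B *v (A $ i))) UNIV"
    by (simp add: norm_vec_def[of "A ** B"] row)
  also have "\<dots> \<le> L2_set (\<lambda>i. norm B * norm (A $ i)) UNIV"
  proof (rule L2_set_mono)
    show "norm (transpose B *v (A $ i)) \<le> norm B * norm (A $ i)" for i
      using norm_matrix_vector_mult_le[of "transpose B" "A $ i"] by (simp add: norm_transpose)
  qed simp
  also have "\<dots> = norm A * norm B"
    by (simp add: norm_vec_def[of A] L2_set_right_distrib[symmetric] mult.commute)
  finally show ?thesis .
qed

lemma bounded_bilinear_matrix_vector_mult:
  "bounded_bilinear ((*v) :: real ^ 'n ^ 'm \<Rightarrow> real ^ 'n \<Rightarrow> real ^ 'm)"
proof
  show "\<exists>K. \<forall>(a :: real ^ 'n ^ 'm) b. norm (a *v b) \<le> norm a * norm b * K"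
    by (rule exI[of _ 1]) (simp add: norm_matrix_vector_mult_le)
qed (simp_all add: algebra_simps scaleR_matrix_vector_assoc matrix_vector_mult_scaleR)

lemma bounded_bilinear_matrix_matrix_mult:
  "bounded_bilinear ((**) :: real ^ 'n ^ 'm \<Rightarrow> real ^ 'k ^ 'n \<Rightarrow> real ^ 'k ^ 'm)"
proof
  show "\<exists>K. \<forall>(a :: real ^ 'n ^ 'm) (b :: real ^ 'k ^ 'n). norm (a ** b) \<le> norm a * norm b * K"
    by (rule exI[of _ 1]) (simp add: norm_matrix_matrix_mult_le)
qed (simp_all add: matrix_matrix_mult_def vec_eq_iff algebra_simps sum.distrib sum_distrib_left)

lemmas has_vector_derivative_mv [derivative_intros] =
  bounded_bilinear.has_vector_derivative[OF bounded_bilinear_matrix_vector_mult]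

lemmas has_vector_derivative_mm [derivative_intros] =
  bounded_bilinear.has_vector_derivative[OF bounded_bilinear_matrix_matrix_mult]

lemmas continuous_on_mv [continuous_intros] =
  bounded_bilinear.continuous_on[OF bounded_bilinear_matrix_vector_mult]

lemmas continuous_on_mm [continuous_intros] =
  bounded_bilinear.continuous_on[OF bounded_bilinear_matrix_matrix_mult]

lemma bounded_linear_transpose: "bounded_linear (transpose :: real ^ 'n ^ 'm \<Rightarrow> real ^ 'm ^ 'n)"
proof (rule bounded_linear_intro[where K=1])
  fix x :: "real ^ 'n ^ 'm"
  show "norm (transpose x) \<le> norm x * 1" by (simp add: norm_transpose)
qed (simp_all add: vec_eq_iff transpose_def)

lemmas has_vector_derivative_transpose [derivative_intros] =
  bounded_linear.has_vector_derivative[OF bounded_linear_transpose]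

lemmas continuous_on_transpose [continuous_intros] =
  bounded_linear.continuous_on[OF bounded_linear_transpose]

lemma inner_mv: "x \<bullet> (A *v y) = (transpose A *v x) \<bullet> y" for A :: "real ^ 'n ^ 'm"
  by (metis dot_lmul_matrix vector_transpose_matrix transpose_transpose)

lemma has_vector_derivative_inner [derivative_intros]:
  assumes "(f has_vector_derivative f') (at t within S)" "(g has_vector_derivative g') (at t within S)"
  shows "((\<lambda>s. f s \<bullet> g s) has_vector_derivative (f t \<bullet> g' + f' \<bullet> g t)) (at t within S)"
  by (rule bounded_bilinear.has_vector_derivative[OF bounded_bilinear_inner assms])

section \<open>Six-dimensional vectors as pairs of blocks\<close>

definition upper :: "vec6 \<Rightarrow> vec3" where "upper x = (\<chi> i. x $ Inl i)"
definition lower :: "vec6 \<Rightarrow> vec3" where "lower x = (\<chi> i. x $ Inr i)"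

lemma block_vec_upper_lower: "block_vec (upper x) (lower x) = x"
  by (simp add: block_vec_def upper_def lower_def vec_eq_iff split: sum.split)

lemma block_vec_nth [simp]: "block_vec u v $ Inl i = u $ i" "block_vec u v $ Inr i = v $ i"
  by (simp_all add: block_vec_def)

lemma sum_UNIV_Plus: "(\<Sum>i\<in>UNIV. f i) = (\<Sum>i\<in>UNIV. f (Inl i)) + (\<Sum>i\<in>UNIV. f (Inr i))"
  for f :: "'a::finite + 'b::finite \<Rightarrow> 'c::comm_monoid_add"
  unfolding UNIV_Plus_UNIV[symmetric] by (simp add: sum.Plus del: UNIV_Plus_UNIV)

lemma vec6_eqI: "\<lbrakk>\<And>i. x $ Inl i = y $ Inl i; \<And>i. x $ Inr i = y $ Inr i\<rbrakk> \<Longrightarrow> x = (y :: real ^ (3 + 3))"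
  unfolding vec_eq_iff by (metis sum.exhaust)

lemma inner_block_vec: "block_vec a b \<bullet> block_vec c d = a \<bullet> c + b \<bullet> d"
  by (simp add: inner_vec_def sum_UNIV_Plus)

lemma upper_block_vec [simp]: "upper (block_vec a b) = a"
  by (simp add: upper_def vec_eq_iff)

lemma lower_block_vec [simp]: "lower (block_vec a b) = b"
  by (simp add: lower_def vec_eq_iff)

lemma block_vec_add: "block_vec a b + block_vec c d = block_vec (a + c) (b + d)"
  by (rule vec6_eqI) simp_all

lemma block_vec_diff: "block_vec a b - block_vec c d = block_vec (a - c) (b - d)"
  by (rule vec6_eqI) simp_all

lemma block_vec_minus: "- block_vec a b = block_vec (- a) (- b)"
  by (rule vec6_eqI) simp_all

lemma block_vec_0 [simp]: "block_vec 0 0 = 0"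
  by (rule vec6_eqI) simp_all

lemma block_vec_scaleR: "r *\<^sub>R block_vec a b = block_vec (r *\<^sub>R a) (r *\<^sub>R b)"
  by (rule vec6_eqI) simp_all

lemma norm_block_vec_sq: "(norm (block_vec a b))\<^sup>2 = (norm a)\<^sup>2 + (norm b)\<^sup>2"
  by (simp add: power2_norm_eq_inner inner_block_vec)

lemma norm_block_vec_le: "norm (block_vec a b) \<le> norm a + norm b"
  by (rule power2_le_imp_le) (auto simp: norm_block_vec_sq power2_sum)

lemma norm_block_vec_ge: "norm a \<le> norm (block_vec a b)" "norm b \<le> norm (block_vec a b)"
  by (rule power2_le_imp_le; simp add: norm_block_vec_sq)+

lemma norm_block_vec_0: "norm (block_vec 0 b) = norm b"
  using norm_block_vec_sq[of 0 b] by (simp add: power2_eq_iff_nonneg)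

lemma bounded_linear_block_vec: "bounded_linear (\<lambda>u. block_vec (fst u) (snd u))"
proof (rule bounded_linear_intro[where K=2])
  fix x :: "vec3 \<times> vec3"
  have "norm (block_vec (fst x) (snd x)) \<le> norm (fst x) + norm (snd x)" by (rule norm_block_vec_le)
  also have "\<dots> \<le> norm x * 2" using norm_fst_le[of "fst x" "snd x"] norm_snd_le[of "snd x" "fst x"] by simp
  finally show "norm (block_vec (fst x) (snd x)) \<le> norm x * 2" .
qed (simp_all add: block_vec_add block_vec_scaleR)

lemma has_vector_derivative_block_vec [derivative_intros]:
  assumes "(f has_vector_derivative f') (at t within S)" "(g has_vector_derivative g') (at t within S)"
  shows "((\<lambda>s. block_vec (f s) (g s)) has_vector_derivative block_vec f' g') (at t within S)"
  using bounded_linear.has_vector_derivative[OF bounded_linear_block_vec has_vector_derivative_Pair[OF assms]]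
  by simp

lemma continuous_on_block_vec [continuous_intros]:
  assumes "continuous_on S f" "continuous_on S g"
  shows "continuous_on S (\<lambda>s. block_vec (f s) (g s))"
  using bounded_linear.continuous_on[OF bounded_linear_block_vec continuous_on_Pair[OF assms]] by simp

lemma block_mat_mult_block_vec:
  "block_mat A B C D *v block_vec u v = block_vec (A *v u + B *v v) (C *v u + D *v v)"
  by (rule vec6_eqI) (simp_all add: block_mat_def matrix_vector_mult_def sum_UNIV_Plus)

lemma transpose_block_mat:
  "transpose (block_mat A B C D) = block_mat (transpose A) (transpose C) (transpose B) (transpose D)"
  by (simp add: block_mat_def transpose_def vec_eq_iff split: sum.splits)

lemma transpose_uminus: "transpose (- A) = - transpose (A :: real ^ 'n ^ 'm)"
  by (simp add: transpose_def vec_eq_iff)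

lemma minus_mv: "(- A) *v x = - (A *v x)" for A :: "real ^ 'n ^ 'm"
  by (simp add: matrix_vector_mult_def vec_eq_iff sum_negf)

lemma transpose_0: "transpose (0 :: real ^ 'n ^ 'm) = 0"
  by (simp add: transpose_def vec_eq_iff)

section \<open>Skew matrices and the adjoint of the error dynamics\<close>

lemma skew_nth:
  "skew x $ 1 $ 1 = 0" "skew x $ 1 $ 2 = - x $ 3" "skew x $ 1 $ 3 = x $ 2"
  "skew x $ 2 $ 1 = x $ 3" "skew x $ 2 $ 2 = 0" "skew x $ 2 $ 3 = - x $ 1"
  "skew x $ 3 $ 1 = - x $ 2" "skew x $ 3 $ 2 = x $ 1" "skew x $ 3 $ 3 = 0"
  by (simp_all add: skew_def matrix_def cross3_def axis_def)

lemma transpose_skew: "transpose (skew x) = - skew x"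
  by (simp add: transpose_def vec_eq_iff forall_3 skew_nth)

lemma transpose_A_mat_mult:
  "transpose (A_mat w) *v block_vec u v = block_vec (cross3 w u) (u + cross3 w v)"
  by (simp add: A_mat_def transpose_block_mat block_mat_mult_block_vec transpose_uminus transpose_skew
      skew_mult transpose_0 transpose_mat)

lemma transpose_C_mat_mult: "transpose C_mat *v u = block_vec u 0"
  by (rule vec6_eqI) (simp_all add: C_mat_def transpose_def matrix_vector_mult_def mat_def if_distrib if_distribR
      cong: if_cong)

lemma skew_minus: "skew (- x) = - skew x"
  by (simp add: vec_eq_iff forall_3 skew_nth)

lemma skew_linear: "skew (x + y) = skew x + skew y" "skew (r *\<^sub>R x) = r *\<^sub>R skew x"
  by (simp_all add: vec_eq_iff forall_3 skew_nth)

lemma norm_skew: "norm (skew x) \<le> 2 * norm x"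
proof (rule power2_le_imp_le)
  have "(norm (skew x))\<^sup>2 = 2 * (norm x)\<^sup>2"
    by (simp add: skew_nth power2_norm_eq_inner inner_vec_def sum_3)
  then show "(norm (skew x))\<^sup>2 \<le> (2 * norm x)\<^sup>2" by (simp add: power_mult_distrib)
qed simp

lemma bounded_linear_skew: "bounded_linear skew"
  by (rule bounded_linear_intro[where K=2]) (use norm_skew in \<open>auto simp: skew_linear mult.commute\<close>)

lemmas continuous_on_skew [continuous_intros] =
  bounded_linear.continuous_on[OF bounded_linear_skew]

section \<open>Rayleigh quotients and the attitude Lyapunov function\<close>

lemma symmetric_inner_mv: "transpose B = B \<Longrightarrow> x \<bullet> (B *v y) = y \<bullet> (B *v x)"
  for B :: "real ^ 'n ^ 'n"
  using inner_mv[of x B y] by (simp add: inner_commute)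

text \<open>The minimiser \<open>v\<close> of the quadratic form on the unit sphere is an
  eigenvector: the form minus \<mu> times the squared norm is nonnegative and vanishes at
  \<open>v\<close>, so its first-order term in every direction \<open>w\<close> has to
  vanish.\<close>

lemma symmetric_Rayleigh_min:
  fixes B :: "real ^ 'n ^ 'n"
  assumes sym: "transpose B = B"
  obtains \<mu> where "\<mu> \<in> eigenvalues B" "\<And>x. \<mu> * (x \<bullet> x) \<le> x \<bullet> (B *v x)"
proof -
  have c: "continuous_on (sphere 0 1) (\<lambda>x. x \<bullet> (B *v x))"
    by (intro continuous_intros)
  have ne: "sphere (0 :: real ^ 'n) 1 \<noteq> {}" by simp
  obtain v where v: "v \<in> sphere 0 1" "\<And>x. x \<in> sphere 0 1 \<Longrightarrow> v \<bullet> (B *v v) \<le> x \<bullet> (B *v x)"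
    using continuous_attains_inf[OF compact_sphere ne c] by blast
  define \<mu> where "\<mu> = v \<bullet> (B *v v)"
  have vv: "v \<bullet> v = 1" "v \<noteq> 0" using v(1) by (auto simp: dot_square_norm)
  have low: "\<mu> * (x \<bullet> x) \<le> x \<bullet> (B *v x)" for x
  proof (cases "x = 0")
    case False
    define y where "y = (1 / norm x) *\<^sub>R x"
    have y: "y \<in> sphere 0 1" "x = norm x *\<^sub>R y" using False by (auto simp: y_def)
    have "\<mu> \<le> y \<bullet> (B *v y)" using v(2)[OF y(1)] by (simp add: \<mu>_def)
    then have "(norm x)\<^sup>2 * \<mu> \<le> (norm x)\<^sup>2 * (y \<bullet> (B *v y))" by (intro mult_left_mono) auto
    also have "\<dots> = x \<bullet> (B *v x)"
    proof -
      have "x \<bullet> (B *v x) = (norm x *\<^sub>R y) \<bullet> (B *v (norm x *\<^sub>R y))" by (simp only: y(2)[symmetric])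
      then show ?thesis by (simp add: matrix_vector_mult_scaleR power2_eq_square)
    qed
    finally show ?thesis by (simp add: dot_square_norm mult.commute)
  qed simp
  have "(B *v v - \<mu> *\<^sub>R v) \<bullet> w = 0" for w
  proof (rule ccontr)
    assume ne: "(B *v v - \<mu> *\<^sub>R v) \<bullet> w \<noteq> 0"
    define a where "a = w \<bullet> (B *v v) - \<mu> * (w \<bullet> v)"
    define b where "b = w \<bullet> (B *v w) - \<mu> * (w \<bullet> w)"
    have a: "a \<noteq> 0" using ne by (simp add: a_def inner_diff_left inner_commute[of w])
    have b: "b \<ge> 0" using low[of w] by (simp add: b_def)
    have q: "2 * t * a + t\<^sup>2 * b \<ge> 0" for t
      using low[of "v + t *\<^sub>R w"] symmetric_inner_mv[OF sym, of v w] vv \<mu>_def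
      by (simp add: a_def b_def matrix_vector_mult_scaleR algebra_simps inner_add_left inner_add_right
          power2_eq_square inner_commute)
    \<comment> \<open>Close to the minimiser of \<open>2 * t * a + t\<^sup>2 * b\<close>, but with
      \<open>b + 1\<close> instead of \<open>b\<close>, which may be zero. The value is negative at
      this \<open>t\<close>.\<close>
    define t where "t = - a / (b + 1)"
    have t: "t * (b + 1) = - a" using b by (simp add: t_def)
    have "(2 * t * a + t\<^sup>2 * b) * (b + 1)\<^sup>2 = - (a\<^sup>2 * (b + 2))" using t by algebra
    moreover have "0 \<le> (2 * t * a + t\<^sup>2 * b) * (b + 1)\<^sup>2" using q[of t] by simp
    moreover have "0 < a\<^sup>2 * (b + 2)" using a b by simp
    ultimately show False by linarith
  qed
  then have "B *v v = \<mu> *\<^sub>R v" using inner_eq_zero_iff by force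
  then have "\<mu> \<in> eigenvalues B" using vv by (auto simp: eigenvalues_def)
  then show thesis using low by (rule that)
qed

lemma symmetric_nth:
  fixes B :: "real ^ 'n ^ 'n"
  assumes "transpose B = B"
  shows "B $ i $ j = B $ j $ i"
  using arg_cong[OF assms, of "\<lambda>A. A $ j $ i"] by (simp add: transpose_def)

text \<open>Eigenvectors of distinct eigenvalues are orthogonal, hence independent. Finiteness is
  what gives \<open>Min\<close> and \<open>Max\<close> in \<open>lambda_min\<close> and
  \<open>lambda_max\<close> their meaning.\<close>

lemma finite_eigenvalues_symmetric:
  fixes B :: "real ^ 'n ^ 'n"
  assumes sym: "transpose B = B"
  shows "finite (eigenvalues B)"
proof -
  have "\<forall>l. \<exists>v. l \<in> eigenvalues B \<longrightarrow> v \<noteq> 0 \<and> B *v v = l *\<^sub>R v" by (auto simp: eigenvalues_def)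
  then obtain e where e: "\<And>l. l \<in> eigenvalues B \<Longrightarrow> e l \<noteq> 0 \<and> B *v e l = l *\<^sub>R e l" by metis
  have orth: "e l \<bullet> e m = 0" if "l \<in> eigenvalues B" "m \<in> eigenvalues B" "l \<noteq> m" for l m
    using symmetric_inner_mv[OF sym, of "e l" "e m"] e[OF that(1)] e[OF that(2)] that(3)
    by (simp add: inner_commute)
  have inj: "inj_on e (eigenvalues B)"
    by (rule inj_onI) (metis e inner_eq_zero_iff orth)
  have "pairwise orthogonal (e ` eigenvalues B)"
    using orth by (auto simp: pairwise_def orthogonal_def)
  then have "independent (e ` eigenvalues B)"
    by (rule pairwise_orthogonal_independent) (use e in auto)
  then have "finite (e ` eigenvalues B)" using independent_bound by blast
  then show ?thesis using inj finite_imageD by blast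
qed

lemma Rayleigh_bounds:
  fixes B :: "real ^ 'n ^ 'n"
  assumes sym: "transpose B = B"
  shows "lambda_min B * (x \<bullet> x) \<le> x \<bullet> (B *v x)" "x \<bullet> (B *v x) \<le> lambda_max B * (x \<bullet> x)"
    "lambda_min B \<in> eigenvalues B" "lambda_min B \<le> lambda_max B"
proof -
  note fin = finite_eigenvalues_symmetric[OF sym]
  have nsym: "transpose (- B) = - B" using sym by (simp add: transpose_uminus)
  obtain \<mu> where \<mu>: "\<mu> \<in> eigenvalues B" "\<And>x. \<mu> * (x \<bullet> x) \<le> x \<bullet> (B *v x)"
    using symmetric_Rayleigh_min[OF sym] by metis
  \<comment> \<open>The upper bound is the lower bound for \<open>- B\<close>.\<close>
  obtain \<nu> where \<nu>: "\<nu> \<in> eigenvalues (- B)" "\<And>x. \<nu> * (x \<bullet> x) \<le> x \<bullet> (- B *v x)"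
    using symmetric_Rayleigh_min[OF nsym] by metis
  obtain w where w: "w \<noteq> 0" "- (B *v w) = \<nu> *\<^sub>R w" using \<nu>(1) by (auto simp: eigenvalues_def minus_mv)
  have "B *v w = (- \<nu>) *\<^sub>R w" using w(2) by (metis minus_minus scaleR_minus_left)
  then have \<nu>': "- \<nu> \<in> eigenvalues B" using w(1) unfolding eigenvalues_def by blast
  have l: "lambda_min B \<le> \<mu>" "- \<nu> \<le> lambda_max B" "lambda_min B \<le> lambda_max B"
    unfolding lambda_min_def lambda_max_def using fin \<mu>(1) \<nu>' by (auto intro: Min_le Max_ge order_trans)
  show "lambda_min B * (x \<bullet> x) \<le> x \<bullet> (B *v x)"
    using \<mu>(2)[of x] l(1) by (meson inner_ge_zero mult_right_mono order_trans)
  have "- \<nu> * (x \<bullet> x) \<le> lambda_max B * (x \<bullet> x)" using l(2) by (intro mult_right_mono) auto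
  then show "x \<bullet> (B *v x) \<le> lambda_max B * (x \<bullet> x)" using \<nu>(2)[of x] by (simp add: minus_mv)
  show "lambda_min B \<le> lambda_max B" by (rule l)
  show "lambda_min B \<in> eigenvalues B"
    unfolding lambda_min_def using fin \<mu>(1) by (intro Min_in) auto
qed

lemma pos_def_lambda_min_pos:
  assumes "pos_def B"
  shows "0 < lambda_min B"
proof -
  have sym: "transpose B = B" and pos: "\<And>x. x \<noteq> 0 \<Longrightarrow> x \<bullet> (B *v x) > 0"
    using assms by (auto simp: pos_def_def)
  obtain v where "v \<noteq> 0" "B *v v = lambda_min B *\<^sub>R v"
    using Rayleigh_bounds(3)[OF sym] by (auto simp: eigenvalues_def)
  then show ?thesis using pos[of v] inner_ge_zero[of v] by (simp add: zero_less_mult_iff not_less[symmetric] del: inner_ge_zero)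
qed

text \<open>Every entry of a rotation is its own cofactor: rotations commute with the cross product,
  so each column is the cross product of the other two.\<close>

lemma rotation_matrix_entries:
  assumes "rotation_matrix (R :: mat3)"
  shows "R$1$1 = R$2$2 * R$3$3 - R$2$3 * R$3$2" "R$1$2 = R$2$3 * R$3$1 - R$2$1 * R$3$3"
    "R$1$3 = R$2$1 * R$3$2 - R$2$2 * R$3$1" "R$2$1 = R$1$3 * R$3$2 - R$1$2 * R$3$3"
    "R$2$2 = R$1$1 * R$3$3 - R$1$3 * R$3$1" "R$2$3 = R$1$2 * R$3$1 - R$1$1 * R$3$2"
    "R$3$1 = R$1$2 * R$2$3 - R$1$3 * R$2$2" "R$3$2 = R$1$3 * R$2$1 - R$1$1 * R$2$3"
    "R$3$3 = R$1$1 * R$2$2 - R$1$2 * R$2$1"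
proof -
  have a: "cross3 (R *v axis i 1) (R *v axis j 1) = R *v (cross3 (axis i 1) (axis j 1))" for i j
    by (rule cross_rotation_matrix[OF assms])
  note a12 = a[of 1 2] and a23 = a[of 2 3] and a31 = a[of 3 1]
  show "R$1$1 = R$2$2 * R$3$3 - R$2$3 * R$3$2" "R$2$1 = R$1$3 * R$3$2 - R$1$2 * R$3$3"
    "R$3$1 = R$1$2 * R$2$3 - R$1$3 * R$2$2"
    using a23 by (simp_all add: vec_eq_iff forall_3 cross3_def axis_def matrix_vector_mult_def sum_3 mult.commute)
  show "R$1$2 = R$2$3 * R$3$1 - R$2$1 * R$3$3" "R$2$2 = R$1$1 * R$3$3 - R$1$3 * R$3$1"
    "R$3$2 = R$1$3 * R$2$1 - R$1$1 * R$2$3"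
    using a31 by (simp_all add: vec_eq_iff forall_3 cross3_def axis_def matrix_vector_mult_def sum_3 mult.commute)
  show "R$1$3 = R$2$1 * R$3$2 - R$2$2 * R$3$1" "R$2$3 = R$1$2 * R$3$1 - R$1$1 * R$3$2"
    "R$3$3 = R$1$1 * R$2$2 - R$1$2 * R$2$1"
    using a12 by (simp_all add: vec_eq_iff forall_3 cross3_def axis_def matrix_vector_mult_def sum_3 mult.commute)
qed

lemma rotation_matrix_transpose_mult:
  assumes "rotation_matrix R"
  shows "transpose R ** R = mat 1" "R ** transpose R = mat 1"
  using assms by (auto simp: rotation_matrix_def orthogonal_matrix_def)

lemma rotation_matrix_orthonormal:
  assumes "rotation_matrix (R :: mat3)"
  shows "R$1$i * R$1$j + R$2$i * R$2$j + R$3$i * R$3$j = (if i = j then 1 else 0)"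
    "R$i$1 * R$j$1 + R$i$2 * R$j$2 + R$i$3 * R$j$3 = (if i = j then 1 else 0)"
proof -
  have "(transpose R ** R) $ i $ j = (mat 1 :: mat3) $ i $ j" "(R ** transpose R) $ i $ j = (mat 1 :: mat3) $ i $ j"
    by (simp_all add: rotation_matrix_transpose_mult[OF assms])
  then show "R$1$i * R$1$j + R$2$i * R$2$j + R$3$i * R$3$j = (if i = j then 1 else 0)"
    "R$i$1 * R$j$1 + R$i$2 * R$j$2 + R$i$3 * R$j$3 = (if i = j then 1 else 0)"
    by (simp_all add: mat_def matrix_matrix_mult_def transpose_def sum_3)
qed

text \<open>In terms of the quaternion \<open>(s, q)\<close> one has \<open>rot_norm R = norm q\<close>, which turns the Lyapunov function
  \<open>trace ((mat 1 - R) ** M)\<close> into the quadratic form \<open>4 q\<^sup>T (bar_mat M) q\<close>.\<close>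

lemma rotation_matrix_quaternion:
  assumes rot: "rotation_matrix (R :: mat3)" and tr: "trace R > -1"
  obtains s and q :: "real ^ 3" where "s\<^sup>2 + q \<bullet> q = 1"
    "R$1$1 = 1 - 2 * ((q$2)\<^sup>2 + (q$3)\<^sup>2)" "R$2$2 = 1 - 2 * ((q$1)\<^sup>2 + (q$3)\<^sup>2)" "R$3$3 = 1 - 2 * ((q$1)\<^sup>2 + (q$2)\<^sup>2)"
    "R$1$2 = 2 * q$1 * q$2 - 2 * s * q$3" "R$2$1 = 2 * q$1 * q$2 + 2 * s * q$3"
    "R$1$3 = 2 * q$1 * q$3 + 2 * s * q$2" "R$3$1 = 2 * q$1 * q$3 - 2 * s * q$2"
    "R$2$3 = 2 * q$2 * q$3 - 2 * s * q$1" "R$3$2 = 2 * q$2 * q$3 + 2 * s * q$1"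
proof -
  note c = rotation_matrix_entries[OF rot]
  note o = rotation_matrix_orthonormal[OF rot]
  \<comment> \<open>The scalar part of the quaternion; the trace assumption excludes the angle
    \<open>pi\<close> and makes it positive, so that the vector part can be obtained by
    division.\<close>
  define s where "s = sqrt (1 + trace R) / 2"
  have s: "s > 0" using tr by (simp add: s_def)
  have s2: "4 * s\<^sup>2 = 1 + R$1$1 + R$2$2 + R$3$3"
    using tr by (simp add: s_def power_divide trace_def sum_3)
  define q where "q = (1 / (2 * s)) *\<^sub>R psi R"
  have q: "4 * s * q$1 = R$3$2 - R$2$3" "4 * s * q$2 = R$1$3 - R$3$1" "4 * s * q$3 = R$2$1 - R$1$2"
    using s by (simp_all add: q_def psi_def)
  \<comment> \<open>Products of components of \<open>q\<close> are compared after multiplication by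
    the nonzero \<open>4 * s\<^sup>2\<close>; what remains are polynomial consequences of
    orthonormality and of the cofactor relations.\<close>
  have off1: "(R$3$2 - R$2$3) * (R$1$3 - R$3$1) = (R$1$2 + R$2$1) * (4 * s\<^sup>2)"
    unfolding s2 using o(1)[of 1 2, simplified] o(2)[of 1 2, simplified] c(2) c(4) by algebra
  have off2: "(R$3$2 - R$2$3) * (R$2$1 - R$1$2) = (R$1$3 + R$3$1) * (4 * s\<^sup>2)"
    unfolding s2 using o(1)[of 1 3, simplified] o(2)[of 1 3, simplified] c(3) c(7) by algebra
  have off3: "(R$1$3 - R$3$1) * (R$2$1 - R$1$2) = (R$2$3 + R$3$2) * (4 * s\<^sup>2)"
    unfolding s2 using o(1)[of 2 3, simplified] o(2)[of 2 3, simplified] c(6) c(8) by algebra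
  note off = off1 off2 off3
  have diag1: "(R$3$2 - R$2$3)\<^sup>2 = 4 * s\<^sup>2 * (1 + R$1$1 - R$2$2 - R$3$3)"
    unfolding s2 using o(2)[of 2 2, simplified] o(2)[of 3 3, simplified] o(1)[of 1 1, simplified] c(1) by algebra
  have diag2: "(R$1$3 - R$3$1)\<^sup>2 = 4 * s\<^sup>2 * (1 + R$2$2 - R$1$1 - R$3$3)"
    unfolding s2 using o(2)[of 1 1, simplified] o(2)[of 3 3, simplified] o(1)[of 2 2, simplified] c(5) by algebra
  have diag3: "(R$2$1 - R$1$2)\<^sup>2 = 4 * s\<^sup>2 * (1 + R$3$3 - R$1$1 - R$2$2)"
    unfolding s2 using o(2)[of 1 1, simplified] o(2)[of 2 2, simplified] o(1)[of 3 3, simplified] c(9) by algebra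
  note diag = diag1 diag2 diag3
  have qq: "4 * (q$1)\<^sup>2 = 1 + R$1$1 - R$2$2 - R$3$3" "4 * (q$2)\<^sup>2 = 1 + R$2$2 - R$1$1 - R$3$3"
    "4 * (q$3)\<^sup>2 = 1 + R$3$3 - R$1$1 - R$2$2"
  proof -
    have "(4 * s\<^sup>2) * (4 * (q$1)\<^sup>2) = (4 * s * q$1)\<^sup>2" "(4 * s\<^sup>2) * (4 * (q$2)\<^sup>2) = (4 * s * q$2)\<^sup>2"
      "(4 * s\<^sup>2) * (4 * (q$3)\<^sup>2) = (4 * s * q$3)\<^sup>2" by (simp_all add: power2_eq_square)
    then show "4 * (q$1)\<^sup>2 = 1 + R$1$1 - R$2$2 - R$3$3" "4 * (q$2)\<^sup>2 = 1 + R$2$2 - R$1$1 - R$3$3"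
    "4 * (q$3)\<^sup>2 = 1 + R$3$3 - R$1$1 - R$2$2"
      unfolding q diag using s by simp_all
  qed
  have qo: "4 * (q$1 * q$2) = R$1$2 + R$2$1" "4 * (q$1 * q$3) = R$1$3 + R$3$1" "4 * (q$2 * q$3) = R$2$3 + R$3$2"
  proof -
    have "(4 * s\<^sup>2) * (4 * (q$1 * q$2)) = (4 * s * q$1) * (4 * s * q$2)"
      "(4 * s\<^sup>2) * (4 * (q$1 * q$3)) = (4 * s * q$1) * (4 * s * q$3)"
      "(4 * s\<^sup>2) * (4 * (q$2 * q$3)) = (4 * s * q$2) * (4 * s * q$3)" by (simp_all add: power2_eq_square)
    then show "4 * (q$1 * q$2) = R$1$2 + R$2$1" "4 * (q$1 * q$3) = R$1$3 + R$3$1" "4 * (q$2 * q$3) = R$2$3 + R$3$2"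
      unfolding q off using s by simp_all
  qed
  show thesis
  proof (rule that[of s q])
    show "s\<^sup>2 + q \<bullet> q = 1" using s2 qq by (simp add: inner_vec_def sum_3 power2_eq_square)
  qed (use q qq qo in \<open>simp_all add: algebra_simps\<close>)
qed

text \<open>The Frobenius form gives access to the triangle inequality and to matrix estimates. It
  also shows that the trace under the root is nonnegative.\<close>

lemma rot_norm_sq:
  assumes "rotation_matrix R"
  shows "(rot_norm R)\<^sup>2 = (1 / 8) * (norm (mat 1 - R))\<^sup>2" "(rot_norm R)\<^sup>2 = (1 / 4) * trace (mat 1 - R)"
proof -
  have n: "(norm (mat 1 - R))\<^sup>2 = (\<Sum>i\<in>UNIV. \<Sum>j\<in>UNIV. ((mat 1 - R) $ i $ j)\<^sup>2)"
    by (simp add: norm_vec_def L2_set_def sum_nonneg)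
  then have "trace (mat 1 - R) = (1 / 2) * (norm (mat 1 - R))\<^sup>2" using trace_rotation[OF assms] by simp
  moreover from this have "0 \<le> trace (mat 1 - R)" by (metis mult_nonneg_nonneg zero_le_power2 zero_le_divide_1_iff zero_le_numeral)
  ultimately show "(rot_norm R)\<^sup>2 = (1 / 4) * trace (mat 1 - R)" "(rot_norm R)\<^sup>2 = (1 / 8) * (norm (mat 1 - R))\<^sup>2"
    by (simp_all add: rot_norm_def)
qed

text \<open>With the quaternion \<open>(s, q)\<close> and \<open>B = bar_mat M\<close> one has
  \<open>psi (M ** R) = 2 *\<^sub>R (s *\<^sub>R (B *v q) - cross3 q (B *v q))\<close>. The two
  terms are orthogonal, so dropping the second leaves a lower bound with the factor
  \<open>s\<^sup>2 = 1 - (rot_norm R)\<^sup>2\<close>. This factor degenerates at rotations by the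
  angle \<open>pi\<close>, where \<open>psi\<close> can vanish away from the identity.\<close>

lemma attitude_Lyapunov_bounds:
  assumes rot: "rotation_matrix R" and lt: "rot_norm R < 1"
    and M: "transpose M = M" and pd: "pos_def (bar_mat M)"
  shows "4 * lambda_min (bar_mat M) * (rot_norm R)\<^sup>2 \<le> trace ((mat 1 - R) ** M)"
    "trace ((mat 1 - R) ** M) \<le> 4 * lambda_max (bar_mat M) * (rot_norm R)\<^sup>2"
    "4 * (1 - (rot_norm R)\<^sup>2) * (lambda_min (bar_mat M))\<^sup>2 * (rot_norm R)\<^sup>2 \<le> (norm (psi (M ** R)))\<^sup>2"
proof -
  have "0 \<le> rot_norm R" unfolding rot_norm_def
    using rot_norm_sq(2)[OF rot] by (metis real_sqrt_ge_zero zero_le_power2)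
  then have "(rot_norm R)\<^sup>2 < 1" using lt by (simp add: power_less_one_iff)
  then have tr: "trace R > -1" using rot_norm_sq(2)[OF rot] by (simp add: trace_sub trace_def mat_def sum_3)
  obtain s and q :: "real ^ 3" where sq: "s\<^sup>2 + q \<bullet> q = 1"
    and e: "R$1$1 = 1 - 2 * ((q$2)\<^sup>2 + (q$3)\<^sup>2)" "R$2$2 = 1 - 2 * ((q$1)\<^sup>2 + (q$3)\<^sup>2)" "R$3$3 = 1 - 2 * ((q$1)\<^sup>2 + (q$2)\<^sup>2)"
    "R$1$2 = 2 * q$1 * q$2 - 2 * s * q$3" "R$2$1 = 2 * q$1 * q$2 + 2 * s * q$3"
    "R$1$3 = 2 * q$1 * q$3 + 2 * s * q$2" "R$3$1 = 2 * q$1 * q$3 - 2 * s * q$2"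
    "R$2$3 = 2 * q$2 * q$3 - 2 * s * q$1" "R$3$2 = 2 * q$2 * q$3 + 2 * s * q$1"
    by (rule rotation_matrix_quaternion[OF rot tr])
  let ?B = "bar_mat M"
  have sB: "transpose ?B = ?B" using pd by (simp add: pos_def_def)
  note ray = Rayleigh_bounds(1,2)[OF sB, of q]
  have rq: "(rot_norm R)\<^sup>2 = q \<bullet> q"
    unfolding rot_norm_sq(2)[OF rot] by (simp add: trace_def sum_3 mat_def e inner_vec_def power2_eq_square)
  have Ms: "M $ 2 $ 1 = M $ 1 $ 2" "M $ 3 $ 1 = M $ 1 $ 3" "M $ 3 $ 2 = M $ 2 $ 3"
    by (rule symmetric_nth[OF M])+
  have L: "trace ((mat 1 - R) ** M) = 4 * (q \<bullet> (?B *v q))"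
    by (simp add: trace_def sum_3 mat_def e inner_vec_def bar_mat_def matrix_matrix_mult_def
        matrix_vector_mult_def Ms power2_eq_square algebra_simps)
  have P: "psi (M ** R) = 2 *\<^sub>R (s *\<^sub>R (?B *v q) - cross3 q (?B *v q))"
    by (simp add: vec_eq_iff forall_3 psi_def cross3_def trace_def sum_3 mat_def e bar_mat_def matrix_matrix_mult_def
        matrix_vector_mult_def Ms power2_eq_square field_simps)
  show "4 * lambda_min ?B * (rot_norm R)\<^sup>2 \<le> trace ((mat 1 - R) ** M)"
    "trace ((mat 1 - R) ** M) \<le> 4 * lambda_max ?B * (rot_norm R)\<^sup>2"
    using ray unfolding L rq by simp_all
  have orth: "(?B *v q) \<bullet> cross3 q (?B *v q) = 0" by (simp add: dot_cross_self)
  have "(norm (psi (M ** R)))\<^sup>2 = 4 * ((norm (s *\<^sub>R (?B *v q)))\<^sup>2 + (norm (cross3 q (?B *v q)))\<^sup>2)"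
    unfolding P power2_norm_eq_inner using orth
    by (simp add: inner_diff_left inner_diff_right inner_commute algebra_simps power2_eq_square)
  then have 1: "(norm (psi (M ** R)))\<^sup>2 \<ge> 4 * (s\<^sup>2 * (norm (?B *v q))\<^sup>2)"
    by (simp add: power_mult_distrib)
  have "lambda_min ?B * (norm q)\<^sup>2 \<le> norm q * norm (?B *v q)"
    using ray(1) Cauchy_Schwarz_ineq2[of q "?B *v q"] by (simp add: dot_square_norm)
  then have "lambda_min ?B * norm q \<le> norm (?B *v q)"
    by (cases "q = 0") (simp_all add: power2_eq_square)
  then have "(lambda_min ?B * norm q)\<^sup>2 \<le> (norm (?B *v q))\<^sup>2"
    using pos_def_lambda_min_pos[OF pd] by (intro power_mono) auto
  then have "4 * (s\<^sup>2 * (lambda_min ?B * norm q)\<^sup>2) \<le> 4 * (s\<^sup>2 * (norm (?B *v q))\<^sup>2)"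
    by (intro mult_left_mono) auto
  moreover have "s\<^sup>2 = 1 - (rot_norm R)\<^sup>2" "(norm q)\<^sup>2 = (rot_norm R)\<^sup>2" using sq rq by (simp_all add: dot_square_norm)
  ultimately have "4 * ((1 - (rot_norm R)\<^sup>2) * ((lambda_min ?B)\<^sup>2 * (rot_norm R)\<^sup>2)) \<le> (norm (psi (M ** R)))\<^sup>2"
    using 1 by (simp add: power_mult_distrib)
  then show "4 * (1 - (rot_norm R)\<^sup>2) * (lambda_min ?B)\<^sup>2 * (rot_norm R)\<^sup>2 \<le> (norm (psi (M ** R)))\<^sup>2"
    by (simp only: mult.assoc)
qed

text \<open>Only the antisymmetric part of \<open>B\<close> pairs with a skew matrix. This is how
  \<open>psi\<close> enters the derivative of the Lyapunov function.\<close>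

lemma trace_mult_skew: "trace (B ** skew x) = - 2 * (psi B \<bullet> x)"
  by (simp add: trace_def sum_3 matrix_matrix_mult_def skew_nth psi_def inner_vec_def field_simps)

lemma norm_psi_le: "norm (psi B) \<le> norm B"
proof -
  have *: "(a - b)\<^sup>2 \<le> 2 * a\<^sup>2 + 2 * b\<^sup>2" for a b :: real
    using zero_le_power2[of "a + b"] unfolding power2_sum power2_diff by linarith
  have n: "0 \<le> (B$i$j)\<^sup>2" for i j by simp
  have e1: "(norm (psi B))\<^sup>2 = ((B$3$2 - B$2$3)\<^sup>2 + (B$1$3 - B$3$1)\<^sup>2 + (B$2$1 - B$1$2)\<^sup>2) / 4"
    unfolding power2_norm_eq_inner by (simp add: psi_def inner_vec_def sum_3 power2_eq_square add_divide_distrib)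
  have e2: "(norm B)\<^sup>2 = (B$1$1)\<^sup>2 + (B$1$2)\<^sup>2 + (B$1$3)\<^sup>2 + (B$2$1)\<^sup>2 + (B$2$2)\<^sup>2 + (B$2$3)\<^sup>2
      + (B$3$1)\<^sup>2 + (B$3$2)\<^sup>2 + (B$3$3)\<^sup>2"
    unfolding power2_norm_eq_inner by (simp add: inner_vec_def sum_3 power2_eq_square)
  \<comment> \<open>With the squares of the entries as atoms the claim is linear.\<close>
  have gen: "(x + y + z) / 4 \<le> a + b + c + d + e + f + g + h + i"
    if "x \<le> 2 * h + 2 * f" "y \<le> 2 * c + 2 * g" "z \<le> 2 * d + 2 * b" "0 \<le> a" "0 \<le> b" "0 \<le> c" "0 \<le> d" "0 \<le> e" "0 \<le> f" "0 \<le> g" "0 \<le> h" "0 \<le> i"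
    for x y z a b c d e f g h i :: real
  proof -
    have "(x + y + z) / 4 \<le> (h + f + c + g + d + b) / 2" using that(1-3) by (simp add: field_simps)
    then show ?thesis using that(4-12) by (simp add: field_simps)
  qed
  have "(norm (psi B))\<^sup>2 \<le> (norm B)\<^sup>2"
    unfolding e1 e2 by (rule gen[OF * * * n n n n n n n n n])
  then show ?thesis by (simp add: power2_le_iff_abs_le)
qed

lemma bounded_linear_psi: "bounded_linear psi"
proof (rule bounded_linear_intro[where K=1])
  show "norm (psi B) \<le> norm B * 1" for B by (simp add: norm_psi_le)
qed (simp_all add: psi_def vec_eq_iff forall_3 algebra_simps)

lemma bounded_linear_trace: "bounded_linear (trace :: real ^ 'n ^ 'n \<Rightarrow> real)"
  unfolding trace_def by (intro bounded_linear_sum bounded_linear_compose[OF bounded_linear_vec_nth] bounded_linear_vec_nth)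

lemma psi_symmetric:
  assumes "transpose M = M"
  shows "psi M = 0"
  using symmetric_nth[OF assms, of 2 1] symmetric_nth[OF assms, of 3 1] symmetric_nth[OF assms, of 3 2]
  by (simp add: psi_def vec_eq_iff forall_3)

lemma norm_psi_diff_le: "norm (psi (M ** R) - psi (M ** S)) \<le> norm M * norm (R - S)"
proof -
  interpret p: bounded_linear psi by (rule bounded_linear_psi)
  have "psi (M ** R) - psi (M ** S) = psi (M ** (R - S))"
    by (simp add: p.diff[symmetric] bounded_bilinear.diff_right[OF bounded_bilinear_matrix_matrix_mult])
  then show ?thesis by (metis norm_psi_le norm_matrix_matrix_mult_le order_trans)
qed

section \<open>Positive definiteness from non-collinear landmarks\<close>

lemma inner_outer_mv: "x \<bullet> (outer u v *v y) = (x \<bullet> u) * (v \<bullet> y)"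
  by (simp add: outer_def matrix_vector_mult_def inner_vec_def sum_3 algebra_simps)

lemma transpose_outer: "transpose (outer u v) = outer v u"
  by (simp add: outer_def transpose_def vec_eq_iff mult.commute)

lemma trace_outer: "trace (outer u v) = u \<bullet> v"
  by (simp add: outer_def trace_def inner_vec_def)

text \<open>Lagrange's identity turns each
  \<open>(y \<bullet> y) * (x \<bullet> x) - (y \<bullet> x)\<^sup>2\<close> into a squared cross
  product, so definiteness becomes the question whether all \<open>y i\<close> are parallel to a
  common \<open>x\<close>.\<close>

lemma bar_mat_sum_outer:
  assumes M: "M = (\<Sum>i\<in>I. k i *\<^sub>R outer (y i) (y i))" and "finite I"
  shows "transpose M = M"
    "x \<bullet> (bar_mat M *v x) = (1 / 2) * (\<Sum>i\<in>I. k i * (norm (cross3 (y i) x))\<^sup>2)"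
proof -
  interpret t: bounded_linear "transpose :: mat3 \<Rightarrow> mat3" by (rule bounded_linear_transpose)
  show "transpose M = M" unfolding M by (simp add: t.sum t.scaleR transpose_outer)
  have "trace M = (\<Sum>i\<in>I. k i * (y i \<bullet> y i))"
    unfolding M by (induction I rule: infinite_finite_induct)
      (simp_all add: trace_add trace_outer[symmetric] trace_def sum_distrib_left sum.distrib)
  moreover have "x \<bullet> (M *v x) = (\<Sum>i\<in>I. k i * (y i \<bullet> x)\<^sup>2)"
    unfolding M
    by (induction I rule: infinite_finite_induct)
      (simp_all add: matrix_vector_mult_add_rdistrib inner_add_right scaleR_matrix_vector_assoc[symmetric]
        inner_outer_mv power2_eq_square inner_commute)
  ultimately have "x \<bullet> (bar_mat M *v x)
    = (1 / 2) * ((\<Sum>i\<in>I. k i * (y i \<bullet> y i)) * (x \<bullet> x) - (\<Sum>i\<in>I. k i * (y i \<bullet> x)\<^sup>2))"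
    by (simp add: bar_mat_def scaleR_matrix_vector_assoc[symmetric] matrix_vector_mult_diff_rdistrib
        inner_diff_right)
  also have "\<dots> = (1 / 2) * (\<Sum>i\<in>I. k i * ((y i \<bullet> y i) * (x \<bullet> x) - (y i \<bullet> x)\<^sup>2))"
    by (simp add: sum_distrib_right sum_subtractf[symmetric] right_diff_distrib mult.assoc)
  also have "\<dots> = (1 / 2) * (\<Sum>i\<in>I. k i * (norm (cross3 (y i) x))\<^sup>2)"
    by (simp add: norm_cross dot_square_norm power_mult_distrib)
  finally show "x \<bullet> (bar_mat M *v x) = (1 / 2) * (\<Sum>i\<in>I. k i * (norm (cross3 (y i) x))\<^sup>2)" .
qed

lemma landmark_mat_symmetric: "transpose (landmark_mat N k p) = landmark_mat N k p"
  by (rule bar_mat_sum_outer(1)[of _ k "\<lambda>i. p i - landmark_center N k p" "{1..N}"])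
     (simp_all add: landmark_mat_def Let_def)

text \<open>If the form vanished at a nonzero \<open>x\<close>, all landmarks would lie on the line
  through the centre with direction \<open>x\<close>.\<close>

lemma pos_def_bar_landmark_mat:
  assumes k_pos: "\<And>i. i \<in> {1..N} \<Longrightarrow> k i > 0"
    and noncollinear: "\<exists>a\<in>{1..N}. \<exists>b\<in>{1..N}. \<exists>c\<in>{1..N}. \<not> collinear {p a, p b, p c}"
  shows "pos_def (bar_mat (landmark_mat N k p))"
  unfolding pos_def_def
proof (intro conjI allI impI)
  let ?M = "landmark_mat N k p"
  define c where "c = landmark_center N k p"
  have M: "?M = (\<Sum>i\<in>{1..N}. k i *\<^sub>R outer (p i - c) (p i - c))"
    by (simp add: landmark_mat_def Let_def c_def)
  show "transpose (bar_mat ?M) = bar_mat ?M"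
  proof -
    have "?M $ i $ j = ?M $ j $ i" for i j by (rule symmetric_nth[OF landmark_mat_symmetric])
    then show ?thesis by (simp add: bar_mat_def transpose_def vec_eq_iff mat_def)
  qed
  fix x :: vec3 assume x: "x \<noteq> 0"
  have "\<exists>i\<in>{1..N}. cross3 (p i - c) x \<noteq> 0"
  proof (rule ccontr)
    assume "\<not> ?thesis"
    then have z: "\<And>i. i \<in> {1..N} \<Longrightarrow> cross3 (p i - c) x = 0" by blast
    have "\<exists>r. p i - c = r *\<^sub>R x" if "i \<in> {1..N}" for i
    proof -
      have "collinear {0, x, p i - c}" using z[OF that] cross_eq_0[of x "p i - c"] cross_skew[of x "p i - c"] by simp
      then show ?thesis using x unfolding collinear_lemma by (metis scaleR_zero_left)
    qed
    then obtain r where r: "\<And>i. i \<in> {1..N} \<Longrightarrow> p i - c = r i *\<^sub>R x" by metis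
    then have r': "\<And>i. i \<in> {1..N} \<Longrightarrow> p i = c + r i *\<^sub>R x" by (metis add.commute diff_add_cancel)
    have "collinear {p a, p b, p d}" if abd: "a \<in> {1..N}" "b \<in> {1..N}" "d \<in> {1..N}" for a b d
      unfolding collinear_def
    proof (intro exI[of _ x] ballI)
      fix u v assume "u \<in> {p a, p b, p d}" "v \<in> {p a, p b, p d}"
      then obtain i j where ij: "i \<in> {1..N}" "j \<in> {1..N}" "u = p i" "v = p j" using abd by blast
      show "\<exists>e. u - v = e *\<^sub>R x"
        by (rule exI[of _ "r i - r j"]) (use ij r' in \<open>simp add: scaleR_diff_left\<close>)
    qed
    then show False using noncollinear by blast
  qed
  then obtain i where i: "i \<in> {1..N}" "cross3 (p i - c) x \<noteq> 0" by blast
  have "0 < (\<Sum>i\<in>{1..N}. k i * (norm (cross3 (p i - c) x))\<^sup>2)"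
    by (rule sum_pos2[of _ i]) (use i k_pos in \<open>auto simp: less_imp_le\<close>)
  then show "0 < x \<bullet> (bar_mat ?M *v x)"
    using bar_mat_sum_outer(2)[OF M, of x] by simp
qed

section \<open>The attitude subsystem\<close>

lemma vector_derivative_Lipschitz:
  fixes f :: "real \<Rightarrow> 'a::real_normed_vector"
  assumes der: "\<And>t. t \<in> {a..b} \<Longrightarrow> (f has_vector_derivative f' t) (at t within {a..b})"
    and bd: "\<And>t. t \<in> {a..b} \<Longrightarrow> norm (f' t) \<le> B" and xy: "x \<in> {a..b}" "y \<in> {a..b}"
  shows "norm (f x - f y) \<le> B * \<bar>x - y\<bar>"
proof -
  have "norm (f x - f y) \<le> B * norm (x - y)"
  proof (rule differentiable_bound[of "{a..b}" f "\<lambda>t h. h *\<^sub>R f' t"])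
    show "(f has_derivative (\<lambda>h. h *\<^sub>R f' t)) (at t within {a..b})" if "t \<in> {a..b}" for t
      using der[OF that] by (simp add: has_vector_derivative_def)
    show "onorm (\<lambda>h. h *\<^sub>R f' t) \<le> B" if "t \<in> {a..b}" for t
      using bd[OF that] by (intro onorm_le) (simp add: mult.commute[of B] mult_left_mono)
  qed (use xy in auto)
  then show ?thesis by simp
qed

text \<open>The only comparison principle used for differential inequalities: the rate is constant,
  and exponential factors are built into \<open>f\<close> beforehand.\<close>

lemma vector_derivative_upper:
  fixes f :: "real \<Rightarrow> real"
  assumes der: "\<And>t. t \<in> {a..b} \<Longrightarrow> (f has_vector_derivative f' t) (at t within {a..b})"
    and bd: "\<And>t. t \<in> {a..b} \<Longrightarrow> f' t \<le> c" and s: "s \<in> {a..b}"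
  shows "f s \<le> f a + c * (s - a)"
proof -
  have "\<exists>x\<in>{a..s}. f s - f a = (s - a) *\<^sub>R f' x"
  proof (rule mvt_very_simple)
    show "(f has_derivative (\<lambda>h. h *\<^sub>R f' x)) (at x within {a..s})" if "a \<le> x" "x \<le> s" for x
      using has_vector_derivative_within_subset[OF der[of x], of "{a..s}"] that s
      by (auto simp: has_vector_derivative_def)
  qed (use s in auto)
  then obtain x where x: "x \<in> {a..s}" "f s - f a = (s - a) * f' x" by auto
  have "(s - a) * f' x \<le> (s - a) * c" using x s by (intro mult_left_mono bd) auto
  then show ?thesis using x(2) by (simp add: mult.commute)
qed

lemma norm_rotation_matrix: "rotation_matrix (R :: mat3) \<Longrightarrow> norm R \<le> 2"
proof (rule power2_le_imp_le)
  assume R: "rotation_matrix R"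
  have "(norm R)\<^sup>2 = 3"
    using rotation_matrix_orthonormal(2)[OF R, of 1 1] rotation_matrix_orthonormal(2)[OF R, of 2 2]
      rotation_matrix_orthonormal(2)[OF R, of 3 3]
    unfolding power2_norm_eq_inner by (simp add: inner_vec_def sum_3)
  then show "(norm R)\<^sup>2 \<le> 2\<^sup>2" by simp
qed simp

lemma rot_norm_nonneg: "rotation_matrix R \<Longrightarrow> 0 \<le> rot_norm R"
  using rot_norm_sq(2)[of R] unfolding rot_norm_def by (metis real_sqrt_ge_zero zero_le_power2)

text \<open>One interval between jumps; \<eta> changes only at jumps and is therefore a
  parameter.\<close>

locale attitude_flow =
  fixes W :: "real \<Rightarrow> mat3" and \<eta> :: vec3 and a b :: real and M :: mat3
  assumes ab: "a \<le> b"
    and rot: "\<And>t. t \<in> {a..b} \<Longrightarrow> rotation_matrix (W t)"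
    and ode: "\<And>t. t \<in> {a..b} \<Longrightarrow> (W has_vector_derivative W t ** skew (- \<eta>)) (at t within {a..b})"
    and M_sym: "transpose M = M"
begin

lemma W_Lipschitz:
  assumes "s \<in> {a..b}" "t \<in> {a..b}"
  shows "norm (W s - W t) \<le> 4 * norm \<eta> * \<bar>s - t\<bar>"
proof (rule vector_derivative_Lipschitz[OF ode _ assms])
  fix t assume "t \<in> {a..b}"
  have "norm (W t ** skew (- \<eta>)) \<le> norm (W t) * norm (skew (- \<eta>))" by (rule norm_matrix_matrix_mult_le)
  also have "\<dots> \<le> 2 * (2 * norm \<eta>)"
    using norm_rotation_matrix[OF rot[OF \<open>t \<in> {a..b}\<close>]] norm_skew[of "- \<eta>"] by (intro mult_mono) auto
  finally show "norm (W t ** skew (- \<eta>)) \<le> 4 * norm \<eta>" by simp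
qed

lemma W_continuous: "continuous_on {a..b} W"
  using ode has_vector_derivative_continuous continuous_on_eq_continuous_within by blast

lemma Lyapunov_derivative:
  assumes t: "t \<in> {a..b}"
  shows "((\<lambda>t. trace ((mat 1 - W t) ** M)) has_vector_derivative - 2 * (psi (M ** W t) \<bullet> \<eta>)) (at t within {a..b})"
proof -
  have "((\<lambda>t. (mat 1 - W t) ** M) has_vector_derivative ((mat 1 - W t) ** 0 + (0 - W t ** skew (- \<eta>)) ** M)) (at t within {a..b})"
    by (intro derivative_intros ode t)
  then have "((\<lambda>t. trace ((mat 1 - W t) ** M)) has_vector_derivative
      trace ((mat 1 - W t) ** 0 + (0 - W t ** skew (- \<eta>)) ** M)) (at t within {a..b})"
    by (rule bounded_linear.has_vector_derivative[OF bounded_linear_trace])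
  moreover have "trace ((mat 1 - W t) ** 0 + (0 - W t ** skew (- \<eta>)) ** M) = - 2 * (psi (M ** W t) \<bullet> \<eta>)"
  proof -
    have "(mat 1 - W t) ** 0 + (0 - W t ** skew (- \<eta>)) ** M = (W t ** skew \<eta>) ** M"
      by (simp add: skew_minus matrix_matrix_mult_def vec_eq_iff sum_negf)
    moreover have "trace ((W t ** skew \<eta>) ** M) = trace ((M ** W t) ** skew \<eta>)"
      by (metis matrix_mul_assoc trace_mul_sym)
    ultimately show ?thesis by (simp add: trace_mult_skew)
  qed
  ultimately show ?thesis by simp
qed

lemma norm_psi_rotation:
  assumes "t \<in> {a..b}"
  shows "norm (psi (M ** W t)) \<le> norm M * norm (mat 1 - W t)"
  using norm_psi_diff_le[of M "W t" "mat 1"] by (simp add: psi_symmetric[OF M_sym] norm_minus_commute)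

text \<open>For the interval before the first jump, where \<eta> bears no relation to
  \<open>psi\<close> and the Lyapunov function may increase.\<close>

lemma Lyapunov_growth:
  assumes t: "t \<in> {a..b}"
  shows "trace ((mat 1 - W t) ** M) \<le> trace ((mat 1 - W a) ** M) + 4 * norm M * norm \<eta> * (t - a)"
proof (rule vector_derivative_upper[OF Lyapunov_derivative _ t])
  fix s assume s: "s \<in> {a..b}"
  have "norm (psi (M ** W s)) \<le> norm (M ** W s)" by (rule norm_psi_le)
  also have "\<dots> \<le> norm M * norm (W s)" by (rule norm_matrix_matrix_mult_le)
  also have "\<dots> \<le> norm M * 2" using norm_rotation_matrix[OF rot[OF s]] by (intro mult_left_mono) auto
  finally have "norm (psi (M ** W s)) * norm \<eta> \<le> (norm M * 2) * norm \<eta>" by (intro mult_right_mono) auto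
  then show "- 2 * (psi (M ** W s) \<bullet> \<eta>) \<le> 4 * norm M * norm \<eta>"
    using Cauchy_Schwarz_ineq2[of "psi (M ** W s)" \<eta>] by linarith
qed

text \<open>On the interval \<open>psi\<close> moves by at most
  \<open>norm M * (4 * norm \<eta> * TM)\<close>, and \<eta> is \<open>kR\<close> times the sampled
  value. The condition on \<open>kR\<close> makes this at most half of the norm of that value, so
  half of the decrease rate survives.\<close>

lemma Lyapunov_decrease:
  assumes t: "t \<in> {a..b}" and \<eta>: "\<eta> = kR *\<^sub>R psi (M ** W a)" and kR: "0 < kR" "kR * (8 * norm M * TM) \<le> 1"
    and TM: "b - a \<le> TM"
  shows "trace ((mat 1 - W t) ** M) \<le> trace ((mat 1 - W a) ** M) + (- kR * (norm (psi (M ** W a)))\<^sup>2) * (t - a)"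
proof (rule vector_derivative_upper[OF Lyapunov_derivative _ t])
  fix s assume s: "s \<in> {a..b}"
  let ?p = "psi (M ** W a)"
  have a: "a \<in> {a..b}" using ab by simp
  have "norm (psi (M ** W s) - ?p) \<le> norm M * norm (W s - W a)" by (rule norm_psi_diff_le)
  also have "\<dots> \<le> norm M * (4 * norm \<eta> * \<bar>s - a\<bar>)" by (intro mult_left_mono W_Lipschitz s a) auto
  also have "\<dots> \<le> norm M * (4 * norm \<eta> * TM)" using s TM by (intro mult_left_mono) auto
  also have "\<dots> = kR * (8 * norm M * TM) * norm ?p / 2" using kR(1) by (simp add: \<eta>)
  also have "\<dots> \<le> norm ?p / 2" using mult_right_mono[OF kR(2), of "norm ?p"] by (simp add: mult_ac)
  finally have "norm (psi (M ** W s) - ?p) * norm ?p \<le> norm ?p / 2 * norm ?p" by (intro mult_right_mono) auto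
  then have "- ((psi (M ** W s) - ?p) \<bullet> ?p) \<le> (norm ?p)\<^sup>2 / 2"
    using Cauchy_Schwarz_ineq2[of "psi (M ** W s) - ?p" ?p] by (simp add: power2_eq_square)
  then have "psi (M ** W s) \<bullet> ?p \<ge> (norm ?p)\<^sup>2 / 2"
    by (simp add: inner_diff_left power2_norm_eq_inner)
  then have "2 * kR * (psi (M ** W s) \<bullet> ?p) \<ge> 2 * kR * ((norm ?p)\<^sup>2 / 2)"
    using kR(1) by (intro mult_left_mono) auto
  then show "- 2 * (psi (M ** W s) \<bullet> \<eta>) \<le> - kR * (norm ?p)\<^sup>2" by (simp add: \<eta>)
qed

text \<open>Bounds the state at the first jump by the initial distance, so that the final estimate
  is proportional to it. The triangle inequality is taken in the Frobenius norm.\<close>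

lemma rot_norm_drift:
  assumes t: "t \<in> {a..b}"
  shows "(rot_norm (W t))\<^sup>2 \<le> 2 * (rot_norm (W a))\<^sup>2 + 4 * (t - a)\<^sup>2 * (norm \<eta>)\<^sup>2"
proof -
  have a: "a \<in> {a..b}" using ab by simp
  have "norm (mat 1 - W t) \<le> norm (mat 1 - W a) + norm (W t - W a)"
    by (metis diff_diff_eq2 norm_triangle_ineq4 diff_add_cancel)
  also have "norm (W t - W a) \<le> 4 * norm \<eta> * (t - a)" using W_Lipschitz[OF t a] t by simp
  finally have "(norm (mat 1 - W t))\<^sup>2 \<le> (norm (mat 1 - W a) + 4 * norm \<eta> * (t - a))\<^sup>2" by (intro power_mono) auto
  also have "\<dots> \<le> 2 * (norm (mat 1 - W a))\<^sup>2 + 2 * (4 * norm \<eta> * (t - a))\<^sup>2"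
    using zero_le_power2[of "norm (mat 1 - W a) - 4 * norm \<eta> * (t - a)"] unfolding power2_sum power2_diff by linarith
  also have "2 * (4 * norm \<eta> * (t - a))\<^sup>2 = 8 * (4 * (t - a)\<^sup>2 * (norm \<eta>)\<^sup>2)"
    unfolding power_mult_distrib by simp
  finally show ?thesis using rot_norm_sq(1)[OF rot[OF t]] rot_norm_sq(1)[OF rot[OF a]] by linarith
qed

text \<open>The lower bound of the Lyapunov function is available only while \<open>rot_norm < 1\<close>, so \<open>rot_norm\<close> could escape
  from \<open>[0, e]\<close> only by jumping over \<open>(e, 1)\<close>, which continuity excludes.\<close>

lemma rot_norm_trapped:
  assumes pd: "pos_def (bar_mat M)" and e: "e < 1" and ini: "rot_norm (W a) \<le> e"
    and L: "\<And>t. t \<in> {a..b} \<Longrightarrow> trace ((mat 1 - W t) ** M) \<le> 4 * lambda_min (bar_mat M) * e\<^sup>2"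
    and t: "t \<in> {a..b}"
  shows "rot_norm (W t) \<le> e"
proof (rule ccontr)
  assume "\<not> rot_norm (W t) \<le> e"
  \<comment> \<open>A level strictly between \<open>e\<close> and \<open>1\<close> that the
    continuous \<open>rot_norm\<close> has to attain before time \<open>t\<close>; there the lower
    bound of the Lyapunov function applies.\<close>
  define v where "v = min (rot_norm (W t)) ((1 + e) / 2)"
  have v: "e < v" "v < 1" "v \<le> rot_norm (W t)" using \<open>\<not> rot_norm (W t) \<le> e\<close> e by (auto simp: v_def min_def)
  have e0: "0 \<le> e" using ini rot_norm_nonneg[OF rot[of a]] ab by auto
  have "continuous_on {a..t} (\<lambda>t. trace (mat 1 - W t))"
    by (intro bounded_linear.continuous_on[OF bounded_linear_trace] continuous_intros
        continuous_on_subset[OF W_continuous]) (use t in auto)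
  then have "continuous_on {a..t} (\<lambda>t. rot_norm (W t))"
    unfolding rot_norm_def by (intro continuous_intros)
  then obtain c where c: "a \<le> c" "c \<le> t" "rot_norm (W c) = v"
    using IVT'[of "\<lambda>t. rot_norm (W t)" a v t] ini v t by auto
  have ct: "c \<in> {a..b}" using c t by auto
  have "4 * lambda_min (bar_mat M) * v\<^sup>2 \<le> 4 * lambda_min (bar_mat M) * e\<^sup>2"
    using attitude_Lyapunov_bounds(1)[OF rot[OF ct] _ M_sym pd] L[OF ct] c(3) v(2) by simp
  then have "v\<^sup>2 \<le> e\<^sup>2" using pos_def_lambda_min_pos[OF pd] by simp
  then show False using v(1) e0 by (simp add: power2_le_iff_abs_le)
qed

end

text \<open>The attitude part of a solution with infinitely many jumps, with one curve and one
  \<eta> per interval. The gap \<open>Tm\<close> is required only after the first jump, because the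
  initial timer value may be anything in \<open>{0..TM}\<close>.\<close>

definition attitude_run ::
  "mat3 \<Rightarrow> real \<Rightarrow> real \<Rightarrow> real \<Rightarrow> (nat \<Rightarrow> real) \<Rightarrow> (nat \<Rightarrow> real \<Rightarrow> mat3) \<Rightarrow> (nat \<Rightarrow> vec3) \<Rightarrow> bool" where
  "attitude_run M kR Tm TM t W \<eta> \<longleftrightarrow>
     (\<forall>j. t j \<le> t (Suc j) \<and> t (Suc j) - t j \<le> TM \<and> Tm \<le> t (Suc (Suc j)) - t (Suc j)) \<and>
     (\<forall>j. \<forall>s\<in>{t j..t (Suc j)}. rotation_matrix (W j s) \<and>
        (W j has_vector_derivative W j s ** skew (- \<eta> j)) (at s within {t j..t (Suc j)})) \<and>
     (\<forall>j. W (Suc j) (t (Suc j)) = W j (t (Suc j)) \<and> \<eta> (Suc j) = kR *\<^sub>R psi (M ** W j (t (Suc j))))"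

text \<open>The thresholds precede \<open>kR\<close>, and the decay constants depend on
  \<open>kR\<close> but not on the run. The Lyapunov function contracts by \<rho> from each jump to
  the next.\<close>

lemma attitude_run_decay:
  fixes M :: mat3
  assumes M: "transpose M = M" and pd: "pos_def (bar_mat M)" and T: "0 < Tm" "Tm \<le> TM" and \<epsilon>: "0 < \<epsilon>" "\<epsilon> < 1"
  shows "\<exists>\<eta>star kRstar. 0 < \<eta>star \<and> 0 < kRstar \<and> (\<forall>kR. 0 < kR \<and> kR < kRstar \<longrightarrow>
    (\<exists>C \<rho>. 0 \<le> C \<and> 0 < \<rho> \<and> \<rho> < 1 \<and> (\<forall>t W \<eta>. attitude_run M kR Tm TM t W \<eta> \<and>
       rot_norm (W 0 (t 0)) \<le> \<epsilon> * sqrt (varsigma M) \<and> norm (\<eta> 0) \<le> \<eta>star \<longrightarrow>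
       (\<forall>j. \<forall>s\<in>{t j..t (Suc j)}. (rot_norm (W j s))\<^sup>2 + (norm (\<eta> j))\<^sup>2
          \<le> C * \<rho> ^ j * ((rot_norm (W 0 (t 0)))\<^sup>2 + (norm (\<eta> 0))\<^sup>2)))))"
proof -
  define l where "l = lambda_min (bar_mat M)"
  define u where "u = lambda_max (bar_mat M)"
  have l: "0 < l" using pos_def_lambda_min_pos[OF pd] by (simp add: l_def)
  have lu: "l \<le> u" using Rayleigh_bounds(4) pd by (auto simp: l_def u_def pos_def_def)
  have u: "0 < u" using l lu by simp
  \<comment> \<open>Between \<epsilon>, which limits the initial attitude, and \<open>1\<close>,
    where the bound on \<open>psi\<close> degenerates.\<close>
  define e where "e = (1 + \<epsilon>) / 2"
  have e: "\<epsilon> < e" "e < 1" "0 < e" using \<epsilon> by (auto simp: e_def)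
  have e2: "\<epsilon>\<^sup>2 < e\<^sup>2" "e\<^sup>2 < 1" using e \<epsilon> by (auto simp: power_strict_mono power_less_one_iff)
  \<comment> \<open>The quotient of the lower bound of the squared \<open>psi\<close> and the upper
    bound of \<open>L\<close> while \<open>rot_norm\<close> is at most \<open>e\<close>.\<close>
  define \<sigma> where "\<sigma> = (1 - e\<^sup>2) * l\<^sup>2 / u"
  have \<sigma>: "0 < \<sigma>" using e2 l u by (simp add: \<sigma>_def)
  \<comment> \<open>Growth by \<open>4 * norm M * \<eta>star * TM\<close> must not lead from the
    level \<open>4 * l * \<epsilon>\<^sup>2\<close> beyond \<open>4 * l * e\<^sup>2\<close>; the
    \<open>+ 1\<close> keeps the denominator positive.\<close>
  define \<eta>star where "\<eta>star = l * (e\<^sup>2 - \<epsilon>\<^sup>2) / (norm M * TM + 1)"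
  have MT: "0 \<le> norm M * TM" using T by simp
  have \<eta>star: "0 < \<eta>star" using l e2 MT by (simp add: \<eta>star_def add_nonneg_pos)
  \<comment> \<open>The first bound keeps \<open>psi\<close> close to its sample, the second makes
    the contraction factor \<open>1 - kR * Tm * \<sigma>\<close> positive.\<close>
  define kRstar where "kRstar = min (1 / (8 * norm M * TM + 1)) (1 / (Tm * \<sigma> + 1))"
  have kRstar: "0 < kRstar" using MT T \<sigma> by (simp add: kRstar_def add_nonneg_pos)
  show ?thesis
  proof (rule exI[of _ \<eta>star], rule exI[of _ kRstar], intro conjI \<eta>star kRstar allI impI, elim conjE)
    fix kR assume kR: "0 < kR" "kR < kRstar"
    have "kR * (8 * norm M * TM + 1) \<le> 1" using kR MT by (simp add: kRstar_def pos_less_divide_eq add_nonneg_pos)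
    then have kM: "kR * (8 * norm M * TM) \<le> 1" using kR(1) by (simp add: algebra_simps)
    have "kR * (Tm * \<sigma> + 1) < 1" using kR T \<sigma> by (simp add: kRstar_def pos_less_divide_eq add_nonneg_pos)
    then have kS: "kR * Tm * \<sigma> < 1" using kR(1) by (simp add: algebra_simps)
    define \<rho> where "\<rho> = 1 - kR * Tm * \<sigma>"
    have \<rho>: "0 < \<rho>" "\<rho> < 1" using kS kR T \<sigma> by (auto simp: \<rho>_def)
    define C0 where "C0 = 2 + 4 * TM\<^sup>2"
    have C0: "0 < C0" by (simp add: C0_def add_pos_nonneg)
    define K where "K = 1 + 8 * kR\<^sup>2 * (norm M)\<^sup>2"
    have K: "0 < K" by (simp add: K_def add_pos_nonneg)
    \<comment> \<open>The first summand serves the intervals after the first jump, the second one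
      the initial interval. The division by \<rho> compensates that contraction is counted from the
      first jump; \<open>K\<close> adds the share of \<eta>, which is \<open>kR\<close> times
      \<open>psi\<close>.\<close>
    define C where "C = K * (u / l) * C0 / \<rho> + (C0 + 1)"
    have C: "0 \<le> C" using K u l C0 \<rho> by (simp add: C_def)
    show "\<exists>C \<rho>. 0 \<le> C \<and> 0 < \<rho> \<and> \<rho> < 1 \<and> (\<forall>t W \<eta>. attitude_run M kR Tm TM t W \<eta> \<and>
       rot_norm (W 0 (t 0)) \<le> \<epsilon> * sqrt (varsigma M) \<and> norm (\<eta> 0) \<le> \<eta>star \<longrightarrow>
       (\<forall>j. \<forall>s\<in>{t j..t (Suc j)}. (rot_norm (W j s))\<^sup>2 + (norm (\<eta> j))\<^sup>2
          \<le> C * \<rho> ^ j * ((rot_norm (W 0 (t 0)))\<^sup>2 + (norm (\<eta> 0))\<^sup>2)))"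
    proof (rule exI[of _ C], rule exI[of _ \<rho>], intro conjI C \<rho> allI impI ballI, elim conjE)
      fix t W \<eta> j s
      assume run: "attitude_run M kR Tm TM t W \<eta>" and R0: "rot_norm (W 0 (t 0)) \<le> \<epsilon> * sqrt (varsigma M)"
        and \<eta>0: "norm (\<eta> 0) \<le> \<eta>star" and s: "s \<in> {t j..t (Suc j)}"
      define d where "d = (rot_norm (W 0 (t 0)))\<^sup>2 + (norm (\<eta> 0))\<^sup>2"
      define L where "L j s = trace ((mat 1 - W j s) ** M)" for j s
      have tm: "t j \<le> t (Suc j)" "t (Suc j) - t j \<le> TM" "Tm \<le> t (Suc (Suc j)) - t (Suc j)" for j
        using run by (auto simp: attitude_run_def)
      have in1: "t j \<in> {t j..t (Suc j)}" "t (Suc j) \<in> {t j..t (Suc j)}" for j using tm(1) by auto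
      have af: "attitude_flow (W j) (\<eta> j) (t j) (t (Suc j)) M" for j
        using run M by unfold_locales (auto simp: attitude_run_def)
      have jump: "W (Suc j) (t (Suc j)) = W j (t (Suc j))" "\<eta> (Suc j) = kR *\<^sub>R psi (M ** W (Suc j) (t (Suc j)))" for j
        using run by (auto simp: attitude_run_def)
      note rot = attitude_flow.rot[OF af]
      note nn = rot_norm_nonneg[OF rot]
      have vs: "0 < varsigma M" "varsigma M \<le> 1" using l lu u by (auto simp: varsigma_def l_def u_def)
      have "\<epsilon> * sqrt (varsigma M) \<le> \<epsilon>" using \<epsilon> vs by simp
      then have R0e: "rot_norm (W 0 (t 0)) \<le> \<epsilon>" using R0 by linarith
      \<comment> \<open>Here \<open>varsigma M = l / u\<close> is used: it trades the factor
        \<open>u\<close> of the upper bound for the factor \<open>l\<close> that defines the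
        trapping level.\<close>
      have "(rot_norm (W 0 (t 0)))\<^sup>2 \<le> (\<epsilon> * sqrt (varsigma M))\<^sup>2"
        by (rule power_mono[OF R0 nn]) (rule in1)
      also have "\<dots> = \<epsilon>\<^sup>2 * (l / u)" using vs by (simp add: power_mult_distrib varsigma_def l_def u_def)
      finally have "4 * u * (rot_norm (W 0 (t 0)))\<^sup>2 \<le> 4 * u * (\<epsilon>\<^sup>2 * (l / u))" using u by (intro mult_left_mono) auto
      also have "\<dots> = 4 * l * \<epsilon>\<^sup>2" using u by simp
      finally have L00': "4 * u * (rot_norm (W 0 (t 0)))\<^sup>2 \<le> 4 * l * \<epsilon>\<^sup>2" .
      then have L00: "L 0 (t 0) \<le> 4 * l * \<epsilon>\<^sup>2"
      proof -
        have r1: "rot_norm (W 0 (t 0)) < 1" using R0e \<epsilon> by linarith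
        show ?thesis using attitude_Lyapunov_bounds(2)[OF rot[OF in1(1)] r1 M pd] L00' by (simp add: L_def u_def)
      qed
      have L0: "L 0 s \<le> 4 * l * e\<^sup>2" if s: "s \<in> {t 0..t (Suc 0)}" for s
      proof -
        have "L 0 s \<le> L 0 (t 0) + 4 * norm M * norm (\<eta> 0) * (s - t 0)"
          using attitude_flow.Lyapunov_growth[OF af s] by (simp add: L_def)
        also have "4 * norm M * norm (\<eta> 0) * (s - t 0) \<le> 4 * norm M * \<eta>star * TM"
          using s tm(2)[of 0] \<eta>0 \<eta>star by (intro mult_mono) auto
        also have "\<dots> \<le> 4 * (\<eta>star * (norm M * TM + 1))" using \<eta>star by (simp add: algebra_simps)
        also have "\<dots> = 4 * l * (e\<^sup>2 - \<epsilon>\<^sup>2)" using MT by (simp add: \<eta>star_def add_nonneg_pos)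
        finally show ?thesis using L00 by (simp add: algebra_simps)
      qed
      have r0: "rot_norm (W 0 s) \<le> e" if s: "s \<in> {t 0..t (Suc 0)}" for s
        by (rule attitude_flow.rot_norm_trapped[OF af pd e(2) _ _ s])
          (use R0e e L0 in \<open>auto simp: L_def l_def\<close>)
      have dec: "L (Suc j) s \<le> L (Suc j) (t (Suc j)) - kR * (norm (psi (M ** W (Suc j) (t (Suc j)))))\<^sup>2 * (s - t (Suc j))"
        if s: "s \<in> {t (Suc j)..t (Suc (Suc j))}" for j s
        using attitude_flow.Lyapunov_decrease[OF af s jump(2) kR(1) kM tm(2)] by (simp add: L_def)
      have dec': "L (Suc j) s \<le> L (Suc j) (t (Suc j))" if s: "s \<in> {t (Suc j)..t (Suc (Suc j))}" for j s
      proof -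
        have "0 \<le> kR * (norm (psi (M ** W (Suc j) (t (Suc j)))))\<^sup>2 * (s - t (Suc j))" using s kR by simp
        then show ?thesis using dec[OF s] by linarith
      qed
      have Lj: "L (Suc j) (t (Suc j)) = L j (t (Suc j))" for j by (simp add: L_def jump(1))
      \<comment> \<open>The invariant is stated at jump times from the first one on, when \<eta> is
        a sampled feedback and \<open>L\<close> no longer increases.\<close>
      have inv: "rot_norm (W (Suc j) (t (Suc j))) \<le> e \<and> L (Suc j) (t (Suc j)) \<le> 4 * l * e\<^sup>2" for j
      proof (induction j)
        case 0
        show ?case using r0[OF in1(2)] L0[OF in1(2)] jump(1)[of 0] Lj[of 0] by simp
      next
        case (Suc j)
        have "rot_norm (W (Suc j) (t (Suc (Suc j)))) \<le> e"
          by (rule attitude_flow.rot_norm_trapped[OF af pd e(2) _ _ in1(2)])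
            (use Suc dec' in \<open>auto simp: L_def l_def intro: order_trans\<close>)
        then show ?case using Suc dec'[OF in1(2)] jump(1)[of "Suc j"] Lj[of "Suc j"] by (metis order_trans)
      qed
      have re: "rot_norm (W (Suc j) s) \<le> e" if s: "s \<in> {t (Suc j)..t (Suc (Suc j))}" for j s
        by (rule attitude_flow.rot_norm_trapped[OF af pd e(2) _ _ s])
          (use inv[of j] dec' in \<open>auto simp: L_def l_def intro: order_trans\<close>)
      have psi_low: "\<sigma> * L (Suc j) (t (Suc j)) \<le> (norm (psi (M ** W (Suc j) (t (Suc j)))))\<^sup>2" for j
      proof -
        let ?W = "W (Suc j) (t (Suc j))"
        have r1: "rot_norm ?W < 1" using inv[of j] e by linarith
        note b = attitude_Lyapunov_bounds[OF rot[OF in1(1)] r1 M pd, folded l_def u_def]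
        have "(rot_norm ?W)\<^sup>2 \<le> e\<^sup>2" using inv[of j] nn[OF in1(1)] by (intro power_mono) auto
        then have "(1 - e\<^sup>2) * (4 * l\<^sup>2 * (rot_norm ?W)\<^sup>2) \<le> (1 - (rot_norm ?W)\<^sup>2) * (4 * l\<^sup>2 * (rot_norm ?W)\<^sup>2)"
          by (intro mult_right_mono) auto
        also have "\<dots> \<le> (norm (psi (M ** ?W)))\<^sup>2"
        proof -
          have "(1 - x) * (4 * y * x) = 4 * (1 - x) * y * x" for x y :: real by (simp add: algebra_simps)
          then show ?thesis using b(3) by (simp only:)
        qed
        finally have 1: "(1 - e\<^sup>2) * (4 * l\<^sup>2 * (rot_norm ?W)\<^sup>2) \<le> (norm (psi (M ** ?W)))\<^sup>2" .
        have "\<sigma> * L (Suc j) (t (Suc j)) \<le> \<sigma> * (4 * u * (rot_norm ?W)\<^sup>2)"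
          using b(2) \<sigma> by (intro mult_left_mono) (auto simp: L_def)
        also have "\<dots> = (1 - e\<^sup>2) * (4 * l\<^sup>2 * (rot_norm ?W)\<^sup>2)" using u by (simp add: \<sigma>_def)
        finally show ?thesis using 1 by linarith
      qed
      have Lnn: "0 \<le> L (Suc j) (t (Suc j))" for j
      proof -
        have r1: "rot_norm (W (Suc j) (t (Suc j))) < 1" using inv[of j] e by linarith
        have "0 \<le> 4 * l * (rot_norm (W (Suc j) (t (Suc j))))\<^sup>2" using l by simp
        also have "\<dots> \<le> L (Suc j) (t (Suc j))"
          using attitude_Lyapunov_bounds(1)[OF rot[OF in1(1)] r1 M pd] by (simp add: L_def l_def)
        finally show ?thesis .
      qed
      have Lrec: "L (Suc (Suc j)) (t (Suc (Suc j))) \<le> \<rho> * L (Suc j) (t (Suc j))" for j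
      proof -
        let ?p = "(norm (psi (M ** W (Suc j) (t (Suc j)))))\<^sup>2"
        have "kR * (\<sigma> * L (Suc j) (t (Suc j))) * Tm \<le> kR * ?p * (t (Suc (Suc j)) - t (Suc j))"
          using psi_low[of j] kR T tm(3)[of j] \<sigma> Lnn[of j] by (intro mult_mono) auto
        then show ?thesis using dec[OF in1(2), of j] Lj[of "Suc j"] by (simp add: \<rho>_def algebra_simps)
      qed
      have Lpow: "L (Suc j) (t (Suc j)) \<le> \<rho> ^ j * L (Suc 0) (t (Suc 0))" for j
      proof (induction j)
        case (Suc j)
        have "L (Suc (Suc j)) (t (Suc (Suc j))) \<le> \<rho> * (\<rho> ^ j * L (Suc 0) (t (Suc 0)))"
          using Lrec[of j] mult_left_mono[OF Suc, of \<rho>] \<rho> by linarith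
        then show ?case by simp
      qed simp
      have d0: "0 \<le> d" by (simp add: d_def)
      have first: "(rot_norm (W 0 s))\<^sup>2 \<le> C0 * d" if s: "s \<in> {t 0..t (Suc 0)}" for s
      proof -
        have "(s - t 0)\<^sup>2 \<le> TM\<^sup>2" using s tm(2)[of 0] by (intro power_mono) auto
        then have "4 * (s - t 0)\<^sup>2 * (norm (\<eta> 0))\<^sup>2 \<le> 4 * TM\<^sup>2 * (norm (\<eta> 0))\<^sup>2" by (intro mult_mono) auto
        moreover have "0 \<le> 4 * TM\<^sup>2 * (rot_norm (W 0 (t 0)))\<^sup>2" "0 \<le> 2 * (norm (\<eta> 0))\<^sup>2" by auto
        moreover have "C0 * d = 2 * (rot_norm (W 0 (t 0)))\<^sup>2 + 2 * (norm (\<eta> 0))\<^sup>2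
            + 4 * TM\<^sup>2 * (rot_norm (W 0 (t 0)))\<^sup>2 + 4 * TM\<^sup>2 * (norm (\<eta> 0))\<^sup>2"
          by (simp add: C0_def d_def algebra_simps)
        ultimately show ?thesis using attitude_flow.rot_norm_drift[OF af s] by linarith
      qed
      have L1: "L (Suc 0) (t (Suc 0)) \<le> 4 * u * (C0 * d)"
      proof -
        have r1: "rot_norm (W (Suc 0) (t (Suc 0))) < 1" using inv[of 0] e by linarith
        have "L (Suc 0) (t (Suc 0)) \<le> 4 * u * (rot_norm (W (Suc 0) (t (Suc 0))))\<^sup>2"
          using attitude_Lyapunov_bounds(2)[OF rot[OF in1(1)] r1 M pd] by (simp add: L_def u_def)
        also have "\<dots> \<le> 4 * u * (C0 * d)" using first[OF in1(2)] u jump(1)[of 0] by (intro mult_left_mono) auto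
        finally show ?thesis .
      qed
      have later: "(rot_norm (W (Suc j) s))\<^sup>2 \<le> (u / l) * C0 * \<rho> ^ j * d" if s: "s \<in> {t (Suc j)..t (Suc (Suc j))}" for j s
      proof -
        have r1: "rot_norm (W (Suc j) s) < 1" using re[OF s] e by linarith
        have "4 * l * (rot_norm (W (Suc j) s))\<^sup>2 \<le> L (Suc j) s"
          using attitude_Lyapunov_bounds(1)[OF rot[OF s] r1 M pd] by (simp add: L_def l_def)
        also have "\<dots> \<le> \<rho> ^ j * L (Suc 0) (t (Suc 0))" using dec'[OF s] Lpow[of j] by linarith
        also have "\<dots> \<le> \<rho> ^ j * (4 * u * (C0 * d))" using L1 \<rho> by (intro mult_left_mono) auto
        finally show ?thesis using l by (simp add: field_simps)
      qed
      show "(rot_norm (W j s))\<^sup>2 + (norm (\<eta> j))\<^sup>2 \<le> C * \<rho> ^ j * ((rot_norm (W 0 (t 0)))\<^sup>2 + (norm (\<eta> 0))\<^sup>2)"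
        unfolding d_def[symmetric]
      proof (cases j)
        case 0
        have "(norm (\<eta> 0))\<^sup>2 \<le> d" by (simp add: d_def)
        then have "(rot_norm (W j s))\<^sup>2 + (norm (\<eta> j))\<^sup>2 \<le> (C0 + 1) * d" using first[of s] s 0 by (simp add: algebra_simps)
        also have "\<dots> \<le> C * d" using K u l C0 \<rho> d0 by (intro mult_right_mono) (auto simp: C_def)
        finally show "(rot_norm (W j s))\<^sup>2 + (norm (\<eta> j))\<^sup>2 \<le> C * \<rho> ^ j * d" using 0 by simp
      next
        case (Suc i)
        let ?W = "W (Suc i) (t (Suc i))"
        have "norm (\<eta> (Suc i)) \<le> kR * (norm M * norm (mat 1 - ?W))"
          using attitude_flow.norm_psi_rotation[OF af in1(1), of "Suc i"] kR jump(2)[of i]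
          by (simp add: mult_left_mono)
        then have "(norm (\<eta> (Suc i)))\<^sup>2 \<le> (kR * (norm M * norm (mat 1 - ?W)))\<^sup>2" by (intro power_mono) auto
        also have "\<dots> = 8 * kR\<^sup>2 * (norm M)\<^sup>2 * (rot_norm ?W)\<^sup>2"
          using rot_norm_sq(1)[OF rot[OF in1(1)], of "Suc i"] by (simp add: power_mult_distrib)
        also have "\<dots> \<le> 8 * kR\<^sup>2 * (norm M)\<^sup>2 * ((u / l) * C0 * \<rho> ^ i * d)"
          by (intro mult_left_mono later in1) auto
        finally have "(rot_norm (W j s))\<^sup>2 + (norm (\<eta> j))\<^sup>2 \<le> K * ((u / l) * C0 * \<rho> ^ i * d)"
          using later[of s i] s Suc by (simp add: K_def algebra_simps)
        also have "\<dots> = (K * (u / l) * C0 / \<rho>) * (\<rho> ^ j * d)" using \<rho> Suc by (simp add: mult_ac)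
        also have "\<dots> \<le> C * (\<rho> ^ j * d)" using C0 \<rho> d0 by (intro mult_right_mono) (auto simp: C_def)
        finally show "(rot_norm (W j s))\<^sup>2 + (norm (\<eta> j))\<^sup>2 \<le> C * \<rho> ^ j * d" by (simp add: mult.assoc)
      qed
    qed
  qed
qed

section \<open>The Riccati equation and its adjoint\<close>

text \<open>The default simp rule would turn \<open>transpose A *v x\<close> into \<open>x v* A\<close> and block the lemmas about transposes below.\<close>

declare transpose_matrix_vector [simp del]

lemma mv_minus: "A *v (- x) = - (A *v x)" for A :: "real ^ 'n ^ 'm"
  by (rule bounded_bilinear.minus_right[OF bounded_bilinear_matrix_vector_mult])

lemma norm_rotation_mv:
  fixes R :: mat3
  assumes "rotation_matrix R"
  shows "norm (R *v x) = norm x" "norm (transpose R *v x) = norm x"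
proof -
  have "(R *v x) \<bullet> (R *v x) = x \<bullet> x" "(transpose R *v x) \<bullet> (transpose R *v x) = x \<bullet> x"
    by (simp_all add: inner_mv matrix_vector_mul_assoc rotation_matrix_transpose_mult[OF assms])
  then show "norm (R *v x) = norm x" "norm (transpose R *v x) = norm x" by (simp_all add: norm_eq)
qed

lemma matrix_inv_right_inverse:
  fixes A :: "real ^ 'n ^ 'm"
  assumes "invertible A"
  shows "A ** matrix_inv A = mat 1"
  using someI_ex[OF assms[unfolded invertible_def]] by (simp add: matrix_inv_def)

lemma matrix_eqI_inner:
  fixes A B :: "real ^ 'n ^ 'm"
  assumes "\<And>x y. x \<bullet> (A *v y) = x \<bullet> (B *v y)"
  shows "A = B"
proof -
  have "x \<bullet> (A *v y - B *v y) = 0" for x y using assms[of x y] by (simp add: inner_diff_right)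
  then have "A *v y = B *v y" for y using inner_eq_zero_iff eq_iff_diff_eq_0 by metis
  then show ?thesis by (simp add: matrix_eq)
qed

lemma transpose_eq_iff_inner:
  fixes A :: "real ^ 'n ^ 'n"
  shows "transpose A = A \<longleftrightarrow> (\<forall>x y. x \<bullet> (A *v y) = y \<bullet> (A *v x))"
proof
  assume "\<forall>x y. x \<bullet> (A *v y) = y \<bullet> (A *v x)"
  then show "transpose A = A"
    by (intro matrix_eqI_inner) (metis inner_mv inner_commute transpose_transpose)
qed (use symmetric_inner_mv in blast)

locale rigid_motion =
  fixes R :: "real \<Rightarrow> mat3" and \<omega> :: "real \<Rightarrow> vec3"
  assumes R_rot: "\<And>t. t \<ge> 0 \<Longrightarrow> rotation_matrix (R t)"
    and R_ode: "\<And>t. t \<ge> 0 \<Longrightarrow> (R has_vector_derivative (R t ** skew (\<omega> t))) (at t within {0..})"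
begin

text \<open>Backward solution of the adjoint equation \<open>z' = - A\<^sub>t\<^sup>T z\<close> with value \<open>z\<close> at time \<open>t\<close>: multiplying both
  blocks by \<open>R\<close> removes \<open>\<omega>\<close> and leaves the adjoint of a double integrator.\<close>
definition adj :: "real \<Rightarrow> vec6 \<Rightarrow> real \<Rightarrow> vec6" where
  "adj t z s = block_vec (transpose (R s) *v (R t *v upper z))
     (transpose (R s) *v (R t *v lower z + (t - s) *\<^sub>R (R t *v upper z)))"

lemma adj_self: "t \<ge> 0 \<Longrightarrow> adj t z t = z"
  by (simp add: adj_def matrix_vector_mul_assoc rotation_matrix_transpose_mult[OF R_rot] block_vec_upper_lower)

lemma norm_upper_le: "norm (upper z) \<le> norm z"
  by (metis block_vec_upper_lower norm_block_vec_ge(1))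

lemma norm_lower_le: "norm (lower z) \<le> norm z"
  by (metis block_vec_upper_lower norm_block_vec_ge(2))

text \<open>Rotations are isometries, so only the double integrator contributes growth, linear in
  the elapsed time.\<close>

lemma norm_adj_le:
  assumes "0 \<le> s" "s \<le> t" "t - s \<le> h"
  shows "norm (adj t z s) \<le> (2 + h) * norm z"
proof -
  have "norm (adj t z s) \<le> norm (upper z) + norm (R t *v lower z + (t - s) *\<^sub>R (R t *v upper z))"
    unfolding adj_def using assms R_rot[of s] R_rot[of t]
    by (intro order_trans[OF norm_block_vec_le]) (simp add: norm_rotation_mv)
  also have "\<dots> \<le> norm (upper z) + (norm (lower z) + (t - s) * norm (upper z))"
    using assms R_rot[of t] by (intro add_left_mono order_trans[OF norm_triangle_ineq]) (simp add: norm_rotation_mv)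
  also have "\<dots> \<le> norm z + (norm z + h * norm z)"
    using assms norm_upper_le norm_lower_le by (intro add_mono mult_mono) auto
  finally show ?thesis by (simp add: algebra_simps)
qed

text \<open>The backward flow is injective. Hence quadratic forms along it stay positive and may
  serve as denominators.\<close>

lemma adj_nonzero:
  assumes "0 \<le> s" "0 \<le> t" "z \<noteq> 0"
  shows "adj t z s \<noteq> 0"
proof
  assume h: "adj t z s = 0"
  have "upper (adj t z s) = 0" "lower (adj t z s) = 0" unfolding h by (simp_all add: upper_def lower_def vec_eq_iff)
  then have "norm (upper z) = 0" and l: "norm (R t *v lower z + (t - s) *\<^sub>R (R t *v upper z)) = 0"
    using norm_rotation_mv[OF R_rot[OF assms(1)]] norm_rotation_mv[OF R_rot[OF assms(2)]]
    by (metis adj_def upper_block_vec lower_block_vec norm_zero)+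
  then have "upper z = 0" "lower z = 0" using norm_rotation_mv[OF R_rot[OF assms(2)]] by auto
  then show False using assms(3) block_vec_upper_lower[of z] by simp
qed

lemma adj_derivative:
  assumes s: "s \<ge> 0"
  shows "(adj t z has_vector_derivative - (transpose (A_mat (\<omega> s)) *v adj t z s)) (at s within {0..})"
proof -
  have "((\<lambda>s. adj t z s) has_vector_derivative
    block_vec (transpose (R s) *v 0 + transpose (R s ** skew (\<omega> s)) *v (R t *v upper z))
     (transpose (R s) *v (0 + (0 - 1) *\<^sub>R (R t *v upper z))
      + transpose (R s ** skew (\<omega> s)) *v (R t *v lower z + (t - s) *\<^sub>R (R t *v upper z)))) (at s within {0..})"
    unfolding adj_def by (auto intro!: derivative_eq_intros R_ode s)
  moreover have "transpose (R s ** skew (\<omega> s)) *v y = - cross3 (\<omega> s) (transpose (R s) *v y)" for y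
    by (simp add: matrix_transpose_mul transpose_skew matrix_vector_mul_assoc[symmetric] minus_mv skew_mult)
  ultimately show ?thesis
    by (simp add: adj_def[of t z s] transpose_A_mat_mult block_vec_minus mv_minus)
qed

end

locale riccati_data = rigid_motion R \<omega> for R :: "real \<Rightarrow> mat3" and \<omega> +
  fixes V :: "real \<Rightarrow> mat6" and Q :: "real \<Rightarrow> mat3" and vm VM qm QM Tm TM :: real
  assumes vm: "0 < vm" and qm: "0 < qm"
    and V_sym: "\<And>t. t \<ge> 0 \<Longrightarrow> transpose (V t) = V t" and V_low: "\<And>t x. t \<ge> 0 \<Longrightarrow> vm * (x \<bullet> x) \<le> x \<bullet> (V t *v x)"
    and V_up: "\<And>t. t \<ge> 0 \<Longrightarrow> norm (V t) \<le> VM"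
    and Q_sym: "\<And>t. t \<ge> 0 \<Longrightarrow> transpose (Q t) = Q t" and Q_low: "\<And>t x. t \<ge> 0 \<Longrightarrow> qm * (x \<bullet> x) \<le> x \<bullet> (Q t *v x)"
    and Q_up: "\<And>t. t \<ge> 0 \<Longrightarrow> norm (Q t) \<le> QM"
    and T: "0 < Tm" "Tm \<le> TM"
begin

lemma quadratic_up: "norm B \<le> c \<Longrightarrow> x \<bullet> (B *v x) \<le> c * (norm x)\<^sup>2" for B :: "real ^ 'n ^ 'n"
proof -
  assume "norm B \<le> c"
  have "x \<bullet> (B *v x) \<le> norm x * norm (B *v x)" by (rule norm_cauchy_schwarz)
  also have "\<dots> \<le> norm x * (norm B * norm x)" by (intro mult_left_mono norm_matrix_vector_mult_le) auto
  also have "\<dots> \<le> norm x * (c * norm x)" using \<open>norm B \<le> c\<close> by (intro mult_left_mono mult_right_mono) auto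
  finally show ?thesis by (simp add: power2_eq_square mult_ac)
qed

lemma VM: "0 \<le> VM" and QM: "0 \<le> QM"
  using order_trans[OF norm_ge_zero V_up[of 0]] order_trans[OF norm_ge_zero Q_up[of 0]] by simp_all

text \<open>The terms with \<open>A_mat\<close> in the Riccati equation cancel against the adjoint
  equation. Two independent vectors are allowed because symmetry and uniqueness of \<open>P\<close>
  need the bilinear form.\<close>

lemma pairing_P:
  assumes ab: "0 \<le> a" and s: "s \<in> {a..b}"
    and P: "(P has_vector_derivative riccati_flow (A_mat (\<omega> s)) (V s) (P s)) (at s within {a..b})"
  shows "((\<lambda>s. adj t z s \<bullet> (P s *v adj t y s)) has_vector_derivative (adj t z s \<bullet> (V s *v adj t y s))) (at s within {a..b})"
proof -
  have s0: "s \<ge> 0" using ab s by simp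
  have d: "(adj t z has_vector_derivative - (transpose (A_mat (\<omega> s)) *v adj t z s)) (at s within {a..b})" for z
    by (rule has_vector_derivative_within_subset[OF adj_derivative[OF s0]]) (use ab in auto)
  let ?A = "A_mat (\<omega> s)"
  have "((\<lambda>s. adj t z s \<bullet> (P s *v adj t y s)) has_vector_derivative
     (adj t z s \<bullet> (P s *v (- (transpose ?A *v adj t y s)) + riccati_flow ?A (V s) (P s) *v adj t y s)
      + (- (transpose ?A *v adj t z s)) \<bullet> (P s *v adj t y s))) (at s within {a..b})"
    by (intro derivative_intros d P)
  moreover have "adj t z s \<bullet> (P s *v (- (transpose ?A *v adj t y s)) + riccati_flow ?A (V s) (P s) *v adj t y s)
      + (- (transpose ?A *v adj t z s)) \<bullet> (P s *v adj t y s) = adj t z s \<bullet> (V s *v adj t y s)"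
    by (simp add: riccati_flow_def matrix_vector_mult_add_rdistrib matrix_vector_mul_assoc[symmetric]
        inner_add_right inner_mv[of "adj t z s" ?A] mv_minus)
  ultimately show ?thesis by simp
qed

lemma pairing_X:
  assumes ab: "0 \<le> a" and s: "s \<in> {a..b}"
    and X: "(X has_vector_derivative (A_mat (\<omega> s) *v X s + \<delta> s)) (at s within {a..b})"
  shows "((\<lambda>s. adj t z s \<bullet> X s) has_vector_derivative (adj t z s \<bullet> \<delta> s)) (at s within {a..b})"
proof -
  have s0: "s \<ge> 0" using ab s by simp
  have d: "(adj t z has_vector_derivative - (transpose (A_mat (\<omega> s)) *v adj t z s)) (at s within {a..b})"
    by (rule has_vector_derivative_within_subset[OF adj_derivative[OF s0]]) (use ab in auto)
  have "((\<lambda>s. adj t z s \<bullet> X s) has_vector_derivative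
     (adj t z s \<bullet> (A_mat (\<omega> s) *v X s + \<delta> s) + (- (transpose (A_mat (\<omega> s)) *v adj t z s)) \<bullet> X s)) (at s within {a..b})"
    by (intro derivative_intros d X)
  then show ?thesis by (simp add: inner_add_right inner_mv[of "adj t z s" "A_mat (\<omega> s)"])
qed

lemma flow_P_upper:
  assumes ab: "0 \<le> a" "b - a \<le> TM" and t: "t \<in> {a..b}"
    and P: "\<And>s. s \<in> {a..b} \<Longrightarrow> (P has_vector_derivative riccati_flow (A_mat (\<omega> s)) (V s) (P s)) (at s within {a..b})"
  shows "z \<bullet> (P t *v z) \<le> adj t z a \<bullet> (P a *v adj t z a) + TM * VM * ((2 + TM) * norm z)\<^sup>2"
proof -
  let ?c = "VM * ((2 + TM) * norm z)\<^sup>2"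
  have c0: "0 \<le> ?c" using VM by simp
  have sub: "{a..t} \<subseteq> {a..b}" using t by auto
  have "adj t z t \<bullet> (P t *v adj t z t) \<le> adj t z a \<bullet> (P a *v adj t z a) + ?c * (t - a)"
  proof (rule vector_derivative_upper[where f'="\<lambda>s. adj t z s \<bullet> (V s *v adj t z s)" and b=t])
    fix s assume s: "s \<in> {a..t}"
    then show "((\<lambda>s. adj t z s \<bullet> (P s *v adj t z s)) has_vector_derivative adj t z s \<bullet> (V s *v adj t z s)) (at s within {a..t})"
      using has_vector_derivative_within_subset[OF pairing_P[OF ab(1) _ P] sub] t by auto
    have s0: "0 \<le> s" using s ab by auto
    have "adj t z s \<bullet> (V s *v adj t z s) \<le> VM * (norm (adj t z s))\<^sup>2" by (rule quadratic_up[OF V_up[OF s0]])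
    also have "\<dots> \<le> ?c"
      using VM s t ab s0 by (intro mult_left_mono power_mono norm_adj_le) auto
    finally show "adj t z s \<bullet> (V s *v adj t z s) \<le> ?c" .
  qed (use t in auto)
  also have "?c * (t - a) \<le> ?c * TM" using c0 t ab by (intro mult_left_mono) auto
  finally show ?thesis using adj_self[of t z] t ab by (simp add: mult_ac)
qed

text \<open>Symmetry: exchanging the two adjoint vectors changes the pairing by a constant, as
  \<open>V\<close> is symmetric, and that constant is zero at time \<open>a\<close>. Positivity: the
  pairing of one vector with itself is nondecreasing.\<close>

lemma flow_P_pos_def:
  assumes ab: "0 \<le> a" and t: "t \<in> {a..b}" and pd: "pos_def (P a)"
    and P: "\<And>s. s \<in> {a..b} \<Longrightarrow> (P has_vector_derivative riccati_flow (A_mat (\<omega> s)) (V s) (P s)) (at s within {a..b})"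
  shows "pos_def (P t)"
  unfolding pos_def_def transpose_eq_iff_inner
proof (intro conjI allI impI)
  have sub: "{a..t} \<subseteq> {a..b}" using t by auto
  have t0: "0 \<le> t" using t ab by auto
  have d: "((\<lambda>s. adj t z s \<bullet> (P s *v adj t y s)) has_vector_derivative adj t z s \<bullet> (V s *v adj t y s)) (at s within {a..t})"
    if s: "s \<in> {a..t}" for s z y
    using has_vector_derivative_within_subset[OF pairing_P[OF ab _ P] sub] t s by auto
  fix z
  show "z \<bullet> (P t *v y) = y \<bullet> (P t *v z)" for y
  proof -
    let ?f = "\<lambda>s. adj t z s \<bullet> (P s *v adj t y s) - adj t y s \<bullet> (P s *v adj t z s)"
    have "norm (?f t - ?f a) \<le> 0 * \<bar>t - a\<bar>"
    proof (rule vector_derivative_Lipschitz[where a=a and b=t and f'="\<lambda>s. adj t z s \<bullet> (V s *v adj t y s) - adj t y s \<bullet> (V s *v adj t z s)"])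
      fix s assume s: "s \<in> {a..t}"
      show "(?f has_vector_derivative adj t z s \<bullet> (V s *v adj t y s) - adj t y s \<bullet> (V s *v adj t z s)) (at s within {a..t})"
        by (intro derivative_intros d s)
      show "norm (adj t z s \<bullet> (V s *v adj t y s) - adj t y s \<bullet> (V s *v adj t z s)) \<le> 0"
        using symmetric_inner_mv[OF V_sym[of s], of "adj t z s" "adj t y s"] s ab by simp
    qed (use t in auto)
    moreover have "?f a = 0"
      using pd unfolding pos_def_def transpose_eq_iff_inner by simp
    ultimately show ?thesis using adj_self[OF t0] by simp
  qed
  assume z: "z \<noteq> 0"
  have "- (adj t z t \<bullet> (P t *v adj t z t)) \<le> - (adj t z a \<bullet> (P a *v adj t z a)) + 0 * (t - a)"
  proof (rule vector_derivative_upper[where f'="\<lambda>s. - (adj t z s \<bullet> (V s *v adj t z s))" and b=t])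
    fix s assume s: "s \<in> {a..t}"
    show "((\<lambda>s. - (adj t z s \<bullet> (P s *v adj t z s))) has_vector_derivative - (adj t z s \<bullet> (V s *v adj t z s))) (at s within {a..t})"
      by (intro derivative_intros d s)
    have "0 \<le> vm * (adj t z s \<bullet> adj t z s)" using vm by simp
    also have "\<dots> \<le> adj t z s \<bullet> (V s *v adj t z s)" using s ab by (intro V_low) auto
    finally show "- (adj t z s \<bullet> (V s *v adj t z s)) \<le> 0" by simp
  qed (use t in auto)
  moreover have "0 < adj t z a \<bullet> (P a *v adj t z a)"
    using pd adj_nonzero[OF ab t0 z] by (auto simp: pos_def_def)
  ultimately show "0 < z \<bullet> (P t *v z)" using adj_self[OF t0] by simp
qed

lemma AM_GM_weighted:
  fixes x D \<beta> :: real
  assumes "0 < \<beta>"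
  shows "2 * (x * D) \<le> \<beta> * x\<^sup>2 + D\<^sup>2 / \<beta>"
proof -
  have "0 \<le> (\<beta> * x - D)\<^sup>2 / \<beta>" using assms by simp
  then show ?thesis using assms by (simp add: power2_eq_square field_simps)
qed

text \<open>The bound \<open>(z \<bullet> x)\<^sup>2 \<le> w * (z \<bullet> (P *v z))\<close> for all \<open>z\<close> is the dual form of \<open>x\<^sup>T P\<^sup>-\<^sup>1 x \<le> w\<close>; it avoids
  differentiating the inverse of \<open>P\<close> and needs no lower bound for \<open>P\<close>.\<close>

lemma flow_error_decay:
  fixes X :: "real \<Rightarrow> vec6" and \<delta> :: "real \<Rightarrow> vec6"
  assumes ab: "0 \<le> a" and t: "t \<in> {a..b}" and pd: "pos_def (P a)"
    and P: "\<And>s. s \<in> {a..b} \<Longrightarrow> (P has_vector_derivative riccati_flow (A_mat (\<omega> s)) (V s) (P s)) (at s within {a..b})"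
    and X: "\<And>s. s \<in> {a..b} \<Longrightarrow> (X has_vector_derivative (A_mat (\<omega> s) *v X s + \<delta> s)) (at s within {a..b})"
    and pM: "0 < pM" "\<And>s z. s \<in> {a..b} \<Longrightarrow> z \<bullet> (P s *v z) \<le> pM * (norm z)\<^sup>2"
    and D: "\<And>s. s \<in> {a..b} \<Longrightarrow> norm (\<delta> s) \<le> D"
    and ini: "\<And>z. (z \<bullet> X a)\<^sup>2 \<le> w * (z \<bullet> (P a *v z))"
  shows "(z \<bullet> X t)\<^sup>2 \<le> (exp (- (vm / (2 * pM)) * (t - a)) * w + D\<^sup>2 / (vm / (2 * pM) * (vm / 2))) * (z \<bullet> (P t *v z))"
proof (cases "z = 0")
  case False
  \<comment> \<open>The dissipation due to \<open>V\<close> is split in half: one half, compared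
    with the upper bound \<open>pM\<close>, yields the decay rate \<alpha>, the other half \<beta>
    absorbs the perturbation.\<close>
  define \<alpha> where "\<alpha> = vm / (2 * pM)"
  define \<beta> where "\<beta> = vm / 2"
  define c where "c = D\<^sup>2 / (\<alpha> * \<beta>)"
  have \<alpha>: "0 < \<alpha>" "0 < \<beta>" using vm pM(1) by (auto simp: \<alpha>_def \<beta>_def)
  have \<alpha>p: "\<alpha> * pM = \<beta>" using pM(1) by (simp add: \<alpha>_def \<beta>_def)
  have sub: "{a..t} \<subseteq> {a..b}" using t by auto
  have t0: "0 \<le> t" using t ab by auto
  define f where "f s = adj t z s \<bullet> (P s *v adj t z s)" for s
  define u where "u s = adj t z s \<bullet> X s" for s
  define f' where "f' s = adj t z s \<bullet> (V s *v adj t z s)" for s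
  define u' where "u' s = adj t z s \<bullet> \<delta> s" for s
  have df: "(f has_real_derivative f' s) (at s within {a..t})" if s: "s \<in> {a..t}" for s
    using has_vector_derivative_within_subset[OF pairing_P[OF ab _ P] sub] t s
    unfolding has_real_derivative_iff_has_vector_derivative f_def f'_def by auto
  have du: "(u has_real_derivative u' s) (at s within {a..t})" if s: "s \<in> {a..t}" for s
  proof -
    have sb: "s \<in> {a..b}" using s t by auto
    show ?thesis
      unfolding has_real_derivative_iff_has_vector_derivative u_def u'_def
      by (rule has_vector_derivative_within_subset[OF pairing_X[where \<delta>=\<delta> and X=X, OF ab sb X[OF sb]] sub])
  qed
  have fpos: "0 < f s" if s: "s \<in> {a..t}" for s
  proof -
    have sb: "s \<in> {a..b}" and s0: "0 \<le> s" using s t ab by auto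
    have "pos_def (P s)" by (rule flow_P_pos_def[OF ab sb pd P])
    then show ?thesis using adj_nonzero[OF s0 t0 False] by (simp add: f_def pos_def_def)
  qed
  \<comment> \<open>The ratio \<open>y = (u s)\<^sup>2 / f s\<close> satisfies
    \<open>y' \<le> - \<alpha> * y + D\<^sup>2 / \<beta>\<close>, with equilibrium \<open>c\<close>.
    The exponential is the integrating factor for \<open>y - c\<close>.\<close>
  define g where "g s = exp (\<alpha> * (s - a)) * ((u s)\<^sup>2 / f s - c)" for s
  define g' where "g' s = exp (\<alpha> * (s - a)) * (\<alpha> * ((u s)\<^sup>2 / f s - c) + (2 * u s * u' s * f s - (u s)\<^sup>2 * f' s) / (f s)\<^sup>2)" for s
  have dg: "(g has_vector_derivative g' s) (at s within {a..t})" if s: "s \<in> {a..t}" for s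
    unfolding has_real_derivative_iff_has_vector_derivative[symmetric] g_def g'_def using fpos[OF s]
    by (auto intro!: derivative_eq_intros df[OF s] du[OF s] simp: field_simps power2_eq_square)
  have gneg: "g' s \<le> 0" if s: "s \<in> {a..t}" for s
  proof -
    have sb: "s \<in> {a..b}" and s0: "0 \<le> s" using s t ab by auto
    note fp = fpos[OF s]
    define n where "n = norm (adj t z s)"
    define q where "q = \<bar>u s\<bar> / f s"
    have "vm * n\<^sup>2 \<le> f' s" using V_low[OF s0, of "adj t z s"] by (simp add: f'_def n_def power2_norm_eq_inner)
    moreover have "\<alpha> * f s \<le> \<beta> * n\<^sup>2"
      using mult_left_mono[OF pM(2)[OF sb, of "adj t z s"], of \<alpha>] \<alpha> \<alpha>p
      by (simp add: f_def n_def mult.assoc[symmetric])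
    moreover have "vm * n\<^sup>2 = \<beta> * n\<^sup>2 + \<beta> * n\<^sup>2" by (simp add: \<beta>_def)
    ultimately have f'l: "\<alpha> * f s + \<beta> * n\<^sup>2 \<le> f' s" by linarith
    have "\<bar>u' s\<bar> \<le> n * D"
      unfolding u'_def n_def using D[OF sb] by (meson Cauchy_Schwarz_ineq2 mult_left_mono norm_ge_zero order_trans)
    then have "u s * u' s \<le> \<bar>u s\<bar> * (n * D)" by (metis abs_ge_self abs_ge_zero abs_mult mult_left_mono order_trans)
    then have 1: "2 * u s * u' s * f s \<le> 2 * (\<bar>u s\<bar> * (n * D)) * f s" using fp by (intro mult_right_mono) auto
    have 2: "(u s)\<^sup>2 * (\<alpha> * f s + \<beta> * n\<^sup>2) \<le> (u s)\<^sup>2 * f' s" using f'l by (intro mult_left_mono) auto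
    have "(2 * u s * u' s * f s - (u s)\<^sup>2 * f' s) / (f s)\<^sup>2
      \<le> (2 * (\<bar>u s\<bar> * (n * D)) * f s - (u s)\<^sup>2 * (\<alpha> * f s + \<beta> * n\<^sup>2)) / (f s)\<^sup>2"
      using 1 2 by (intro divide_right_mono) auto
    also have "\<dots> = 2 * ((q * n) * D) - \<beta> * (q * n)\<^sup>2 - \<alpha> * ((u s)\<^sup>2 / f s)"
      using fp by (simp add: q_def power2_eq_square field_simps)
    also have "\<dots> \<le> D\<^sup>2 / \<beta> - \<alpha> * ((u s)\<^sup>2 / f s)" using AM_GM_weighted[OF \<alpha>(2), of "q * n" D] by linarith
    also have "D\<^sup>2 / \<beta> = \<alpha> * c" using \<alpha> by (simp add: c_def)
    finally have "\<alpha> * ((u s)\<^sup>2 / f s - c) + (2 * u s * u' s * f s - (u s)\<^sup>2 * f' s) / (f s)\<^sup>2 \<le> 0"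
      by (simp add: algebra_simps)
    then show ?thesis unfolding g'_def by (intro mult_nonneg_nonpos) auto
  qed
  have "g t \<le> g a + 0 * (t - a)" by (rule vector_derivative_upper[OF dg gneg]) (use t in auto)
  then have "exp (\<alpha> * (t - a)) * ((u t)\<^sup>2 / f t - c) \<le> (u a)\<^sup>2 / f a - c" by (simp add: g_def)
  moreover have "(u a)\<^sup>2 / f a \<le> w"
    using ini[of "adj t z a"] fpos[of a] t by (simp add: u_def f_def pos_divide_le_eq)
  moreover have "0 \<le> c" using \<alpha> by (simp add: c_def)
  ultimately have "exp (\<alpha> * (t - a)) * ((u t)\<^sup>2 / f t - c) \<le> w" by linarith
  then have "exp (- \<alpha> * (t - a)) * (exp (\<alpha> * (t - a)) * ((u t)\<^sup>2 / f t - c)) \<le> exp (- \<alpha> * (t - a)) * w"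
    by (intro mult_left_mono) auto
  then have h1: "(exp (- \<alpha> * (t - a)) * exp (\<alpha> * (t - a))) * ((u t)\<^sup>2 / f t - c) \<le> exp (- \<alpha> * (t - a)) * w"
    by (simp only: mult.assoc)
  have h2: "exp (- \<alpha> * (t - a)) * exp (\<alpha> * (t - a)) = 1" by (simp add: exp_add[symmetric])
  have "(u t)\<^sup>2 / f t - c \<le> exp (- \<alpha> * (t - a)) * w"
    using h1 unfolding h2 by (simp only: mult_1_left)
  then have "(u t)\<^sup>2 / f t \<le> exp (- \<alpha> * (t - a)) * w + c" by linarith
  then have "(u t)\<^sup>2 \<le> (exp (- \<alpha> * (t - a)) * w + c) * f t"
    using fpos[of t] t by (simp add: pos_divide_le_eq)
  then show ?thesis by (simp add: u_def f_def adj_self[OF t0] \<alpha>_def \<beta>_def c_def)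
qed simp

section \<open>The measurement update at a jump\<close>

lemma innovation:
  fixes P :: mat6
  assumes t: "0 \<le> t" and P: "pos_def P"
  defines "S \<equiv> C_mat ** P ** transpose C_mat + Q t"
  shows "S *v (matrix_inv S *v y) = y" "transpose S = S" "qm * (y \<bullet> y) \<le> y \<bullet> (S *v y)"
    "y \<bullet> (S *v y) = (transpose C_mat *v y) \<bullet> (P *v (transpose C_mat *v y)) + y \<bullet> (Q t *v y)"
proof -
  have Psym: "transpose P = P" and Ppos: "0 \<le> x \<bullet> (P *v x)" for x
    using P by (auto simp: pos_def_def) (metis inner_zero_left less_imp_le order_refl)
  have qf: "x \<bullet> (S *v y) = (transpose C_mat *v x) \<bullet> (P *v (transpose C_mat *v y)) + x \<bullet> (Q t *v y)" for x y
    by (simp add: S_def matrix_vector_mult_add_rdistrib matrix_vector_mul_assoc[symmetric] inner_add_right inner_mv[of x C_mat])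
  show "y \<bullet> (S *v y) = (transpose C_mat *v y) \<bullet> (P *v (transpose C_mat *v y)) + y \<bullet> (Q t *v y)" by (rule qf)
  have low: "qm * (y \<bullet> y) \<le> y \<bullet> (S *v y)" for y
    using qf[of y y] Ppos[of "transpose C_mat *v y"] Q_low[OF t, of y] by linarith
  show "qm * (y \<bullet> y) \<le> y \<bullet> (S *v y)" by (rule low)
  show "transpose S = S"
    unfolding transpose_eq_iff_inner qf using symmetric_inner_mv[OF Psym] symmetric_inner_mv[OF Q_sym[OF t]] by metis
  \<comment> \<open>The lower bound inherited from \<open>Q\<close> excludes a kernel, so
    \<open>matrix_inv\<close> is a genuine inverse.\<close>
  have "inj ((*v) S)"
  proof (rule injI)
    fix x y assume "S *v x = S *v y"
    then have "(x - y) \<bullet> (S *v (x - y)) = 0" by (simp add: matrix_vector_mult_diff_distrib)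
    then have "(x - y) \<bullet> (x - y) \<le> 0" using low[of "x - y"] qm by (simp add: mult_le_0_iff)
    then show "x = y" by (metis eq_iff_diff_eq_0 inner_eq_zero_iff inner_ge_zero order_antisym)
  qed
  then have "invertible S" using invertible_left_inverse matrix_left_invertible_injective by blast
  then show "S *v (matrix_inv S *v y) = y"
    by (simp add: matrix_vector_mul_assoc matrix_inv_right_inverse)
qed

text \<open>Completing the square: as a function of \<open>k\<close>, the cost on the right of the
  second identity is minimal at \<open>\<kappa> z\<close>, and its minimum is the form of the
  updated matrix. The adjoint of the error jump subtracts the same \<open>\<kappa> z\<close>, which
  is what makes the two updates compatible.\<close>

lemma jump_identities:
  fixes P :: mat6
  assumes t: "0 \<le> t" and P: "pos_def P"
  defines "S \<equiv> C_mat ** P ** transpose C_mat + Q t"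
  defines "\<kappa> \<equiv> \<lambda>z. matrix_inv S *v (C_mat *v (P *v z))"
  shows "z \<bullet> ((mat 1 - gain P (Q t) ** C_mat) *v x) = (z - transpose C_mat *v \<kappa> z) \<bullet> x"
    "z \<bullet> (riccati_jump (Q t) P *v z) + (k - \<kappa> z) \<bullet> (S *v (k - \<kappa> z))
      = (z - transpose C_mat *v k) \<bullet> (P *v (z - transpose C_mat *v k)) + k \<bullet> (Q t *v k)"
    "transpose (riccati_jump (Q t) P) = riccati_jump (Q t) P"
proof -
  have Psym: "transpose P = P" using P by (auto simp: pos_def_def)
  note inn = innovation[OF t P, folded S_def]
  have Sk: "S *v \<kappa> z = C_mat *v (P *v z)" for z by (simp add: \<kappa>_def inn(1))
  have mv: "z \<bullet> (P *v (transpose C_mat *v (matrix_inv S *v v))) = \<kappa> z \<bullet> v" for z v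
  proof -
    have "z \<bullet> (P *v (transpose C_mat *v (matrix_inv S *v v))) = (C_mat *v (P *v z)) \<bullet> (matrix_inv S *v v)"
      by (simp add: inner_mv Psym)
    also have "\<dots> = (S *v \<kappa> z) \<bullet> (matrix_inv S *v v)" by (simp add: Sk)
    also have "\<dots> = \<kappa> z \<bullet> (S *v (matrix_inv S *v v))"
      using inner_mv[of "\<kappa> z" S] inn(2) by simp
    finally show ?thesis by (simp add: inn(1))
  qed
  show "z \<bullet> ((mat 1 - gain P (Q t) ** C_mat) *v x) = (z - transpose C_mat *v \<kappa> z) \<bullet> x"
    by (simp add: matrix_vector_mult_diff_rdistrib gain_def S_def[symmetric] matrix_vector_mul_assoc[symmetric]
        inner_diff_right inner_diff_left mv inner_mv[of _ C_mat])
  have J: "z \<bullet> (riccati_jump (Q t) P *v y) = z \<bullet> (P *v y) - \<kappa> z \<bullet> (C_mat *v (P *v y))" for z y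
    by (simp add: riccati_jump_def S_def[symmetric] matrix_vector_mult_diff_rdistrib matrix_vector_mul_assoc[symmetric]
        inner_diff_right mv)
  have sS: "x \<bullet> (S *v y) = y \<bullet> (S *v x)" for x y by (rule symmetric_inner_mv[OF inn(2)])
  show "transpose (riccati_jump (Q t) P) = riccati_jump (Q t) P"
    unfolding transpose_eq_iff_inner J Sk[symmetric] using sS symmetric_inner_mv[OF Psym] by metis
  have CP: "(transpose C_mat *v k) \<bullet> (P *v z) = k \<bullet> (S *v \<kappa> z)" for k
    by (simp add: Sk inner_mv[of k C_mat])
  have PC: "z \<bullet> (P *v (transpose C_mat *v k)) = k \<bullet> (S *v \<kappa> z)" for k
    using CP[of k] symmetric_inner_mv[OF Psym, of z] by simp
  show "z \<bullet> (riccati_jump (Q t) P *v z) + (k - \<kappa> z) \<bullet> (S *v (k - \<kappa> z))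
      = (z - transpose C_mat *v k) \<bullet> (P *v (z - transpose C_mat *v k)) + k \<bullet> (Q t *v k)"
    using inn(4)[of k] sS[of "\<kappa> z" k]
    by (simp add: J matrix_vector_mult_diff_distrib inner_diff_left inner_diff_right CP PC Sk[symmetric])
qed

text \<open>The minimum is bounded by the cost of any \<open>k\<close>, so \<open>k\<close> may be
  chosen as a control.\<close>

lemma jump_P_upper:
  assumes "0 \<le> t" "pos_def P"
  shows "z \<bullet> (riccati_jump (Q t) P *v z) \<le> (z - block_vec k 0) \<bullet> (P *v (z - block_vec k 0)) + QM * (norm k)\<^sup>2"
proof -
  let ?S = "C_mat ** P ** transpose C_mat + Q t"
  have "0 \<le> y \<bullet> (?S *v y)" for y
    using innovation(3)[OF assms, of y] qm by (meson inner_ge_zero less_imp_le mult_nonneg_nonneg order_trans)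
  then show ?thesis
    using jump_identities(2)[OF assms, of z k] quadratic_up[OF Q_up[OF assms(1)], of k]
    by (simp add: transpose_C_mat_mult) (smt (verit))
qed

lemma jump_P_pos_def:
  assumes t: "0 \<le> t" and P: "pos_def P"
  shows "pos_def (riccati_jump (Q t) P)"
  unfolding pos_def_def
proof (intro conjI allI impI)
  show "transpose (riccati_jump (Q t) P) = riccati_jump (Q t) P" by (rule jump_identities(3)[OF t P])
  fix z :: vec6 assume z: "z \<noteq> 0"
  define k where "k = matrix_inv (C_mat ** P ** transpose C_mat + Q t) *v (C_mat *v (P *v z))"
  have eq: "z \<bullet> (riccati_jump (Q t) P *v z) = (z - transpose C_mat *v k) \<bullet> (P *v (z - transpose C_mat *v k)) + k \<bullet> (Q t *v k)"
    using jump_identities(2)[OF t P, of z k] by (simp add: k_def)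
  have Ppos: "0 \<le> x \<bullet> (P *v x)" for x
    using P by (auto simp: pos_def_def) (metis inner_zero_left less_imp_le order_refl)
  show "0 < z \<bullet> (riccati_jump (Q t) P *v z)"
  \<comment> \<open>The two terms of the minimal cost cannot vanish together: without an impulse
    \<open>z\<close> itself remains, otherwise \<open>Q\<close> charges for the impulse.\<close>
  proof (cases "k = 0")
    case True
    then show ?thesis using eq P z by (simp add: pos_def_def)
  next
    case False
    then have "0 < qm * (k \<bullet> k)" using qm by simp
    then show ?thesis using eq Q_low[OF t, of k] Ppos[of "z - transpose C_mat *v k"] by linarith
  qed
qed

text \<open>A jump preserves the weight \<open>w\<close>: the new error paired with \<open>z\<close>
  is the old one paired with \<open>z - transpose C_mat *v k\<close>, whose cost is part of the new
  quadratic form.\<close>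

lemma jump_error:
  assumes t: "0 \<le> t" and P: "pos_def P" and w: "0 \<le> w" and ini: "\<And>z. (z \<bullet> x)\<^sup>2 \<le> w * (z \<bullet> (P *v z))"
  shows "(z \<bullet> ((mat 1 - gain P (Q t) ** C_mat) *v x))\<^sup>2 \<le> w * (z \<bullet> (riccati_jump (Q t) P *v z))"
proof -
  define k where "k = matrix_inv (C_mat ** P ** transpose C_mat + Q t) *v (C_mat *v (P *v z))"
  let ?z = "z - transpose C_mat *v k"
  have eq: "z \<bullet> (riccati_jump (Q t) P *v z) = ?z \<bullet> (P *v ?z) + k \<bullet> (Q t *v k)"
    using jump_identities(2)[OF t P, of z k] by (simp add: k_def)
  have "0 \<le> qm * (k \<bullet> k)" using qm by simp
  then have "?z \<bullet> (P *v ?z) \<le> z \<bullet> (riccati_jump (Q t) P *v z)" using eq Q_low[OF t, of k] by linarith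
  then have "w * (?z \<bullet> (P *v ?z)) \<le> w * (z \<bullet> (riccati_jump (Q t) P *v z))" using w by (intro mult_left_mono)
  moreover have "(z \<bullet> ((mat 1 - gain P (Q t) ** C_mat) *v x))\<^sup>2 = (?z \<bullet> x)\<^sup>2"
    using jump_identities(1)[OF t P, of z x] by (simp add: k_def)
  ultimately show ?thesis using ini[of ?z] by linarith
qed

end

section \<open>Uniform bounds for the position and velocity errors\<close>

context riccati_data
begin

text \<open>After a \<open>1\<close> for positivity, the summands bound \<open>P\<close> on the
  first interval, on the second one, and on all later ones by the cost of two impulses. Here
  \<open>c\<close> bounds the backward flow over one interval, \<open>d\<close> the size of
  impulses, and \<open>v\<close> the contribution of \<open>V\<close>. No data of a particular run
  enter besides \<open>P0\<close>.\<close>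

definition pmax :: "mat6 \<Rightarrow> real" where
  "pmax P0 = (let c = 2 + TM; d = 1 + 1 / Tm; v = TM * VM * c\<^sup>2; p0 = norm P0 * c\<^sup>2 + v
     in 1 + p0 + (p0 * c\<^sup>2 + v) + (v + QM * d\<^sup>2 * c\<^sup>2 + v * d\<^sup>2 * c\<^sup>2 + QM * c\<^sup>2 * d\<^sup>2 * c\<^sup>2))"

lemma pmax_ge:
  assumes "c = 2 + TM" "d = 1 + 1 / Tm" "v = TM * VM * c\<^sup>2" "p0 = norm P0 * c\<^sup>2 + v"
  shows "p0 \<le> pmax P0" "p0 * c\<^sup>2 + v \<le> pmax P0"
    "v + QM * d\<^sup>2 * c\<^sup>2 + v * d\<^sup>2 * c\<^sup>2 + QM * c\<^sup>2 * d\<^sup>2 * c\<^sup>2 \<le> pmax P0" "1 \<le> pmax P0"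
proof -
  have "0 \<le> v" using assms VM T by simp
  moreover have "0 \<le> p0" using assms calculation by simp
  moreover have "0 \<le> p0 * c\<^sup>2" "0 \<le> QM * d\<^sup>2 * c\<^sup>2" "0 \<le> v * d\<^sup>2 * c\<^sup>2" "0 \<le> QM * c\<^sup>2 * d\<^sup>2 * c\<^sup>2"
    using calculation QM by auto
  moreover have "pmax P0 = 1 + p0 + (p0 * c\<^sup>2 + v) + (v + QM * d\<^sup>2 * c\<^sup>2 + v * d\<^sup>2 * c\<^sup>2 + QM * c\<^sup>2 * d\<^sup>2 * c\<^sup>2)"
    unfolding pmax_def Let_def assms by simp
  ultimately show "p0 \<le> pmax P0" "p0 * c\<^sup>2 + v \<le> pmax P0"
    "v + QM * d\<^sup>2 * c\<^sup>2 + v * d\<^sup>2 * c\<^sup>2 + QM * c\<^sup>2 * d\<^sup>2 * c\<^sup>2 \<le> pmax P0" "1 \<le> pmax P0" by linarith+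
qed

lemma pmax_pos: "0 < pmax P0"
  using pmax_ge(4)[OF refl refl refl refl, of P0] by linarith

end

locale riccati_run = riccati_data +
  fixes t :: "nat \<Rightarrow> real" and P :: "nat \<Rightarrow> real \<Rightarrow> mat6" and P0 :: mat6
  assumes t0: "t 0 = 0" and t_mono: "\<And>j. t j \<le> t (Suc j)" and t_le: "\<And>j. t (Suc j) - t j \<le> TM"
    and t_ge: "\<And>j. Tm \<le> t (Suc (Suc j)) - t (Suc j)"
    and P_ode: "\<And>j s. s \<in> {t j..t (Suc j)} \<Longrightarrow>
      (P j has_vector_derivative riccati_flow (A_mat (\<omega> s)) (V s) (P j s)) (at s within {t j..t (Suc j)})"
    and P_jump: "\<And>j. P (Suc j) (t (Suc j)) = riccati_jump (Q (t (Suc j))) (P j (t (Suc j)))"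
    and P_init: "P 0 0 = P0" and P0_pd: "pos_def P0"
begin

lemma t_nonneg: "0 \<le> t j"
  using lift_Suc_mono_le[of t 0 j] t_mono t0 by simp

lemma P_pos_def_start: "pos_def (P j (t j))"
proof (induction j)
  case (Suc j)
  have "pos_def (P j (t (Suc j)))"
    by (rule flow_P_pos_def[OF t_nonneg _ Suc P_ode]) (use t_mono[of j] in auto)
  then show ?case unfolding P_jump by (rule jump_P_pos_def[OF t_nonneg])
qed (simp add: t0 P_init P0_pd)

lemma P_pos_def: "s \<in> {t j..t (Suc j)} \<Longrightarrow> pos_def (P j s)"
  by (rule flow_P_pos_def[OF t_nonneg _ P_pos_def_start P_ode])

lemma flow_step:
  assumes s: "s \<in> {t j..t (Suc j)}"
  shows "z \<bullet> (P j s *v z) \<le> adj s z (t j) \<bullet> (P j (t j) *v adj s z (t j)) + TM * VM * (2 + TM)\<^sup>2 * (norm z)\<^sup>2"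
    "(norm (adj s z (t j)))\<^sup>2 \<le> (2 + TM)\<^sup>2 * (norm z)\<^sup>2"
proof -
  show "z \<bullet> (P j s *v z) \<le> adj s z (t j) \<bullet> (P j (t j) *v adj s z (t j)) + TM * VM * (2 + TM)\<^sup>2 * (norm z)\<^sup>2"
    using flow_P_upper[OF t_nonneg t_le s P_ode, of z] by (simp add: power_mult_distrib mult.assoc)
  have "norm (adj s z (t j)) \<le> (2 + TM) * norm z"
    by (rule norm_adj_le[OF t_nonneg]) (use s t_le[of j] in auto)
  then have "(norm (adj s z (t j)))\<^sup>2 \<le> ((2 + TM) * norm z)\<^sup>2" by (intro power_mono) auto
  then show "(norm (adj s z (t j)))\<^sup>2 \<le> (2 + TM)\<^sup>2 * (norm z)\<^sup>2" by (simp add: power_mult_distrib)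
qed

lemma jump_step:
  "z \<bullet> (P (Suc j) (t (Suc j)) *v z)
    \<le> (z - block_vec k 0) \<bullet> (P j (t (Suc j)) *v (z - block_vec k 0)) + QM * (norm k)\<^sup>2"
  unfolding P_jump by (rule jump_P_upper[OF t_nonneg P_pos_def]) (use t_mono[of j] in auto)

text \<open>Two sampling instants a time \<open>h \<ge> Tm\<close> apart suffice to steer the adjoint state to zero backwards in
  time: the first impulse sets the upper block to the value that makes the lower block vanish after \<open>h\<close>, the
  second one removes the upper block. The cost of this control bounds \<open>P\<close> independently of the past.\<close>

lemma P_upper_start:
  "z \<bullet> (P (Suc (Suc j)) (t (Suc (Suc j))) *v z)
    \<le> (QM * (1 + 1 / Tm)\<^sup>2 + TM * VM * (2 + TM)\<^sup>2 * (1 + 1 / Tm)\<^sup>2 + QM * (2 + TM)\<^sup>2 * (1 + 1 / Tm)\<^sup>2) * (norm z)\<^sup>2"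
proof -
  let ?T = "t (Suc (Suc j))" and ?S = "t (Suc j)"
  let ?d = "1 + 1 / Tm"
  define h where "h = ?T - ?S"
  have h: "0 < h" "Tm \<le> h" using t_ge[of j] T by (auto simp: h_def)
  have ih: "1 / h \<le> 1 / Tm" using h T by (simp add: frac_le)
  define v where "v = (- 1 / h) *\<^sub>R lower z"
  define k where "k = upper z - v"
  define y where "y = block_vec v (lower z)"
  have "block_vec (upper z) (lower z) - block_vec k 0 = y" by (simp add: block_vec_diff k_def y_def)
  then have y: "z - block_vec k 0 = y" by (simp only: block_vec_upper_lower)
  have nv: "norm v \<le> (1 / Tm) * norm z"
  proof -
    have "norm v = (1 / h) * norm (lower z)" using h by (simp add: v_def)
    also have "\<dots> \<le> (1 / Tm) * norm z" using ih h T norm_lower_le by (intro mult_mono) auto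
    finally show ?thesis .
  qed
  have "norm k \<le> norm (upper z) + norm v" unfolding k_def by (rule norm_triangle_ineq4)
  then have nk: "norm k \<le> ?d * norm z" using norm_upper_le[of z] nv by (simp add: algebra_simps)
  have "norm y \<le> norm v + norm (lower z)" unfolding y_def by (rule norm_block_vec_le)
  then have ny: "norm y \<le> ?d * norm z" using norm_lower_le[of z] nv by (simp add: algebra_simps)
  have nk2: "(norm k)\<^sup>2 \<le> ?d\<^sup>2 * (norm z)\<^sup>2" and ny2: "(norm y)\<^sup>2 \<le> ?d\<^sup>2 * (norm z)\<^sup>2"
    using power_mono[OF nk, of 2] power_mono[OF ny, of 2] by (simp_all add: power_mult_distrib)
  have Tin: "?T \<in> {?S..?T}" using t_mono[of "Suc j"] by auto
  define x where "x = adj ?T y ?S"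
  have "lower x = 0"
    using h by (simp add: x_def adj_def y_def v_def h_def[symmetric] mv_minus matrix_vector_mult_scaleR scaleR_right_distrib)
  then have x: "x - block_vec (upper x) 0 = 0"
    using block_vec_upper_lower[of x] by simp
  have "z \<bullet> (P (Suc (Suc j)) ?T *v z) \<le> y \<bullet> (P (Suc j) ?T *v y) + QM * (norm k)\<^sup>2"
    using jump_step[of z "Suc j" k] unfolding y .
  also have "y \<bullet> (P (Suc j) ?T *v y) \<le> x \<bullet> (P (Suc j) ?S *v x) + TM * VM * (2 + TM)\<^sup>2 * (norm y)\<^sup>2"
    using flow_step(1)[OF Tin, of y] unfolding x_def .
  also have "x \<bullet> (P (Suc j) ?S *v x) \<le> QM * (norm x)\<^sup>2"
  proof -
    have "x \<bullet> (P (Suc j) ?S *v x) \<le> QM * (norm (upper x))\<^sup>2"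
      using jump_step[of x j "upper x"] unfolding x by simp
    also have "\<dots> \<le> QM * (norm x)\<^sup>2" using QM norm_upper_le by (intro mult_left_mono power_mono) auto
    finally show ?thesis .
  qed
  also have "(norm x)\<^sup>2 \<le> (2 + TM)\<^sup>2 * (norm y)\<^sup>2" using flow_step(2)[OF Tin, of y] unfolding x_def .
  finally have "z \<bullet> (P (Suc (Suc j)) ?T *v z) \<le> QM * ((2 + TM)\<^sup>2 * (norm y)\<^sup>2) + TM * VM * (2 + TM)\<^sup>2 * (norm y)\<^sup>2 + QM * (norm k)\<^sup>2"
    using QM by (simp add: mult_left_mono)
  also have "\<dots> \<le> QM * ((2 + TM)\<^sup>2 * (?d\<^sup>2 * (norm z)\<^sup>2)) + TM * VM * (2 + TM)\<^sup>2 * (?d\<^sup>2 * (norm z)\<^sup>2) + QM * (?d\<^sup>2 * (norm z)\<^sup>2)"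
    using QM VM T nk2 ny2 by (intro add_mono mult_left_mono) auto
  finally show ?thesis by (simp add: algebra_simps)
qed

lemma P_upper:
  assumes s: "s \<in> {t j..t (Suc j)}"
  shows "z \<bullet> (P j s *v z) \<le> pmax P0 * (norm z)\<^sup>2"
proof -
  define c where "c = 2 + TM"
  define d where "d = 1 + 1 / Tm"
  define v where "v = TM * VM * c\<^sup>2"
  define p0 where "p0 = norm P0 * c\<^sup>2 + v"
  note ge = pmax_ge[OF c_def d_def v_def p0_def]
  have fs: "z \<bullet> (P j s *v z) \<le> adj s z (t j) \<bullet> (P j (t j) *v adj s z (t j)) + v * (norm z)\<^sup>2"
    "(norm (adj s z (t j)))\<^sup>2 \<le> c\<^sup>2 * (norm z)\<^sup>2" if "s \<in> {t j..t (Suc j)}" for s j z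
    using flow_step[OF that, of z] by (simp_all add: v_def c_def)
  have step: "z \<bullet> (P j s *v z) \<le> (p * c\<^sup>2 + v) * (norm z)\<^sup>2"
    if "s \<in> {t j..t (Suc j)}" "0 \<le> p" "\<And>y. y \<bullet> (P j (t j) *v y) \<le> p * (norm y)\<^sup>2" for p s j z
  proof -
    have "adj s z (t j) \<bullet> (P j (t j) *v adj s z (t j)) \<le> p * (norm (adj s z (t j)))\<^sup>2" by (rule that(3))
    also have "\<dots> \<le> p * (c\<^sup>2 * (norm z)\<^sup>2)" using that(2) fs(2)[OF that(1)] by (intro mult_left_mono) auto
    finally show ?thesis using fs(1)[OF that(1), of z] by (simp add: algebra_simps)
  qed
  have v0: "0 \<le> v" using VM T by (simp add: v_def)
  have p00: "0 \<le> p0" using v0 by (simp add: p0_def)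
  have z0: "z \<bullet> (P 0 s *v z) \<le> p0 * (norm z)\<^sup>2" if "s \<in> {t 0..t (Suc 0)}" for s z
    unfolding p0_def by (rule step[OF that]) (auto simp: t0 P_init intro: quadratic_up)
  \<comment> \<open>Two jumps at distance at least \<open>Tm\<close> are available only from the
    second jump on; before that, the bound has to come from \<open>P0\<close>.\<close>
  consider "j = 0" | "j = 1" | i where "j = Suc (Suc i)" by (metis One_nat_def not0_implies_Suc)
  then show ?thesis
  proof cases
    case 1
    have "p0 * (norm z)\<^sup>2 \<le> pmax P0 * (norm z)\<^sup>2" using ge(1) by (intro mult_right_mono) auto
    then show ?thesis using z0[of s z] s 1 by auto
  next
    case 2
    have s1: "s \<in> {t (Suc 0)..t (Suc (Suc 0))}" using s 2 by simp
    \<comment> \<open>With the impulse zero: a jump never increases \<open>P\<close>.\<close>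
    have "y \<bullet> (P (Suc 0) (t (Suc 0)) *v y) \<le> p0 * (norm y)\<^sup>2" for y
      using jump_step[of y 0 0] z0[of "t (Suc 0)" y] t_mono[of 0] by simp
    then have "z \<bullet> (P (Suc 0) s *v z) \<le> (p0 * c\<^sup>2 + v) * (norm z)\<^sup>2" by (rule step[OF s1 p00])
    also have "\<dots> \<le> pmax P0 * (norm z)\<^sup>2" using ge(2) by (intro mult_right_mono) auto
    finally show ?thesis using 2 by simp
  next
    case 3
    define p where "p = QM * d\<^sup>2 + v * d\<^sup>2 + QM * c\<^sup>2 * d\<^sup>2"
    have p: "0 \<le> p" using QM v0 by (simp add: p_def)
    have s1: "s \<in> {t (Suc (Suc i))..t (Suc (Suc (Suc i)))}" using s 3 by simp
    have "y \<bullet> (P (Suc (Suc i)) (t (Suc (Suc i))) *v y) \<le> p * (norm y)\<^sup>2" for y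
      using P_upper_start[of y i] by (simp add: p_def v_def c_def d_def)
    then have "z \<bullet> (P (Suc (Suc i)) s *v z) \<le> (p * c\<^sup>2 + v) * (norm z)\<^sup>2" by (rule step[OF s1 p])
    also have "p * c\<^sup>2 + v = v + QM * d\<^sup>2 * c\<^sup>2 + v * d\<^sup>2 * c\<^sup>2 + QM * c\<^sup>2 * d\<^sup>2 * c\<^sup>2"
      by (simp add: p_def algebra_simps)
    also have "\<dots> * (norm z)\<^sup>2 \<le> pmax P0 * (norm z)\<^sup>2" using ge(3) by (intro mult_right_mono) auto
    finally show ?thesis using 3 by simp
  qed
qed

end

context riccati_data
begin

text \<open>The weights of the dual bound satisfy a recursion: over a full interval \<open>w\<close>
  becomes at most \<open>e * w + c * \<rho> ^ j * m\<close>, and jumps leave it unchanged. Both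
  \<open>C\<close> and \<open>r\<close> are independent of the run; \<open>m\<close> bounds the
  initial error and scales the forcing.\<close>

lemma riccati_run_error_decay:
  assumes P0: "pos_def P0" and \<rho>: "0 < \<rho>" "\<rho> < 1" and G: "0 \<le> G"
  shows "\<exists>C r. 0 \<le> C \<and> \<rho> \<le> r \<and> r < 1 \<and> (\<forall>t P X \<delta> m.
    riccati_run R \<omega> V Q vm VM qm QM Tm TM t P P0 \<and>
    (\<forall>j. \<forall>s\<in>{t j..t (Suc j)}. (X j has_vector_derivative (A_mat (\<omega> s) *v X j s + \<delta> j s)) (at s within {t j..t (Suc j)})) \<and>
    (\<forall>j. X (Suc j) (t (Suc j)) = (mat 1 - gain (P j (t (Suc j))) (Q (t (Suc j))) ** C_mat) *v X j (t (Suc j))) \<and>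
    (\<forall>j. \<forall>s\<in>{t j..t (Suc j)}. (norm (\<delta> j s))\<^sup>2 \<le> G * \<rho> ^ j * m) \<and> (norm (X 0 0))\<^sup>2 \<le> m \<longrightarrow>
    (\<forall>j. \<forall>s\<in>{t j..t (Suc j)}. (norm (X j s))\<^sup>2 \<le> C * r ^ j * m))"
proof -
  define pM where "pM = pmax P0"
  have pM: "0 < pM" by (simp add: pM_def pmax_pos)
  define \<alpha> where "\<alpha> = vm / (2 * pM)"
  define \<beta> where "\<beta> = vm / 2"
  have \<alpha>: "0 < \<alpha>" "0 < \<beta>" using vm pM by (auto simp: \<alpha>_def \<beta>_def)
  define c where "c = G / (\<alpha> * \<beta>)"
  have c: "0 \<le> c" using \<alpha> G by (simp add: c_def)
  define l where "l = lambda_min P0"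
  have l: "0 < l" unfolding l_def by (rule pos_def_lambda_min_pos[OF P0])
  define e where "e = exp (- \<alpha> * Tm)"
  have e: "0 < e" "e < 1" using \<alpha> T by (auto simp: e_def)
  \<comment> \<open>Strictly above the contraction factor \<open>e\<close>, which leaves room for
    the forcing, and above \<rho>, so that powers of \<rho> are dominated.\<close>
  define r where "r = (1 + max \<rho> e) / 2"
  have r: "\<rho> \<le> r" "e < r" "r < 1" "0 < r" using \<rho> e by (auto simp: r_def max_def)
  \<comment> \<open>The first summand covers the initial interval, where no contraction is
    guaranteed. The second gives \<open>c \<le> B * (r - e)\<close>, which makes
    \<open>B * r ^ j * m\<close> a supersolution of the recursion.\<close>
  define B where "B = (1 / l + c) / r + c / (r - e)"
  have B1: "1 / l + c \<le> B * r"
  proof -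
    have "B * r = (1 / l + c) + (c / (r - e)) * r" using r by (simp add: B_def field_simps)
    then show ?thesis using c r by simp
  qed
  have B2: "c \<le> B * (r - e)"
  proof -
    have "B * (r - e) = (1 / l + c) / r * (r - e) + c" using r by (simp add: B_def distrib_right)
    moreover have "0 \<le> (1 / l + c) / r * (r - e)" using c l r by simp
    ultimately show ?thesis by linarith
  qed
  have B0: "0 \<le> B" using c l r by (simp add: B_def)
  have "B * r \<le> B * 1" using B0 r by (intro mult_left_mono) auto
  then have B3: "1 / l \<le> B" using B1 c by simp
  define C where "C = pM * (B + c)"
  have C: "0 \<le> C" using pM B0 c by (simp add: C_def)
  show ?thesis
  proof (rule exI[of _ C], rule exI[of _ r], intro conjI C r allI impI ballI, elim conjE)
    fix t P X \<delta> m j s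
    assume run: "riccati_run R \<omega> V Q vm VM qm QM Tm TM t P P0"
      and X: "\<forall>j. \<forall>s\<in>{t j..t (Suc j)}. (X j has_vector_derivative (A_mat (\<omega> s) *v X j s + \<delta> j s)) (at s within {t j..t (Suc j)})"
      and X_jump: "\<forall>j. X (Suc j) (t (Suc j)) = (mat 1 - gain (P j (t (Suc j))) (Q (t (Suc j))) ** C_mat) *v X j (t (Suc j))"
      and \<delta>: "\<forall>j. \<forall>s\<in>{t j..t (Suc j)}. (norm (\<delta> j s))\<^sup>2 \<le> G * \<rho> ^ j * m" and m: "(norm (X 0 0))\<^sup>2 \<le> m"
      and s: "s \<in> {t j..t (Suc j)}"
    interpret run: riccati_run R \<omega> V Q vm VM qm QM Tm TM t P P0 by (rule run)
    have m0: "0 \<le> m" using m by (meson order_trans zero_le_power2)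
    have flow: "(z \<bullet> X j s)\<^sup>2 \<le> (exp (- \<alpha> * (s - t j)) * w + c * \<rho> ^ j * m) * (z \<bullet> (P j s *v z))"
      if s: "s \<in> {t j..t (Suc j)}" and w: "\<And>z. (z \<bullet> X j (t j))\<^sup>2 \<le> w * (z \<bullet> (P j (t j) *v z))" for j s z w
    proof -
      define D where "D = sqrt (G * \<rho> ^ j * m)"
      have D2: "D\<^sup>2 = G * \<rho> ^ j * m" using G \<rho> m0 by (simp add: D_def)
      have "norm (\<delta> j s) \<le> D" if "s \<in> {t j..t (Suc j)}" for s
        using \<delta> that real_le_rsqrt by (auto simp: D_def)
      then have "(z \<bullet> X j s)\<^sup>2 \<le> (exp (- (vm / (2 * pM)) * (s - t j)) * w + D\<^sup>2 / (vm / (2 * pM) * (vm / 2))) * (z \<bullet> (P j s *v z))"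
        by (intro flow_error_decay[OF run.t_nonneg s run.P_pos_def_start run.P_ode _ pM])
          (use X w run.P_upper in \<open>auto simp: pM_def\<close>)
      then show ?thesis by (simp add: \<alpha>_def[symmetric] \<beta>_def[symmetric] D2 c_def)
    qed
    have Ppos: "0 \<le> z \<bullet> (P j s *v z)" if "s \<in> {t j..t (Suc j)}" for z j s
      using run.P_pos_def[OF that] by (auto simp: pos_def_def) (metis inner_zero_left less_imp_le order_refl)
    have in1: "t j \<in> {t j..t (Suc j)}" "t (Suc j) \<in> {t j..t (Suc j)}" for j using run.t_mono by auto
    have jump: "(z \<bullet> X (Suc j) (t (Suc j)))\<^sup>2 \<le> w * (z \<bullet> (P (Suc j) (t (Suc j)) *v z))"
      if "0 \<le> w" "\<And>z. (z \<bullet> X j (t (Suc j)))\<^sup>2 \<le> w * (z \<bullet> (P j (t (Suc j)) *v z))" for j z w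
      unfolding run.P_jump X_jump[rule_format]
      by (rule jump_error[OF run.t_nonneg run.P_pos_def[OF in1(2)] that])
    have weaken: "(z \<bullet> X j s)\<^sup>2 \<le> w' * (z \<bullet> (P j s *v z))"
      if "(z \<bullet> X j s)\<^sup>2 \<le> w * (z \<bullet> (P j s *v z))" "w \<le> w'" "s \<in> {t j..t (Suc j)}" for z j s w w'
      using that(1) mult_right_mono[OF that(2) Ppos[OF that(3)]] by (rule order_trans)
    \<comment> \<open>The only lower bound on \<open>P\<close> in the decay estimate: at the initial
      time, by \<open>lambda_min P0\<close>.\<close>
    have w0: "(z \<bullet> X 0 (t 0))\<^sup>2 \<le> ((1 / l) * m) * (z \<bullet> (P 0 (t 0) *v z))" for z
    proof -
      have "(z \<bullet> X 0 (t 0))\<^sup>2 \<le> (norm z * norm (X 0 (t 0)))\<^sup>2"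
        by (simp add: Cauchy_Schwarz_ineq2 abs_le_square_iff[symmetric])
      also have "\<dots> = (norm (X 0 0))\<^sup>2 * (norm z)\<^sup>2" by (simp add: power_mult_distrib run.t0 mult.commute)
      also have "\<dots> \<le> m * (norm z)\<^sup>2" using m by (intro mult_right_mono) auto
      also have "\<dots> = ((1 / l) * m) * (l * (norm z)\<^sup>2)" using l by simp
      also have "\<dots> \<le> ((1 / l) * m) * (z \<bullet> (P 0 (t 0) *v z))"
        using Rayleigh_bounds(1)[of P0 z] P0 l m0
        by (intro mult_left_mono) (auto simp: run.t0 run.P_init l_def pos_def_def dot_square_norm)
      finally show ?thesis .
    qed
    have w1: "(z \<bullet> X (Suc 0) (t (Suc 0)))\<^sup>2 \<le> ((1 / l + c) * m) * (z \<bullet> (P (Suc 0) (t (Suc 0)) *v z))" for z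
    proof (rule jump)
      show "0 \<le> (1 / l + c) * m" using l c m0 by simp
      have "exp (- \<alpha> * (t (Suc 0) - t 0)) \<le> 1" using \<alpha> run.t_mono[of 0] by simp
      then have "exp (- \<alpha> * (t (Suc 0) - t 0)) * ((1 / l) * m) \<le> 1 * ((1 / l) * m)"
        using l m0 by (intro mult_right_mono) auto
      then have le: "exp (- \<alpha> * (t (Suc 0) - t 0)) * ((1 / l) * m) + c * \<rho> ^ 0 * m \<le> (1 / l + c) * m"
        by (simp add: algebra_simps)
      show "(z \<bullet> X 0 (t (Suc 0)))\<^sup>2 \<le> ((1 / l + c) * m) * (z \<bullet> (P 0 (t (Suc 0)) *v z))" for z
        by (rule weaken[OF flow[OF in1(2) w0] le in1(2)])
    qed
    \<comment> \<open>The induction starts after the first jump, since only later intervals have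
      length at least \<open>Tm\<close>.\<close>
    have wS: "\<forall>z. (z \<bullet> X (Suc j) (t (Suc j)))\<^sup>2 \<le> (B * r ^ Suc j * m) * (z \<bullet> (P (Suc j) (t (Suc j)) *v z))" for j
    proof (induction j)
      case 0
      have "(1 / l + c) * m \<le> B * r ^ Suc 0 * m" using B1 m0 by (intro mult_right_mono) auto
      then show ?case using weaken[OF w1 _ in1(1)] by blast
    next
      case (Suc j)
      let ?j = "Suc j"
      have IH: "(z \<bullet> X ?j (t ?j))\<^sup>2 \<le> (B * r ^ ?j * m) * (z \<bullet> (P ?j (t ?j) *v z))" for z using Suc by blast
      have "\<alpha> * Tm \<le> \<alpha> * (t (Suc ?j) - t ?j)" using \<alpha> run.t_ge[of j] by (intro mult_left_mono) auto
      then have "exp (- \<alpha> * (t (Suc ?j) - t ?j)) \<le> e" by (simp add: e_def)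
      then have "exp (- \<alpha> * (t (Suc ?j) - t ?j)) * (B * r ^ ?j * m) \<le> e * (B * r ^ ?j * m)"
        using B0 r m0 by (intro mult_right_mono) auto
      moreover have "c * \<rho> ^ ?j * m \<le> (B * (r - e)) * r ^ ?j * m"
        using B2 r \<rho> c B0 m0 by (intro mult_right_mono mult_mono power_mono) auto
      ultimately have le: "exp (- \<alpha> * (t (Suc ?j) - t ?j)) * (B * r ^ ?j * m) + c * \<rho> ^ ?j * m \<le> B * r ^ Suc ?j * m"
        by (simp add: algebra_simps)
      show ?case
      proof
        fix z show "(z \<bullet> X (Suc ?j) (t (Suc ?j)))\<^sup>2 \<le> (B * r ^ Suc ?j * m) * (z \<bullet> (P (Suc ?j) (t (Suc ?j)) *v z))"
        proof (rule jump)
          show "0 \<le> B * r ^ Suc ?j * m" using B0 r m0 by simp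
          show "(z \<bullet> X ?j (t (Suc ?j)))\<^sup>2 \<le> (B * r ^ Suc ?j * m) * (z \<bullet> (P ?j (t (Suc ?j)) *v z))" for z
            by (rule weaken[OF flow[OF in1(2) IH] le in1(2)])
        qed
      qed
    qed
    have w: "(z \<bullet> X j (t j))\<^sup>2 \<le> (B * r ^ j * m) * (z \<bullet> (P j (t j) *v z))" for z
    proof (cases j)
      case 0
      have "(1 / l) * m \<le> B * r ^ 0 * m" using mult_right_mono[OF B3 m0] by simp
      then show ?thesis using weaken[OF w0 _ in1(1)] 0 by blast
    next
      case (Suc i)
      then show ?thesis using wS[of i] by blast
    qed
    have "exp (- \<alpha> * (s - t j)) \<le> 1" using \<alpha> s by simp
    then have "exp (- \<alpha> * (s - t j)) * (B * r ^ j * m) \<le> 1 * (B * r ^ j * m)"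
      using B0 r m0 by (intro mult_right_mono) auto
    moreover have "c * \<rho> ^ j * m \<le> c * r ^ j * m" using c \<rho> r m0 by (intro mult_right_mono mult_left_mono power_mono) auto
    ultimately have le: "exp (- \<alpha> * (s - t j)) * (B * r ^ j * m) + c * \<rho> ^ j * m \<le> (B + c) * r ^ j * m"
      by (simp add: algebra_simps)
    \<comment> \<open>Choosing the error itself as dual vector returns to its norm: one factor of
      its square cancels against the upper bound of \<open>P\<close>.\<close>
    have "(X j s \<bullet> X j s)\<^sup>2 \<le> ((B + c) * r ^ j * m) * (X j s \<bullet> (P j s *v X j s))"
      by (rule weaken[OF flow[OF s w] le s])
    also have "\<dots> \<le> ((B + c) * r ^ j * m) * (pM * (norm (X j s))\<^sup>2)"
      unfolding pM_def using B0 c r m0 by (intro mult_left_mono run.P_upper[OF s]) auto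
    finally have "(norm (X j s))\<^sup>2 * (norm (X j s))\<^sup>2 \<le> (C * r ^ j * m) * (norm (X j s))\<^sup>2"
      by (simp add: C_def dot_square_norm power2_eq_square mult_ac)
    then show "(norm (X j s))\<^sup>2 \<le> C * r ^ j * m"
    proof (cases "X j s = 0")
      case True
      then show ?thesis using pM B0 c r m0 by (simp add: C_def)
    next
      case False
      then have "0 < (norm (X j s))\<^sup>2" by simp
      with \<open>(norm (X j s))\<^sup>2 * (norm (X j s))\<^sup>2 \<le> _\<close> show ?thesis by (rule mult_right_le_imp_le)
    qed
  qed
qed

end

section \<open>Flows of the error system\<close>

lemma bounded_linear_block_mat:
  "bounded_linear (\<lambda>(A, B, C, D). block_mat A B C D)"
proof -
  let ?f = "\<lambda>(A, B, C, D). block_mat A B C D"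
  have "linear ?f"
    by (rule linearI) (auto simp: block_mat_def vec_eq_iff split: sum.splits prod.splits)
  then show ?thesis by (rule linear_conv_bounded_linear[THEN iffD1])
qed

lemma has_vector_derivative_block_mat [derivative_intros]:
  assumes "(A has_vector_derivative A') (at t within S)" "(B has_vector_derivative B') (at t within S)"
    "(C has_vector_derivative C') (at t within S)" "(D has_vector_derivative D') (at t within S)"
  shows "((\<lambda>s. block_mat (A s) (B s) (C s) (D s)) has_vector_derivative block_mat A' B' C' D') (at t within S)"
  using bounded_linear.has_vector_derivative[OF bounded_linear_block_mat
      has_vector_derivative_Pair[OF assms(1) has_vector_derivative_Pair[OF assms(2) has_vector_derivative_Pair[OF assms(3,4)]]]]
  by simp

lemma continuous_on_block_mat [continuous_intros]:
  assumes "continuous_on S A" "continuous_on S B" "continuous_on S C" "continuous_on S D"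
  shows "continuous_on S (\<lambda>s. block_mat (A s) (B s) (C s) (D s))"
  using bounded_linear.continuous_on[OF bounded_linear_block_mat
      continuous_on_Pair[OF assms(1) continuous_on_Pair[OF assms(2) continuous_on_Pair[OF assms(3,4)]]]]
  by simp

lemma continuous_on_A_mat [continuous_intros]: "continuous_on S w \<Longrightarrow> continuous_on S (\<lambda>s. A_mat (w s))"
  unfolding A_mat_def by (intro continuous_intros)

lemma block_mat_mult:
  "block_mat A B C D ** block_mat A' B' C' D' =
    block_mat (A ** A' + B ** C') (A ** B' + B ** D') (C ** A' + D ** C') (C ** B' + D ** D')"
  by (simp add: block_mat_def matrix_matrix_mult_def vec_eq_iff sum_UNIV_Plus split: sum.splits)

lemma block_mat_1: "block_mat (mat 1) 0 0 (mat 1) = mat 1"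
  by (simp add: block_mat_def mat_def vec_eq_iff split: sum.splits)

lemma matrix_mult_minus: "(- A) ** B = - (A ** B)" "A ** (- B) = - (A ** B)"
  for A :: "real ^ 'n ^ 'm" and B :: "real ^ 'k ^ 'n"
  by (rule bounded_bilinear.minus_left[OF bounded_bilinear_matrix_matrix_mult]
      bounded_bilinear.minus_right[OF bounded_bilinear_matrix_matrix_mult])+

lemma matrix_mult_scaleR: "(r *\<^sub>R A) ** B = r *\<^sub>R (A ** B)" "A ** (r *\<^sub>R B) = r *\<^sub>R (A ** B)"
  for A :: "real ^ 'n ^ 'm" and B :: "real ^ 'k ^ 'n"
  by (rule bounded_bilinear.scaleR_left[OF bounded_bilinear_matrix_matrix_mult]
      bounded_bilinear.scaleR_right[OF bounded_bilinear_matrix_matrix_mult])+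

lemma matrix_mult_add: "(A + A') ** B = A ** B + A' ** B"
  for A A' :: "real ^ 'n ^ 'm" and B :: "real ^ 'k ^ 'n"
  by (rule bounded_bilinear.add_left[OF bounded_bilinear_matrix_matrix_mult])

section \<open>Explicit attitude flow for constant angular rate\<close>

lemma skew_cube: "skew x ** skew x ** skew x = - ((norm x)\<^sup>2 *\<^sub>R skew x)"
proof -
  have "(norm x)\<^sup>2 = (x$1)\<^sup>2 + (x$2)\<^sup>2 + (x$3)\<^sup>2"
    unfolding power2_norm_eq_inner by (simp add: inner_vec_def sum_3 power2_eq_square)
  then show ?thesis
    by (simp add: vec_eq_iff forall_3 matrix_matrix_mult_def sum_3 skew_nth power2_eq_square algebra_simps)
qed

lemma has_vector_derivative_imp_continuous_on:
  assumes "\<And>s. s \<in> S \<Longrightarrow> (f has_vector_derivative f' s) (at s within S)"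
  shows "continuous_on S f"
  unfolding continuous_on_eq_continuous_within using has_vector_derivative_continuous[OF assms] by simp

text \<open>Rodrigues' formula for the exponential of
  \<open>- (s - a) *\<^sub>R skew \<eta>\<close>; the cubic relation reduces its derivative to the
  required product. Zero \<eta> is separate because of the division by the angular speed.\<close>

lemma rotation_flow_exists:
  fixes W0 :: mat3 and \<eta> :: vec3
  shows "\<exists>W. W a = W0 \<and> (\<forall>s S. (W has_vector_derivative W s ** skew (- \<eta>)) (at s within S))"
proof (cases "\<eta> = 0")
  case True
  have "skew 0 = 0" by (simp add: vec_eq_iff forall_3 skew_nth)
  then have "((\<lambda>s. W0) has_vector_derivative W0 ** skew (- \<eta>)) (at s within S)" for s S
    using True by (simp add: matrix_matrix_mult_def zero_vec_def[symmetric])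
  then show ?thesis by (intro exI[of _ "\<lambda>_. W0"]) simp
next
  case False
  define \<theta> where "\<theta> = norm \<eta>"
  have \<theta>: "\<theta> \<noteq> 0" using False by (simp add: \<theta>_def)
  define K where "K = skew \<eta>"
  define W where "W s = W0 ** (mat 1 - (sin (\<theta> * (s - a)) / \<theta>) *\<^sub>R K + ((1 - cos (\<theta> * (s - a))) / \<theta>\<^sup>2) *\<^sub>R (K ** K))" for s
  have K3: "K ** K ** K = - (\<theta>\<^sup>2 *\<^sub>R K)" unfolding K_def \<theta>_def by (rule skew_cube)
  have id: "(mat 1 - (p / \<theta>) *\<^sub>R K + ((1 - q) / \<theta>\<^sup>2) *\<^sub>R (K ** K)) ** (- K) = - (q *\<^sub>R K) + (p / \<theta>) *\<^sub>R (K ** K)" for p q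
  proof -
    have "(1 - q) / \<theta>\<^sup>2 * \<theta>\<^sup>2 = 1 - q" using \<theta> by simp
    then have "((1 - q) / \<theta>\<^sup>2) *\<^sub>R (K ** K ** K) = q *\<^sub>R K - K" by (simp only: K3 scaleR_minus_right scaleR_scaleR scaleR_diff_left) simp
    then show ?thesis
      by (simp add: matrix_mult_minus matrix_mult_scaleR matrix_mult_add bounded_bilinear.diff_left[OF bounded_bilinear_matrix_matrix_mult])
  qed
  have "(W has_vector_derivative W s ** skew (- \<eta>)) (at s within S)" for s S
  proof -
    have "((\<lambda>s. mat 1 - (sin (\<theta> * (s - a)) / \<theta>) *\<^sub>R K + ((1 - cos (\<theta> * (s - a))) / \<theta>\<^sup>2) *\<^sub>R (K ** K))
      has_vector_derivative (- (cos (\<theta> * (s - a)) *\<^sub>R K) + (sin (\<theta> * (s - a)) / \<theta>) *\<^sub>R (K ** K))) (at s within S)"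
      using \<theta> by (auto intro!: derivative_eq_intros simp: power2_eq_square)
    moreover have "(mat 1 - (sin (\<theta> * (s - a)) / \<theta>) *\<^sub>R K + ((1 - cos (\<theta> * (s - a))) / \<theta>\<^sup>2) *\<^sub>R (K ** K)) ** (- K)
        = - (cos (\<theta> * (s - a)) *\<^sub>R K) + (sin (\<theta> * (s - a)) / \<theta>) *\<^sub>R (K ** K)"
      by (rule id)
    ultimately have "(W has_vector_derivative W0 ** ((mat 1 - (sin (\<theta> * (s - a)) / \<theta>) *\<^sub>R K
        + ((1 - cos (\<theta> * (s - a))) / \<theta>\<^sup>2) *\<^sub>R (K ** K)) ** (- K))) (at s within S)"
      unfolding W_def using bounded_linear.has_vector_derivative[OF bounded_bilinear.bounded_linear_right[OF bounded_bilinear_matrix_matrix_mult]]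
      by fastforce
    then show ?thesis by (simp add: W_def K_def skew_minus matrix_mul_assoc)
  qed
  moreover have "W a = W0" by (simp add: W_def)
  ultimately show ?thesis by blast
qed

lemma vector_derivative_zero_constant:
  fixes f :: "real \<Rightarrow> 'a::real_normed_vector"
  assumes "\<And>t. t \<in> {a..b} \<Longrightarrow> (f has_vector_derivative 0) (at t within {a..b})" "s \<in> {a..b}"
  shows "f s = f a"
proof -
  have "norm (f s - f a) \<le> 0 * \<bar>s - a\<bar>"
    by (rule vector_derivative_Lipschitz[where f'="\<lambda>_. 0", OF assms(1)]) (use assms(2) in auto)
  then show ?thesis by simp
qed

text \<open>A conserved quantity with two uses: for one curve it preserves orthogonality, for two
  curves with the same start it gives uniqueness.\<close>

lemma rotation_flow_pairing:
  assumes W: "(W has_vector_derivative W s ** skew (- \<eta>)) (at s within S)"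
    and W': "(W' has_vector_derivative W' s ** skew (- \<eta>)) (at s within S)"
  shows "((\<lambda>s. W s ** transpose (W' s)) has_vector_derivative 0) (at s within S)"
proof -
  have "((\<lambda>s. W s ** transpose (W' s)) has_vector_derivative
     (W s ** transpose (W' s ** skew (- \<eta>)) + (W s ** skew (- \<eta>)) ** transpose (W' s))) (at s within S)"
    by (intro derivative_intros W W')
  moreover have "W s ** transpose (W' s ** skew (- \<eta>)) + (W s ** skew (- \<eta>)) ** transpose (W' s) = 0"
    by (simp add: matrix_transpose_mul transpose_skew skew_minus transpose_uminus matrix_mult_minus matrix_mul_assoc)
  ultimately show ?thesis by simp
qed

text \<open>Orthogonality is conserved, and the continuous determinant cannot pass from
  \<open>1\<close> to \<open>-1\<close> without vanishing.\<close>

lemma rotation_flow_stays: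
  assumes W: "\<And>s. s \<in> {a..b} \<Longrightarrow> (W has_vector_derivative W s ** skew (- \<eta>)) (at s within {a..b})"
    and W0: "rotation_matrix (W a)" and s: "s \<in> {a..b}"
  shows "rotation_matrix (W s)"
proof -
  have orth: "orthogonal_matrix (W s)" if s: "s \<in> {a..b}" for s
  proof -
    have "W s ** transpose (W s) = W a ** transpose (W a)"
      by (rule vector_derivative_zero_constant[OF rotation_flow_pairing[OF W W] s])
    also have "\<dots> = mat 1" by (rule rotation_matrix_transpose_mult[OF W0])
    finally show ?thesis by (simp add: orthogonal_matrix_def matrix_left_right_inverse)
  qed
  have "continuous_on {a..b} W" by (rule has_vector_derivative_imp_continuous_on[OF W])
  then have "continuous_on {a..s} W" by (rule continuous_on_subset) (use s in auto)
  then have c: "continuous_on {a..s} (\<lambda>s. det (W s))" unfolding det_3 by (intro continuous_intros)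
  have "det (W s) \<noteq> -1"
  proof
    assume "det (W s) = -1"
    then obtain r where "r \<in> {a..s}" "det (W r) = 0"
      using IVT2'[of "\<lambda>s. det (W s)" s 0 a] c s W0 by (auto simp: rotation_matrix_def)
    then show False using det_orthogonal_matrix[OF orth[of r]] s by auto
  qed
  then show ?thesis using orth[OF s] det_orthogonal_matrix[OF orth[OF s]] by (auto simp: rotation_matrix_def)
qed

section \<open>Uniqueness and existence of flows of the whole system\<close>

locale h2_system = riccati_data R \<omega> V Q vm VM qm QM Tm TM
  for R \<omega> V Q vm VM qm QM Tm TM +
  fixes g :: vec3 and M :: mat3 and kR :: real
  assumes \<omega>_cont: "continuous_on {0..} \<omega>" and V_cont: "continuous_on {0..} V"
begin

lemma R_cont: "continuous_on {0..} R"
  by (rule has_vector_derivative_imp_continuous_on[OF R_ode]) simp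

lemma cont_sub: "0 \<le> a \<Longrightarrow> continuous_on {0..} f \<Longrightarrow> continuous_on {a..b} f" for f :: "real \<Rightarrow> 'a::topological_space"
  by (erule continuous_on_subset) auto

definition drift :: "(real \<Rightarrow> mat3) \<Rightarrow> real \<Rightarrow> vec6" where
  "drift W s = block_vec 0 (transpose (R s - transpose (W s) ** R s) *v g)"

definition flow_on :: "real \<Rightarrow> real \<Rightarrow> (real \<Rightarrow> mat3) \<Rightarrow> vec3 \<Rightarrow> (real \<Rightarrow> vec6) \<Rightarrow> (real \<Rightarrow> mat6) \<Rightarrow> bool" where
  "flow_on a b W \<eta> X S \<longleftrightarrow> (\<forall>s\<in>{a..b}. rotation_matrix (W s) \<and>
     (W has_vector_derivative W s ** skew (- \<eta>)) (at s within {a..b}) \<and>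
     (X has_vector_derivative A_mat (\<omega> s) *v X s + drift W s) (at s within {a..b}) \<and>
     (S has_vector_derivative riccati_flow (A_mat (\<omega> s)) (V s) (S s)) (at s within {a..b}))"

lemma flow_on_continuous:
  assumes "flow_on a b W \<eta> X S"
  shows "continuous_on {a..b} W" "continuous_on {a..b} X" "continuous_on {a..b} S"
  using assms unfolding flow_on_def
  by (auto intro: has_vector_derivative_imp_continuous_on)

text \<open>The conserved product settles the attitude. The difference of two \<open>X\<close>, and
  likewise of two \<open>S\<close>, then solves a homogeneous linear equation, so its pairings with
  adjoint solutions are constant; these pairings determine it at the final time.\<close>

lemma flow_on_unique:
  assumes a: "0 \<le> a" and s: "s \<in> {a..b}" and f: "flow_on a b W \<eta> X S" "flow_on a b W' \<eta> X' S'"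
    and ini: "W a = W' a" "X a = X' a" "S a = S' a"
  shows "W s = W' s" "X s = X' s" "S s = S' s"
proof -
  have W_eq: "W r = W' r" if r: "r \<in> {a..b}" for r
  proof -
    have ra: "a \<in> {a..b}" using r by auto
    have "W r ** transpose (W' r) = W a ** transpose (W' a)"
      by (rule vector_derivative_zero_constant[OF rotation_flow_pairing r]) (use f in \<open>auto simp: flow_on_def\<close>)
    also have "\<dots> = mat 1"
      using f(2) ra rotation_matrix_transpose_mult(2) unfolding flow_on_def ini by blast
    finally have "(W r ** transpose (W' r)) ** W' r = W' r" by simp
    moreover have "transpose (W' r) ** W' r = mat 1"
      using f(2) r rotation_matrix_transpose_mult(1) unfolding flow_on_def by blast
    ultimately show ?thesis by (simp add: matrix_mul_assoc[symmetric])
  qed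
  have s0: "0 \<le> s" using a s by auto
  have d: "drift W r = drift W' r" if "r \<in> {a..b}" for r using W_eq[OF that] by (simp add: drift_def)
  have sub: "{a..s} \<subseteq> {a..b}" using s by auto
  have "X s - X' s = 0"
  proof -
    have "((\<lambda>r. X r - X' r) has_vector_derivative A_mat (\<omega> r) *v (X r - X' r) + 0) (at r within {a..b})" if r: "r \<in> {a..b}" for r
    proof -
      have "((\<lambda>r. X r - X' r) has_vector_derivative (A_mat (\<omega> r) *v X r + drift W r) - (A_mat (\<omega> r) *v X' r + drift W' r)) (at r within {a..b})"
        using f r by (intro derivative_intros) (auto simp: flow_on_def)
      then show ?thesis using d[OF r] by (simp add: matrix_vector_mult_diff_distrib)
    qed
    then have "adj s z s \<bullet> (X s - X' s) = adj s z a \<bullet> (X a - X' a)" for z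
      using pairing_X[OF a, of _ b "\<lambda>r. X r - X' r" "\<lambda>_. 0" s z]
      by (intro vector_derivative_zero_constant[where b=b and f="\<lambda>r. adj s z r \<bullet> (X r - X' r)"]) (use s in auto)
    then have "z \<bullet> (X s - X' s) = 0" for z using ini adj_self[OF s0] by simp
    then show ?thesis using inner_eq_zero_iff by blast
  qed
  then show "X s = X' s" by simp
  have "adj s z s \<bullet> (S s *v adj s y s) - adj s z s \<bullet> (S' s *v adj s y s)
    = adj s z a \<bullet> (S a *v adj s y a) - adj s z a \<bullet> (S' a *v adj s y a)" for z y
  proof (rule vector_derivative_zero_constant[where b=b and f="\<lambda>r. adj s z r \<bullet> (S r *v adj s y r) - adj s z r \<bullet> (S' r *v adj s y r)", OF _ s])
    fix r assume r: "r \<in> {a..b}"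
    have "((\<lambda>r. adj s z r \<bullet> (S r *v adj s y r) - adj s z r \<bullet> (S' r *v adj s y r)) has_vector_derivative
      adj s z r \<bullet> (V r *v adj s y r) - adj s z r \<bullet> (V r *v adj s y r)) (at r within {a..b})"
      by (intro has_vector_derivative_diff pairing_P[OF a r]) (use f r in \<open>auto simp: flow_on_def\<close>)
    then show "((\<lambda>r. adj s z r \<bullet> (S r *v adj s y r) - adj s z r \<bullet> (S' r *v adj s y r)) has_vector_derivative 0) (at r within {a..b})"
      by simp
  qed
  then show "S s = S' s" using ini adj_self[OF s0] by (intro matrix_eqI_inner) simp
  show "W s = W' s" by (rule W_eq[OF s])
qed

text \<open>Transition matrix of \<open>A\<^sub>t\<close> and its inverse, up to the constant rotation \<open>R a\<close>: in the coordinates obtained by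
  multiplying both blocks by \<open>R\<close> the system is a double integrator.\<close>

definition trans_mat :: "real \<Rightarrow> real \<Rightarrow> mat6" where
  "trans_mat a s = block_mat (transpose (R s)) ((s - a) *\<^sub>R transpose (R s)) 0 (transpose (R s))"

definition trans_inv :: "real \<Rightarrow> real \<Rightarrow> mat6" where
  "trans_inv a s = block_mat (R s) (- ((s - a) *\<^sub>R R s)) 0 (R s)"

lemma trans_mat_inv: "0 \<le> s \<Longrightarrow> trans_mat a s ** trans_inv a s = mat 1"
  by (simp add: trans_mat_def trans_inv_def block_mat_mult matrix_mult_minus matrix_mult_scaleR
      rotation_matrix_transpose_mult[OF R_rot] block_mat_1[symmetric])

lemma trans_mat_derivative:
  assumes s: "0 \<le> s"
  shows "(trans_mat a has_vector_derivative A_mat (\<omega> s) ** trans_mat a s) (at s within {0..})"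
proof -
  have T: "transpose (R s ** skew (\<omega> s)) = - (skew (\<omega> s) ** transpose (R s))"
    by (simp add: matrix_transpose_mul transpose_skew matrix_mult_minus)
  have "((\<lambda>s. block_mat (transpose (R s)) ((s - a) *\<^sub>R transpose (R s)) 0 (transpose (R s))) has_vector_derivative
    block_mat (transpose (R s ** skew (\<omega> s))) ((s - a) *\<^sub>R transpose (R s ** skew (\<omega> s)) + 1 *\<^sub>R transpose (R s)) 0
      (transpose (R s ** skew (\<omega> s)))) (at s within {0..})"
    using s by (auto intro!: derivative_eq_intros R_ode)
  moreover have "block_mat (transpose (R s ** skew (\<omega> s))) ((s - a) *\<^sub>R transpose (R s ** skew (\<omega> s)) + 1 *\<^sub>R transpose (R s)) 0
      (transpose (R s ** skew (\<omega> s))) = A_mat (\<omega> s) ** trans_mat a s"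
    unfolding T by (simp add: A_mat_def trans_mat_def block_mat_mult matrix_mult_minus matrix_mult_scaleR)
  ultimately show ?thesis unfolding trans_mat_def by simp
qed

text \<open>The attitude comes first because it drives \<open>X\<close>. Then \<open>X\<close> and
  \<open>S\<close> are obtained by variation of constants, \<open>S\<close> with the transition
  matrix acting from both sides.\<close>

lemma flow_on_exists:
  assumes a: "0 \<le> a" "a \<le> b" and W0: "rotation_matrix W0"
  shows "\<exists>W X S. W a = W0 \<and> X a = X0 \<and> S a = S0 \<and> flow_on a b W \<eta> X S"
proof -
  obtain W where W: "W a = W0" "\<And>s S. (W has_vector_derivative W s ** skew (- \<eta>)) (at s within S)"
    using rotation_flow_exists by blast
  have W_cont: "continuous_on {a..b} W"
    by (rule has_vector_derivative_imp_continuous_on[OF W(2)])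
  note Rc = cont_sub[OF a(1) R_cont, of b]
  have inv_cont: "continuous_on {a..b} (trans_inv a)"
    unfolding trans_inv_def by (intro continuous_intros Rc)
  have drift_cont: "continuous_on {a..b} (drift W)"
    unfolding drift_def by (intro continuous_intros Rc W_cont)
  have der: "(trans_mat a has_vector_derivative A_mat (\<omega> s) ** trans_mat a s) (at s within {a..b})" if "s \<in> {a..b}" for s
    by (rule has_vector_derivative_within_subset[OF trans_mat_derivative]) (use that a in auto)
  define y where "y s = trans_inv a a *v X0 + integral {a..s} (\<lambda>r. trans_inv a r *v drift W r)" for s
  define X where "X s = trans_mat a s *v y s" for s
  define Y where "Y s = trans_inv a a ** S0 ** transpose (trans_inv a a)
    + integral {a..s} (\<lambda>r. trans_inv a r ** V r ** transpose (trans_inv a r))" for s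
  define S where "S s = trans_mat a s ** Y s ** transpose (trans_mat a s)" for s
  have dy: "(y has_vector_derivative trans_inv a s *v drift W s) (at s within {a..b})" if s: "s \<in> {a..b}" for s
  proof -
    have "((\<lambda>s. integral {a..s} (\<lambda>r. trans_inv a r *v drift W r)) has_vector_derivative trans_inv a s *v drift W s) (at s within {a..b})"
      by (rule integral_has_vector_derivative[OF _ s]) (intro continuous_intros inv_cont drift_cont)
    then show ?thesis unfolding y_def by (auto intro!: derivative_eq_intros)
  qed
  have dY: "(Y has_vector_derivative trans_inv a s ** V s ** transpose (trans_inv a s)) (at s within {a..b})" if s: "s \<in> {a..b}" for s
  proof -
    have "((\<lambda>s. integral {a..s} (\<lambda>r. trans_inv a r ** V r ** transpose (trans_inv a r))) has_vector_derivative
        trans_inv a s ** V s ** transpose (trans_inv a s)) (at s within {a..b})"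
      by (rule integral_has_vector_derivative[OF _ s]) (intro continuous_intros inv_cont cont_sub[OF a(1) V_cont])
    then show ?thesis unfolding Y_def by (auto intro!: derivative_eq_intros)
  qed
  have aa: "trans_mat a a ** trans_inv a a = mat 1" by (rule trans_mat_inv[OF a(1)])
  have aa': "transpose (trans_inv a a) ** transpose (trans_mat a a) = mat 1"
    using arg_cong[OF aa, of transpose] by (simp add: matrix_transpose_mul transpose_mat)
  have "flow_on a b W \<eta> X S"
    unfolding flow_on_def
  proof (intro ballI conjI)
    fix s assume s: "s \<in> {a..b}"
    have s0: "0 \<le> s" using s a by auto
    show "rotation_matrix (W s)"
      by (rule rotation_flow_stays[OF W(2) _ s]) (simp add: W W0)
    show "(W has_vector_derivative W s ** skew (- \<eta>)) (at s within {a..b})" by (rule W(2))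
    have "(X has_vector_derivative trans_mat a s *v (trans_inv a s *v drift W s) + (A_mat (\<omega> s) ** trans_mat a s) *v y s) (at s within {a..b})"
      unfolding X_def by (intro derivative_intros der dy s)
    then show "(X has_vector_derivative A_mat (\<omega> s) *v X s + drift W s) (at s within {a..b})"
      by (simp add: X_def matrix_vector_mul_assoc trans_mat_inv[OF s0] add.commute)
    have inv1: "trans_mat a s ** (trans_inv a s ** B) = B" for B :: mat6
      by (simp add: matrix_mul_assoc trans_mat_inv[OF s0])
    have inv2: "transpose (trans_inv a s) ** transpose (trans_mat a s) = mat 1"
      using arg_cong[OF trans_mat_inv[OF s0, of a], of transpose] by (simp add: matrix_transpose_mul transpose_mat)
    have "(S has_vector_derivative (trans_mat a s ** Y s) ** transpose (A_mat (\<omega> s) ** trans_mat a s)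
       + (trans_mat a s ** (trans_inv a s ** V s ** transpose (trans_inv a s)) + (A_mat (\<omega> s) ** trans_mat a s) ** Y s) ** transpose (trans_mat a s))
       (at s within {a..b})"
      unfolding S_def by (intro derivative_intros der dY s)
    moreover have "(trans_mat a s ** Y s) ** transpose (A_mat (\<omega> s) ** trans_mat a s)
       + (trans_mat a s ** (trans_inv a s ** V s ** transpose (trans_inv a s)) + (A_mat (\<omega> s) ** trans_mat a s) ** Y s) ** transpose (trans_mat a s)
       = riccati_flow (A_mat (\<omega> s)) (V s) (S s)"
      by (simp add: riccati_flow_def S_def matrix_transpose_mul matrix_mult_add matrix_mul_assoc[symmetric] inv1 inv2)
    ultimately show "(S has_vector_derivative riccati_flow (A_mat (\<omega> s)) (V s) (S s)) (at s within {a..b})" by simp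
  qed
  moreover have "X a = X0" by (simp add: X_def y_def matrix_vector_mul_assoc aa)
  moreover have "S a = S0"
  proof -
    have "S a = (trans_mat a a ** trans_inv a a) ** S0 ** (transpose (trans_inv a a) ** transpose (trans_mat a a))"
      by (simp add: S_def Y_def matrix_mul_assoc)
    then show ?thesis by (simp add: aa aa')
  qed
  ultimately show ?thesis using W(1) by blast
qed

section \<open>Regularity of solutions on a flow interval\<close>

lemma h2_flow_eq:
  "h2_flow g R \<omega> t z = (fst z ** skew (- fst (snd z)), 0,
     A_mat (\<omega> t) *v fst (snd (snd z)) + block_vec 0 (transpose (R t - transpose (fst z) ** R t) *v g), - 1)"
  by (cases z) (simp add: h2_flow_def Let_def)

text \<open>An absolutely continuous solution is continuous, hence so is the right-hand side along
  it, and the equation holds at every time. The components can then be separated: \<eta> is constant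
  and the timer falls at unit rate.\<close>

lemma flow_regular:
  fixes z :: "real \<Rightarrow> h2_state" and S :: "real \<Rightarrow> mat6"
  assumes a: "0 \<le> a" and ac: "abs_continuous_on {a..b} (\<lambda>t. (z t, S t))"
    and der: "AE t in lebesgue. t \<in> {a..b} \<longrightarrow> ((\<lambda>s. (z s, S s)) has_vector_derivative
      (h2_flow g R \<omega> t (z t), riccati_flow (A_mat (\<omega> t)) (V t) (S t))) (at t within {a..b})"
    and space: "\<And>s. s \<in> {a..b} \<Longrightarrow> z s \<in> h2_space TM"
  shows "flow_on a b (\<lambda>s. fst (z s)) (fst (snd (z a))) (\<lambda>s. fst (snd (snd (z s)))) S"
    "s \<in> {a..b} \<Longrightarrow> fst (snd (z s)) = fst (snd (z a))"
    "s \<in> {a..b} \<Longrightarrow> snd (snd (snd (z s))) = snd (snd (snd (z a))) - (s - a)"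
proof -
  have c: "continuous_on {a..b} (\<lambda>t. (z t, S t))" by (rule abs_continuous_on_imp_continuous_on[OF ac])
  have cz: "continuous_on {a..b} z" using continuous_on_fst[OF c] by simp
  have cS: "continuous_on {a..b} S" using continuous_on_snd[OF c] by simp
  have "continuous_on {a..b} (\<lambda>t. (h2_flow g R \<omega> t (z t), riccati_flow (A_mat (\<omega> t)) (V t) (S t)))"
    unfolding h2_flow_eq riccati_flow_def
    by (intro continuous_intros cz cS
        cont_sub[OF a \<omega>_cont] cont_sub[OF a V_cont] cont_sub[OF a R_cont])
  note d = abs_continuous_ode_imp_has_vector_derivative[OF ac this der]
  have dz: "(z has_vector_derivative h2_flow g R \<omega> s (z s)) (at s within {a..b})"
    and dS: "(S has_vector_derivative riccati_flow (A_mat (\<omega> s)) (V s) (S s)) (at s within {a..b})" if "s \<in> {a..b}" for s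
    using bounded_linear.has_vector_derivative[OF bounded_linear_fst d[OF that]]
      bounded_linear.has_vector_derivative[OF bounded_linear_snd d[OF that]] by simp_all
  have dW: "((\<lambda>s. fst (z s)) has_vector_derivative fst (z s) ** skew (- fst (snd (z s)))) (at s within {a..b})"
    and dr: "((\<lambda>s. snd (z s)) has_vector_derivative snd (h2_flow g R \<omega> s (z s))) (at s within {a..b})" if "s \<in> {a..b}" for s
    using bounded_linear.has_vector_derivative[OF bounded_linear_fst dz[OF that]]
      bounded_linear.has_vector_derivative[OF bounded_linear_snd dz[OF that]] by (simp_all add: h2_flow_eq)
  have de: "((\<lambda>s. fst (snd (z s))) has_vector_derivative 0) (at s within {a..b})"
    and dr2: "((\<lambda>s. snd (snd (z s))) has_vector_derivative snd (snd (h2_flow g R \<omega> s (z s)))) (at s within {a..b})" if "s \<in> {a..b}" for s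
    using bounded_linear.has_vector_derivative[OF bounded_linear_fst dr[OF that]]
      bounded_linear.has_vector_derivative[OF bounded_linear_snd dr[OF that]] by (simp_all add: h2_flow_eq)
  have dX: "((\<lambda>s. fst (snd (snd (z s)))) has_vector_derivative A_mat (\<omega> s) *v fst (snd (snd (z s))) + drift (\<lambda>s. fst (z s)) s) (at s within {a..b})"
    and dt: "((\<lambda>s. snd (snd (snd (z s)))) has_vector_derivative - 1) (at s within {a..b})" if "s \<in> {a..b}" for s
    using bounded_linear.has_vector_derivative[OF bounded_linear_fst dr2[OF that]]
      bounded_linear.has_vector_derivative[OF bounded_linear_snd dr2[OF that]] by (simp_all add: h2_flow_eq drift_def)
  show e: "fst (snd (z s)) = fst (snd (z a))" if "s \<in> {a..b}" for s
    by (rule vector_derivative_zero_constant[where f="\<lambda>s. fst (snd (z s))", OF de that])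
  show "snd (snd (snd (z s))) = snd (snd (snd (z a))) - (s - a)" if "s \<in> {a..b}" for s
  proof -
    have "snd (snd (snd (z s))) + s = snd (snd (snd (z a))) + a"
    proof (rule vector_derivative_zero_constant[where f="\<lambda>s. snd (snd (snd (z s))) + s", OF _ that])
      fix s assume s: "s \<in> {a..b}"
      have "((\<lambda>s. snd (snd (snd (z s))) + s) has_vector_derivative - 1 + 1) (at s within {a..b})"
        by (intro derivative_intros dt s)
      then show "((\<lambda>s. snd (snd (snd (z s))) + s) has_vector_derivative 0) (at s within {a..b})" by simp
    qed
    then show ?thesis by simp
  qed
  show "flow_on a b (\<lambda>s. fst (z s)) (fst (snd (z a))) (\<lambda>s. fst (snd (snd (z s)))) S"
    unfolding flow_on_def
  proof (intro ballI conjI dX dS)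
    fix s assume s: "s \<in> {a..b}"
    show "rotation_matrix (fst (z s))" using space[OF s] by (auto simp: h2_space_def)
    show "((\<lambda>s. fst (z s)) has_vector_derivative fst (z s) ** skew (- fst (snd (z a)))) (at s within {a..b})"
      using dW[OF s] e[OF s] by simp
  qed
qed

end

section \<open>Extension of solutions\<close>

lemma C1_imp_abs_continuous_on:
  fixes f :: "real \<Rightarrow> 'a::real_normed_vector"
  assumes der: "\<And>t. t \<in> {a..b} \<Longrightarrow> (f has_vector_derivative f' t) (at t within {a..b})"
    and cont: "continuous_on {a..b} f'"
  shows "abs_continuous_on {a..b} f"
proof -
  have "bounded (f' ` {a..b})" by (intro compact_imp_bounded compact_continuous_image cont) simp
  then obtain B where B: "\<And>t. t \<in> {a..b} \<Longrightarrow> norm (f' t) \<le> B" unfolding bounded_iff by blast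
  show ?thesis
    by (rule Lipschitz_imp_abs_continuous_on[where B=B])
      (use vector_derivative_Lipschitz[OF der B] in \<open>simp add: dist_norm\<close>)
qed

context h2_system
begin

abbreviation flow_field :: "real \<Rightarrow> h2_state \<times> mat6 \<Rightarrow> h2_state \<times> mat6" where
  "flow_field \<equiv> \<lambda>t (z, S). (h2_flow g R \<omega> t z, riccati_flow (A_mat (\<omega> t)) (V t) S)"

abbreviation solution_pair :: "(real \<times> nat) set \<Rightarrow> (real \<times> nat \<Rightarrow> h2_state) \<Rightarrow> (real \<times> nat \<Rightarrow> mat6) \<Rightarrow> bool" where
  "solution_pair E x P \<equiv> hybrid_solution flow_field (h2_space TM \<times> UNIV)
     (\<lambda>t (z, S). h2_jump kR M Q Tm TM t S z \<times> {riccati_jump (Q t) S})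
     {((Rt, \<eta>, X, \<tau>), S). (Rt, \<eta>, X, \<tau>) \<in> h2_space TM \<and> \<tau> = 0} E (\<lambda>s. (x s, P s))"

lemma solution_flow:
  assumes sol: "solution_pair E x P" and a: "0 \<le> a" and sub: "{a..b} \<subseteq> {t. (t, j) \<in> E}"
  shows "flow_on a b (\<lambda>s. fst (x (s, j))) (fst (snd (x (a, j)))) (\<lambda>s. fst (snd (snd (x (s, j))))) (\<lambda>s. P (s, j))"
    "s \<in> {a..b} \<Longrightarrow> fst (snd (x (s, j))) = fst (snd (x (a, j)))"
    "s \<in> {a..b} \<Longrightarrow> snd (snd (snd (x (s, j)))) = snd (snd (snd (x (a, j)))) - (s - a)"
proof -
  let ?I = "{t. (t, j) \<in> E}"
  have lac: "locally_abs_continuous_on ?I (\<lambda>t. (x (t, j), P (t, j)))"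
    and der: "AE t in lebesgue. t \<in> ?I \<longrightarrow>
      ((\<lambda>s. (x (s, j), P (s, j))) has_vector_derivative flow_field t (x (t, j), P (t, j))) (at t within ?I)"
    using sol unfolding hybrid_solution_def Let_def by blast+
  have ac: "abs_continuous_on {a..b} (\<lambda>t. (x (t, j), P (t, j)))"
    using lac sub unfolding locally_abs_continuous_on_def by blast
  have der': "AE t in lebesgue. t \<in> {a..b} \<longrightarrow> ((\<lambda>s. (x (s, j), P (s, j))) has_vector_derivative
      (h2_flow g R \<omega> t (x (t, j)), riccati_flow (A_mat (\<omega> t)) (V t) (P (t, j)))) (at t within {a..b})"
    using der
  proof (rule eventually_mono)
    fix t assume h: "t \<in> ?I \<longrightarrow> ((\<lambda>s. (x (s, j), P (s, j))) has_vector_derivative flow_field t (x (t, j), P (t, j))) (at t within ?I)"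
    show "t \<in> {a..b} \<longrightarrow> ((\<lambda>s. (x (s, j), P (s, j))) has_vector_derivative
      (h2_flow g R \<omega> t (x (t, j)), riccati_flow (A_mat (\<omega> t)) (V t) (P (t, j)))) (at t within {a..b})"
    proof
      assume "t \<in> {a..b}"
      then have "((\<lambda>s. (x (s, j), P (s, j))) has_vector_derivative flow_field t (x (t, j), P (t, j))) (at t within ?I)"
        using h sub by blast
      then have "((\<lambda>s. (x (s, j), P (s, j))) has_vector_derivative flow_field t (x (t, j), P (t, j))) (at t within {a..b})"
        by (rule has_vector_derivative_within_subset[OF _ sub])
      then show "((\<lambda>s. (x (s, j), P (s, j))) has_vector_derivative
        (h2_flow g R \<omega> t (x (t, j)), riccati_flow (A_mat (\<omega> t)) (V t) (P (t, j)))) (at t within {a..b})" by simp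
    qed
  qed
  have space: "x (s, j) \<in> h2_space TM" if "s \<in> {a..b}" for s
    using sol sub that unfolding hybrid_solution_def by blast
  note fr = flow_regular[OF a ac der' space]
  show "flow_on a b (\<lambda>s. fst (x (s, j))) (fst (snd (x (a, j)))) (\<lambda>s. fst (snd (snd (x (s, j))))) (\<lambda>s. P (s, j))"
    by (rule fr(1))
  show "s \<in> {a..b} \<Longrightarrow> fst (snd (x (s, j))) = fst (snd (x (a, j)))" by (rule fr(2))
  show "s \<in> {a..b} \<Longrightarrow> snd (snd (snd (x (s, j)))) = snd (snd (snd (x (a, j)))) - (s - a)" by (rule fr(3))
qed

lemma flow_on_subset:
  assumes "flow_on a b W \<eta> X S" "c \<le> b"
  shows "flow_on a c W \<eta> X S"
proof -
  have sub: "{a..c} \<subseteq> {a..b}" using assms(2) by auto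
  show ?thesis
    unfolding flow_on_def
  proof (intro ballI conjI)
    fix s assume "s \<in> {a..c}"
    then have s: "s \<in> {a..b}" using sub by blast
    show "rotation_matrix (W s)" using assms(1) s unfolding flow_on_def by blast
    show "(W has_vector_derivative W s ** skew (- \<eta>)) (at s within {a..c})"
      by (rule has_vector_derivative_within_subset[OF _ sub]) (use assms(1) s in \<open>simp add: flow_on_def\<close>)
    show "(X has_vector_derivative A_mat (\<omega> s) *v X s + drift W s) (at s within {a..c})"
      by (rule has_vector_derivative_within_subset[OF _ sub]) (use assms(1) s in \<open>simp add: flow_on_def\<close>)
    show "(S has_vector_derivative riccati_flow (A_mat (\<omega> s)) (V s) (S s)) (at s within {a..c})"
      by (rule has_vector_derivative_within_subset[OF _ sub]) (use assms(1) s in \<open>simp add: flow_on_def\<close>)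
  qed
qed

lemma flow_on_derivative:
  assumes "flow_on a b W \<eta> X S" "s \<in> {a..b}"
  shows "((\<lambda>s. ((W s, \<eta>, X s, c - s), S s)) has_vector_derivative flow_field s ((W s, \<eta>, X s, c - s), S s)) (at s within {a..b})"
proof -
  have "((\<lambda>s. ((W s, \<eta>, X s, c - s), S s)) has_vector_derivative
    ((W s ** skew (- \<eta>), 0, A_mat (\<omega> s) *v X s + drift W s, 0 - 1), riccati_flow (A_mat (\<omega> s)) (V s) (S s))) (at s within {a..b})"
    using assms unfolding flow_on_def by (intro has_vector_derivative_Pair derivative_intros) auto
  then show ?thesis by (simp add: h2_flow_eq drift_def)
qed

lemma flow_on_field_continuous:
  assumes a: "0 \<le> a" and f: "flow_on a b W \<eta> X S"
  shows "continuous_on {a..b} (\<lambda>s. flow_field s ((W s, \<eta>, X s, c - s), S s))"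
  unfolding h2_flow_eq riccati_flow_def split_conv fst_conv snd_conv
  by (intro continuous_intros flow_on_continuous[OF f]
        cont_sub[OF a \<omega>_cont] cont_sub[OF a V_cont] cont_sub[OF a R_cont])

text \<open>The last interval is prolonged until the timer expires, and a jump is appended. Uniqueness of the flow makes
  the new solution agree with the old one.\<close>

lemma solution_extends:
  assumes sol: "solution_pair E x P" and t0: "t 0 = 0" and t: "incseq t"
    and E: "E = (\<Union>j<J. {t j..t (Suc j)} \<times> {j}) \<union> I \<times> {J}"
    and I: "t J \<in> I" "\<And>s. s \<in> I \<Longrightarrow> t J \<le> s \<and> {t J..s} \<subseteq> I"
  shows "\<exists>E' x' P'. solution_pair E' x' P' \<and> E \<subset> E' \<and> (\<forall>s\<in>E. x' s = x s \<and> P' s = P s)"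
proof -
  have lac: "locally_abs_continuous_on {s. (s, j) \<in> E} (\<lambda>t. (x (t, j), P (t, j)))"
    and der: "AE s in lebesgue. s \<in> {s. (s, j) \<in> E} \<longrightarrow>
      ((\<lambda>s. (x (s, j), P (s, j))) has_vector_derivative flow_field s (x (s, j), P (s, j))) (at s within {s. (s, j) \<in> E})" for j
    using sol unfolding hybrid_solution_def Let_def by blast+
  have jmp: "(x (s, j), P (s, j)) \<in> {((Rt, \<eta>, X, \<tau>), S). (Rt, \<eta>, X, \<tau>) \<in> h2_space TM \<and> \<tau> = 0}"
    "(x (s, Suc j), P (s, Suc j)) \<in> (\<lambda>t (z, S). h2_jump kR M Q Tm TM t S z \<times> {riccati_jump (Q t) S}) s (x (s, j), P (s, j))"
    if "(s, j) \<in> E" "(s, Suc j) \<in> E" for s j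
  proof -
    note H = sol[unfolded hybrid_solution_def, THEN conjunct2, THEN conjunct2, THEN conjunct2, THEN spec, THEN spec, THEN mp, OF conjI[OF that]]
    show "(x (s, j), P (s, j)) \<in> {((Rt, \<eta>, X, \<tau>), S). (Rt, \<eta>, X, \<tau>) \<in> h2_space TM \<and> \<tau> = 0}"
      by (rule H[THEN conjunct1])
    show "(x (s, Suc j), P (s, Suc j)) \<in> (\<lambda>t (z, S). h2_jump kR M Q Tm TM t S z \<times> {riccati_jump (Q t) S}) s (x (s, j), P (s, j))"
      by (rule H[THEN conjunct2])
  qed
  define a where "a = t J"
  have tn: "0 \<le> t j" for j using incseqD[OF t, of 0 j] t0 by simp
  have a: "0 \<le> a" by (simp add: a_def tn)
  have tJ: "j \<le> J \<Longrightarrow> t j \<le> a" for j using incseqD[OF t] by (simp add: a_def)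
  have aE: "(a, J) \<in> E" using I(1) by (auto simp: E a_def)
  obtain W0 \<eta> X0 \<tau>0 where x0: "x (a, J) = (W0, \<eta>, X0, \<tau>0)" by (cases "x (a, J)") auto
  have "x (a, J) \<in> h2_space TM" using sol aE unfolding hybrid_solution_def by blast
  then have W0: "rotation_matrix W0" and \<tau>0: "0 \<le> \<tau>0" "\<tau>0 \<le> TM" by (auto simp: x0 h2_space_def)
  \<comment> \<open>The instant at which the timer, falling at unit rate, expires.\<close>
  define b where "b = a + \<tau>0"
  have ab: "a \<le> b" using \<tau>0 by (simp add: b_def)
  obtain W X S where f: "W a = W0" "X a = X0" "S a = P (a, J)" "flow_on a b W \<eta> X S"
    using flow_on_exists[OF a ab W0] by blast
  \<comment> \<open>The timer is nonnegative on the old domain, so the last interval ends no later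
    than \<open>b\<close>; this covers closed, half-open and a priori unbounded intervals
    alike.\<close>
  have match: "s \<le> b" "x (s, J) = (W s, \<eta>, X s, b - s)" "P (s, J) = S s" if s: "s \<in> I" for s
  proof -
    have sub: "{a..s} \<subseteq> {t. (t, J) \<in> E}" using I(2)[OF s] by (auto simp: E a_def)
    have ss: "s \<in> {a..s}" using I(2)[OF s] by (auto simp: a_def)
    note sf = solution_flow[OF sol a sub]
    have "(s, J) \<in> E" using s by (simp add: E)
    then have "x (s, J) \<in> h2_space TM" using sol unfolding hybrid_solution_def by blast
    then have "0 \<le> snd (snd (snd (x (s, J))))" by (auto simp: h2_space_def)
    then show sb: "s \<le> b" using sf(3)[OF ss] by (simp add: x0 b_def)
    have fs: "flow_on a s (\<lambda>s. fst (x (s, J))) \<eta> (\<lambda>s. fst (snd (snd (x (s, J))))) (\<lambda>s. P (s, J))"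
      using sf(1) by (simp add: x0)
    note u = flow_on_unique[OF a ss fs flow_on_subset[OF f(4) sb]]
    have "fst (x (s, J)) = W s" "fst (snd (snd (x (s, J)))) = X s" "P (s, J) = S s"
      using u by (simp_all add: x0 f)
    moreover have "fst (snd (x (s, J))) = \<eta>" using sf(2)[OF ss] by (simp add: x0)
    moreover have "snd (snd (snd (x (s, J)))) = b - s" using sf(3)[OF ss] by (simp add: x0 b_def)
    ultimately show "x (s, J) = (W s, \<eta>, X s, b - s)" "P (s, J) = S s" by (simp_all add: prod_eq_iff)
  qed
  \<comment> \<open>The post-jump state; the timer is reset to \<open>TM\<close>, one of the
    admissible values.\<close>
  define xj :: h2_state where "xj = (W b, kR *\<^sub>R psi (M ** W b), (mat 1 - gain (S b) (Q b) ** C_mat) *v X b, TM)"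
  define E' where "E' = (\<Union>j<J. {t j..t (Suc j)} \<times> {j}) \<union> {a..b} \<times> {J} \<union> {b} \<times> {Suc J}"
  define x' where "x' p = (if snd p < J then x p else if snd p = J then (W (fst p), \<eta>, X (fst p), b - fst p) else xj)" for p
  define P' where "P' p = (if snd p < J then P p else if snd p = J then S (fst p) else riccati_jump (Q b) (S b))" for p
  have old: "x' s = x s \<and> P' s = P s" if "s \<in> E" for s
    using that match by (auto simp: E x'_def P'_def)
  have IE: "I \<subseteq> {a..b}" using match(1) I(2) by (auto simp: a_def)
  have sub: "E \<subset> E'"
  proof
    show "E \<subseteq> E'" using IE by (auto simp: E E'_def)
    have "(b, Suc J) \<in> E'" "(b, Suc J) \<notin> E" by (auto simp: E E'_def)
    then show "E \<noteq> E'" by blast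
  qed
  have slice: "{s. (s, j) \<in> E'} = (if j < J then {t j..t (Suc j)} else if j = J then {a..b} else if j = Suc J then {b} else {})" for j
    by (auto simp: E'_def)
  have slice_old: "{s. (s, j) \<in> E} = {t j..t (Suc j)}" if "j < J" for j using that by (auto simp: E)
  have "solution_pair E' x' P'"
    unfolding hybrid_solution_def Let_def slice
  proof (intro conjI allI ballI impI)
    show "hybrid_time_domain E'"
      unfolding hybrid_time_domain_def
    \<comment> \<open>The jump times are continued by the constant \<open>b\<close>, so the appended
      slice is the degenerate interval \<open>{b..b}\<close>. This makes the new domain strictly
      larger even if the old one already reached \<open>b\<close>.\<close>
    proof (intro exI[of _ "\<lambda>i. if i \<le> J then t i else b"] conjI)
      show "incseq (\<lambda>i. if i \<le> J then t i else b)"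
        using tJ ab by (intro incseq_SucI) (auto simp: incseq_SucD[OF t] a_def not_less_eq_eq intro: order_trans)
      have "E' = (\<Union>j\<le>Suc J. {(if j \<le> J then t j else b)..(if Suc j \<le> J then t (Suc j) else b)} \<times> {j})"
      proof (rule set_eqI)
        fix p :: "real \<times> nat"
        obtain s j where p: "p = (s, j)" by (cases p)
        show "p \<in> E' \<longleftrightarrow> p \<in> (\<Union>j\<le>Suc J. {(if j \<le> J then t j else b)..(if Suc j \<le> J then t (Suc j) else b)} \<times> {j})"
          unfolding p by (cases "j < J"; cases "j = J"; cases "j = Suc J") (auto simp: E'_def a_def split: if_splits)
      qed
      then show "E' = (\<Union>j. {(if j \<le> J then t j else b)..(if Suc j \<le> J then t (Suc j) else b)} \<times> {j}) \<or>
        (\<exists>Ja. E' = (\<Union>j\<le>Ja. {(if j \<le> J then t j else b)..(if Suc j \<le> J then t (Suc j) else b)} \<times> {j})) \<or>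
        (\<exists>Ja T. ereal (if Ja \<le> J then t Ja else b) < T \<and>
          E' = (\<Union>j<Ja. {(if j \<le> J then t j else b)..(if Suc j \<le> J then t (Suc j) else b)} \<times> {j})
            \<union> {s. (if Ja \<le> J then t Ja else b) \<le> s \<and> ereal s < T} \<times> {Ja})" by blast
    qed (simp add: t0)
  next
    fix p assume p: "p \<in> E'"
    consider "p \<in> E" | s where "p = (s, J)" "s \<in> {a..b}" | "p = (b, Suc J)" using p by (auto simp: E'_def E)
    then show "(x' p, P' p) \<in> h2_space TM \<times> UNIV"
    proof cases
      case 1
      then show ?thesis using old[OF 1] sol unfolding hybrid_solution_def by auto
    next
      case 2
      then show ?thesis using f(4) \<tau>0 by (auto simp: x'_def h2_space_def flow_on_def b_def)
    next
      case 3
      then show ?thesis using f(4) T ab by (auto simp: x'_def xj_def h2_space_def flow_on_def)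
    qed
  next
    fix j
    show "locally_abs_continuous_on (if j < J then {t j..t (Suc j)} else if j = J then {a..b} else if j = Suc J then {b} else {})
        (\<lambda>t. (x' (t, j), P' (t, j)))"
    proof -
      consider "j < J" | "j = J" | "j > J" by linarith
      then show ?thesis
      proof cases
        case 1
        have "locally_abs_continuous_on {t j..t (Suc j)} (\<lambda>t. (x (t, j), P (t, j)))"
          using lac[of j] unfolding slice_old[OF 1] .
        then show ?thesis using 1 by (simp add: x'_def P'_def)
      next
        case 2
        have "abs_continuous_on {a..b} (\<lambda>s. ((W s, \<eta>, X s, b - s), S s))"
          by (rule C1_imp_abs_continuous_on[OF flow_on_derivative[OF f(4)] flow_on_field_continuous[OF a f(4)]])
        then show ?thesis using 2 by (auto simp: x'_def P'_def locally_abs_continuous_on_def intro: abs_continuous_on_subset)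
      next
        case 3
        then show ?thesis
          by (auto simp: x'_def P'_def locally_abs_continuous_on_def intro!: Lipschitz_imp_abs_continuous_on[where B=0])
      qed
    qed
  next
    fix j
    show "AE s in lebesgue. s \<in> (if j < J then {t j..t (Suc j)} else if j = J then {a..b} else if j = Suc J then {b} else {}) \<longrightarrow>
       ((\<lambda>s. (x' (s, j), P' (s, j))) has_vector_derivative flow_field s (x' (s, j), P' (s, j)))
        (at s within (if j < J then {t j..t (Suc j)} else if j = J then {a..b} else if j = Suc J then {b} else {}))"
    proof -
      consider "j < J" | "j = J" | "j > J" by linarith
      then show ?thesis
      proof cases
        case 1
        show ?thesis using der[of j] unfolding slice_old[OF 1] using 1 by (simp add: x'_def P'_def)
      next
        case 2
        have "\<forall>s\<in>{a..b}. ((\<lambda>s. ((W s, \<eta>, X s, b - s), S s)) has_vector_derivative flow_field s ((W s, \<eta>, X s, b - s), S s)) (at s within {a..b})"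
          using flow_on_derivative[OF f(4)] by blast
        then show ?thesis using 2 by (simp add: x'_def P'_def)
      next
        case 3
        \<comment> \<open>On the appended slice the equation is void, as a single point is a null
          set.\<close>
        have "(if j = Suc J then {b} else {}) \<in> null_sets lebesgue" by simp
        then have "AE s in lebesgue. s \<notin> (if j = Suc J then {b} else {})" by (rule AE_not_in)
        then show ?thesis by (rule eventually_mono) (use 3 in \<open>auto split: if_splits\<close>)
      qed
    qed
  next
    fix s j assume h: "(s, j) \<in> E' \<and> (s, Suc j) \<in> E'"
    have "(x' (s, j), P' (s, j)) \<in> {((Rt, \<eta>, X, \<tau>), S). (Rt, \<eta>, X, \<tau>) \<in> h2_space TM \<and> \<tau> = 0} \<and>
      (x' (s, Suc j), P' (s, Suc j)) \<in> (\<lambda>t (z, S). h2_jump kR M Q Tm TM t S z \<times> {riccati_jump (Q t) S}) s (x' (s, j), P' (s, j))"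
    proof (cases "j = J")
      case True
      then have "s = b" using h by (auto simp: E'_def)
      then show ?thesis using True f(4) T ab
        by (auto simp: x'_def P'_def xj_def h2_space_def flow_on_def h2_jump_def)
    next
      case False
      then have j: "j < J" using h by (auto simp: E'_def)
      have "(s, j) \<in> E" using h j by (auto simp: E'_def E)
      \<comment> \<open>A new jump pair could arise only where the prolonged slice meets its
        predecessor; that happens at time \<open>a\<close> alone, which was already in the old
        slice.\<close>
      moreover have "(s, Suc j) \<in> E"
      proof (cases "Suc j = J")
        case True
        have "s \<in> {t j..t (Suc j)}" "s \<in> {a..b}" using h j True by (auto simp: E'_def)
        then have "s = a" using True by (auto simp: a_def)
        then show ?thesis using aE True by simp
      next
        case False
        then show ?thesis using h j by (auto simp: E'_def E)
      qed
      ultimately show ?thesis using old[of "(s, j)"] old[of "(s, Suc j)"] jmp[of s j] by simp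
    qed
    note H = this
    show "(x' (s, j), P' (s, j)) \<in> {((Rt, \<eta>, X, \<tau>), S). (Rt, \<eta>, X, \<tau>) \<in> h2_space TM \<and> \<tau> = 0}"
      by (rule H[THEN conjunct1])
    show "(x' (s, Suc j), P' (s, Suc j)) \<in> (\<lambda>t (z, S). h2_jump kR M Q Tm TM t S z \<times> {riccati_jump (Q t) S}) s (x' (s, j), P' (s, j))"
      by (rule H[THEN conjunct2])
  qed
  then show ?thesis using sub old by blast
qed

end

section \<open>Exponential stability\<close>

lemma hybrid_time_domain_0: "hybrid_time_domain E \<Longrightarrow> (0, 0) \<in> E"
proof -
  assume "hybrid_time_domain E"
  then obtain t :: "nat \<Rightarrow> real" where t: "t 0 = 0" "incseq t"
    and E: "E = (\<Union>j. {t j..t (Suc j)} \<times> {j}) \<or> (\<exists>J. E = (\<Union>j\<le>J. {t j..t (Suc j)} \<times> {j})) \<or>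
         (\<exists>J T. ereal (t J) < T \<and> E = (\<Union>j<J. {t j..t (Suc j)} \<times> {j}) \<union> {s. t J \<le> s \<and> ereal s < T} \<times> {J})"
    unfolding hybrid_time_domain_def by blast
  have "0 \<in> {t 0..t (Suc 0)}" using t incseq_SucD[OF t(2), of 0] by auto
  then have 0: "(0, 0) \<in> {t 0..t (Suc 0)} \<times> {0::nat}" by simp
  from E show ?thesis
  proof (elim disjE exE conjE)
    fix J and T :: ereal assume T: "ereal (t J) < T" and E: "E = (\<Union>j<J. {t j..t (Suc j)} \<times> {j}) \<union> {s. t J \<le> s \<and> ereal s < T} \<times> {J}"
    show ?thesis
    proof (cases "J = 0")
      case True
      then show ?thesis using T t(1) by (simp add: E zero_ereal_def)
    next
      case False
      then show ?thesis using 0 unfolding E by blast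
    qed
  qed (use 0 in blast)+
qed

context h2_system
begin

lemma h2_solution_iff:
  "h2_solution g R \<omega> V Q P0 M Tm TM kR E x \<longleftrightarrow> (\<exists>P. P (0, 0) = P0 \<and> solution_pair E x P)"
  by (simp only: h2_solution_def)

text \<open>Both kinds of domain with finitely many intervals end in a slice that contains, with
  each time, everything back to its start. They can be prolonged, and the prolongation keeps the
  initial value of \<open>P\<close>.\<close>

lemma maximal_solution_domain:
  assumes max: "h2_maximal_solution g R \<omega> V Q P0 M Tm TM kR E x"
  obtains t :: "nat \<Rightarrow> real" where "t 0 = 0" "incseq t" "E = (\<Union>j. {t j..t (Suc j)} \<times> {j})"
proof -
  obtain P where P: "P (0, 0) = P0" "solution_pair E x P"
    using max unfolding h2_maximal_solution_def h2_solution_iff by blast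
  have dom: "hybrid_time_domain E" by (rule P(2)[unfolded hybrid_solution_def, THEN conjunct1])
  obtain t :: "nat \<Rightarrow> real" where t: "t 0 = 0" "incseq t"
    and E: "E = (\<Union>j. {t j..t (Suc j)} \<times> {j}) \<or> (\<exists>J. E = (\<Union>j\<le>J. {t j..t (Suc j)} \<times> {j})) \<or>
         (\<exists>J T. ereal (t J) < T \<and> E = (\<Union>j<J. {t j..t (Suc j)} \<times> {j}) \<union> {s. t J \<le> s \<and> ereal s < T} \<times> {J})"
    using dom unfolding hybrid_time_domain_def by blast
  have no: False if I: "E = (\<Union>j<J. {t j..t (Suc j)} \<times> {j}) \<union> I \<times> {J}" "t J \<in> I"
    "\<And>s. s \<in> I \<Longrightarrow> t J \<le> s \<and> {t J..s} \<subseteq> I" for J I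
  proof -
    obtain E' x' P' where e: "solution_pair E' x' P'" "E \<subset> E'" "\<forall>s\<in>E. x' s = x s \<and> P' s = P s"
      using solution_extends[OF P(2) t I] by blast
    have "P' (0, 0) = P0" using e(3) hybrid_time_domain_0[OF dom] P(1) by simp
    then have "h2_solution g R \<omega> V Q P0 M Tm TM kR E' x'" using e(1) unfolding h2_solution_iff by blast
    then show False using max e(2,3) unfolding h2_maximal_solution_def by blast
  qed
  from E show thesis
  proof (elim disjE exE conjE)
    assume "E = (\<Union>j. {t j..t (Suc j)} \<times> {j})"
    then show thesis by (rule that[OF t])
  next
    fix J assume "E = (\<Union>j\<le>J. {t j..t (Suc j)} \<times> {j})"
    moreover have "{..J} = {..<J} \<union> {J}" by auto
    ultimately have "E = (\<Union>j<J. {t j..t (Suc j)} \<times> {j}) \<union> {t J..t (Suc J)} \<times> {J}" by auto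
    then show thesis using no[of J "{t J..t (Suc J)}"] incseq_SucD[OF t(2), of J] by force
  next
    fix J and T :: ereal assume T: "ereal (t J) < T" and E: "E = (\<Union>j<J. {t j..t (Suc j)} \<times> {j}) \<union> {s. t J \<le> s \<and> ereal s < T} \<times> {J}"
    have False
    proof (rule no[OF E])
      show "t J \<in> {s. t J \<le> s \<and> ereal s < T}" using T by simp
      fix s assume s: "s \<in> {s. t J \<le> s \<and> ereal s < T}"
      have "ereal r < T" if "r \<le> s" for r
        using that s by (simp add: order.strict_trans1[of "ereal r" "ereal s"])
      then show "t J \<le> s \<and> {t J..s} \<subseteq> {s. t J \<le> s \<and> ereal s < T}" using s by auto
    qed
    then show thesis ..
  qed
qed

lemma solution_run:
  assumes sol: "solution_pair E x P" and P0: "P (0, 0) = P0" "pos_def P0"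
    and t: "t 0 = 0" "incseq t" and E: "E = (\<Union>j. {t j..t (Suc j)} \<times> {j})"
  defines "W \<equiv> \<lambda>j s. fst (x (s, j))" and "\<eta> \<equiv> \<lambda>j. fst (snd (x (t j, j)))" and "X \<equiv> \<lambda>j s. fst (snd (snd (x (s, j))))"
  shows "attitude_run M kR Tm TM t W \<eta>"
    "riccati_run R \<omega> V Q vm VM qm QM Tm TM t (\<lambda>j s. P (s, j)) P0"
    "\<And>j s. s \<in> {t j..t (Suc j)} \<Longrightarrow> (X j has_vector_derivative (A_mat (\<omega> s) *v X j s + drift (W j) s)) (at s within {t j..t (Suc j)})"
    "\<And>j. X (Suc j) (t (Suc j)) = (mat 1 - gain (P (t (Suc j), j)) (Q (t (Suc j))) ** C_mat) *v X j (t (Suc j))"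
    "\<And>j s. s \<in> {t j..t (Suc j)} \<Longrightarrow> fst (snd (x (s, j))) = \<eta> j"
    "\<And>j s. s \<in> {t j..t (Suc j)} \<Longrightarrow> rotation_matrix (W j s)"
    "\<And>j. t (Suc j) - t j \<le> TM"
proof -
  let ?\<tau> = "\<lambda>j s. snd (snd (snd (x (s, j))))"
  have tn: "0 \<le> t j" for j using incseqD[OF t(2), of 0 j] t by simp
  have tm: "t j \<le> t (Suc j)" for j by (rule incseq_SucD[OF t(2)])
  have sub: "{t j..t (Suc j)} \<subseteq> {s. (s, j) \<in> E}" for j by (auto simp: E)
  note sf = solution_flow[OF sol tn sub]
  have end1: "t (Suc j) \<in> {t j..t (Suc j)}" for j using tm by simp
  have flow: "flow_on (t j) (t (Suc j)) (W j) (\<eta> j) (X j) (\<lambda>s. P (s, j))" for j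
    using sf(1)[of j] by (simp add: W_def \<eta>_def X_def)
  have jump: "?\<tau> j (t (Suc j)) = 0 \<and> Tm \<le> ?\<tau> (Suc j) (t (Suc j)) \<and> W (Suc j) (t (Suc j)) = W j (t (Suc j))
    \<and> \<eta> (Suc j) = kR *\<^sub>R psi (M ** W j (t (Suc j)))
    \<and> X (Suc j) (t (Suc j)) = (mat 1 - gain (P (t (Suc j), j)) (Q (t (Suc j))) ** C_mat) *v X j (t (Suc j))
    \<and> P (t (Suc j), Suc j) = riccati_jump (Q (t (Suc j))) (P (t (Suc j), j))" for j
  proof -
    let ?T = "t (Suc j)"
    have "(?T, j) \<in> E" "(?T, Suc j) \<in> E" using tm[of j] tm[of "Suc j"] by (auto simp: E)
    note H = sol[unfolded hybrid_solution_def, THEN conjunct2, THEN conjunct2, THEN conjunct2, THEN spec, THEN spec, THEN mp, OF conjI[OF this]]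
    obtain Rt h Y \<tau> where x: "x (?T, j) = (Rt, h, Y, \<tau>)" by (cases "x (?T, j)") auto
    show ?thesis using H by (auto simp: x h2_jump_def W_def \<eta>_def X_def)
  qed
  \<comment> \<open>The timer reaches zero exactly at the jump, so its value at the start of an
    interval is the length of the interval; the admissible timer and reset values thus become bounds
    on lengths.\<close>
  have tau: "?\<tau> j (t j) = t (Suc j) - t j" for j
    using sf(3)[OF end1, of j] jump[of j] by simp
  have sp: "x (t j, j) \<in> h2_space TM" for j
  proof -
    have "(t j, j) \<in> E" using tm[of j] by (auto simp: E)
    then show ?thesis using sol unfolding hybrid_solution_def by blast
  qed
  have tle: "t (Suc j) - t j \<le> TM" for j using sp[of j] tau[of j] by (auto simp: h2_space_def)
  have tge: "Tm \<le> t (Suc (Suc j)) - t (Suc j)" for j using jump[of j] tau[of "Suc j"] by simp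
  show "t (Suc j) - t j \<le> TM" for j by (rule tle)
  show "attitude_run M kR Tm TM t W \<eta>"
    using tm tle tge flow jump unfolding attitude_run_def flow_on_def by simp
  show "riccati_run R \<omega> V Q vm VM qm QM Tm TM t (\<lambda>j s. P (s, j)) P0"
    by unfold_locales (use t tm tle tge flow jump P0 in \<open>auto simp: flow_on_def\<close>)
  show "(X j has_vector_derivative (A_mat (\<omega> s) *v X j s + drift (W j) s)) (at s within {t j..t (Suc j)})"
    if "s \<in> {t j..t (Suc j)}" for j s using flow[of j] that by (simp add: flow_on_def)
  show "X (Suc j) (t (Suc j)) = (mat 1 - gain (P (t (Suc j), j)) (Q (t (Suc j))) ** C_mat) *v X j (t (Suc j))" for j
    using jump[of j] by simp
  show "fst (snd (x (s, j))) = \<eta> j" if "s \<in> {t j..t (Suc j)}" for j s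
    using sf(2)[OF that] by (simp add: \<eta>_def)
  show "rotation_matrix (W j s)" if "s \<in> {t j..t (Suc j)}" for j s
    using flow[of j] that by (simp add: flow_on_def)
qed

text \<open>The perturbation is \<open>transpose (R s)\<close> applied to
  \<open>(mat 1 - W s) *v g\<close>. The true attitude drops out as an isometry, and the forcing
  vanishes with the attitude error.\<close>

lemma norm_drift_le:
  assumes s: "0 \<le> s" and W: "rotation_matrix (W s)"
  shows "(norm (drift W s))\<^sup>2 \<le> 32 * (norm g)\<^sup>2 * (rot_norm (W s))\<^sup>2"
proof -
  have "transpose (R s - transpose (W s) ** R s) *v g = transpose (R s) *v ((mat 1 - W s) *v g)"
    by (simp add: matrix_transpose_mul linear_diff[OF bounded_linear.linear[OF bounded_linear_transpose]]
        matrix_vector_mult_diff_rdistrib matrix_vector_mult_diff_distrib matrix_vector_mul_assoc)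
  then have "norm (drift W s) = norm ((mat 1 - W s) *v g)"
    by (simp add: drift_def norm_block_vec_0 norm_rotation_mv[OF R_rot[OF s]])
  also have "\<dots> \<le> norm (mat 1 - W s) * norm g" by (rule norm_matrix_vector_mult_le)
  finally have "(norm (drift W s))\<^sup>2 \<le> (norm (mat 1 - W s) * norm g)\<^sup>2" by (intro power_mono) auto
  also have "\<dots> = 8 * (norm g)\<^sup>2 * (rot_norm (W s))\<^sup>2"
    using rot_norm_sq(1)[OF W] by (simp add: power_mult_distrib)
  also have "\<dots> \<le> 32 * (norm g)\<^sup>2 * (rot_norm (W s))\<^sup>2" by (intro mult_right_mono) auto
  finally show ?thesis .
qed

end

section \<open>Completeness, closedness and the final estimate\<close>

lemma complete_domain_unbounded_jumps:
  assumes "incseq t" "E = (\<Union>j. {t j..t (Suc j)} \<times> {j})" "t 0 = 0"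
  shows "complete_domain E"
  unfolding complete_domain_def
proof
  fix B :: real
  obtain n :: nat where n: "B < real n" using reals_Archimedean2 by blast
  have "0 \<le> t n" using incseqD[OF assms(1), of 0 n] assms(3) by simp
  moreover have "(t n, n) \<in> E" using incseq_SucD[OF assms(1), of n] by (auto simp: assms(2))
  ultimately show "\<exists>(s, j)\<in>E. B < s + real j" using n by (intro bexI[of _ "(t n, n)"]) auto
qed

lemma closed_h2_target:
  assumes "0 \<le> TM"
  shows "closed (h2_target TM)"
proof -
  have "rotation_matrix (mat 1 :: mat3)" by (simp add: rotation_matrix_def orthogonal_matrix_id)
  then have "h2_target TM = {mat 1} \<times> {0} \<times> {0} \<times> {0..TM}"
    by (auto simp: h2_target_def h2_space_def)
  then show ?thesis by (simp add: closed_Times)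
qed

theorem theorem9:
  fixes N :: nat and p :: "nat \<Rightarrow> real ^ 3" and k :: "nat \<Rightarrow> real"
    and g :: "real ^ 3" and R :: "real \<Rightarrow> real ^ 3 ^ 3" and \<omega> :: "real \<Rightarrow> real ^ 3"
    and V :: "real \<Rightarrow> real ^ (3 + 3) ^ (3 + 3)" and Q :: "real \<Rightarrow> real ^ 3 ^ 3"
    and P0 :: "real ^ (3 + 3) ^ (3 + 3)" and Tm TM :: real
  assumes N: "N \<ge> 3"
    and k_pos: "\<And>i. i \<in> {1..N} \<Longrightarrow> k i > 0"
    and k_sum: "(\<Sum>i=1..N. k i) = 1"
    and noncollinear: "\<exists>a\<in>{1..N}. \<exists>b\<in>{1..N}. \<exists>c\<in>{1..N}. \<not> collinear {p a, p b, p c}"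
    and timer: "0 < Tm" "Tm \<le> TM"
    and R_rot: "\<And>t. t \<ge> 0 \<Longrightarrow> rotation_matrix (R t)"
    and R_ode: "\<And>t. t \<ge> 0 \<Longrightarrow> (R has_vector_derivative (R t ** skew (\<omega> t))) (at t within {0..})"
    and \<omega>: "continuous_on {0..} \<omega>" "bounded (\<omega> ` {0..})"
    and V: "continuous_on {0..} V" "bounded (V ` {0..})" "uniformly_pos_def V"
    and Q: "bounded (Q ` {0..})" "uniformly_pos_def Q"
    and P0: "pos_def P0"
  shows "closed (h2_target TM) \<and>
    (\<forall>\<epsilon>. 0 < \<epsilon> \<and> \<epsilon> < 1 \<longrightarrow>
      (\<exists>\<eta>star kRstar. 0 < \<eta>star \<and> 0 < kRstar \<and>
        (\<forall>kR. 0 < kR \<and> kR < kRstar \<longrightarrow>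
          (\<exists>\<kappa> lam. 0 < \<kappa> \<and> 0 < lam \<and>
            (\<forall>E x Rt0 \<eta>0 X0 \<tau>0.
              h2_maximal_solution g R \<omega> V Q P0 (landmark_mat N k p) Tm TM kR E x \<and>
              x (0, 0) = (Rt0, \<eta>0, X0, \<tau>0) \<and>
              rot_norm Rt0 \<le> \<epsilon> * sqrt (varsigma (landmark_mat N k p)) \<and>
              norm \<eta>0 \<le> \<eta>star
              \<longrightarrow> complete_domain E \<and>
                  (\<forall>(t, j)\<in>E. h2_dist (x (t, j)) \<le> \<kappa> * exp (- lam * (t + real j)) * h2_dist (x (0, 0))))))))"
proof (intro conjI allI impI, goal_cases)
  case 1
  show ?case using timer by (intro closed_h2_target) simp
next
  case (2 \<epsilon>)
  then have \<epsilon>: "0 < \<epsilon>" "\<epsilon> < 1" by auto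
  let ?M = "landmark_mat N k p"
  note M_sym = landmark_mat_symmetric[of N k p]
  have M_pd: "pos_def (bar_mat ?M)" by (rule pos_def_bar_landmark_mat[OF k_pos noncollinear])
  obtain vm where vm: "0 < vm" "\<And>t. t \<ge> 0 \<Longrightarrow> transpose (V t) = V t" "\<And>t x. t \<ge> 0 \<Longrightarrow> vm * (x \<bullet> x) \<le> x \<bullet> (V t *v x)"
    using V(3) unfolding uniformly_pos_def_def by blast
  obtain qm where qm: "0 < qm" "\<And>t. t \<ge> 0 \<Longrightarrow> transpose (Q t) = Q t" "\<And>t x. t \<ge> 0 \<Longrightarrow> qm * (x \<bullet> x) \<le> x \<bullet> (Q t *v x)"
    using Q(2) unfolding uniformly_pos_def_def by blast
  obtain VM where VM: "\<And>t. t \<ge> 0 \<Longrightarrow> norm (V t) \<le> VM" using V(2) unfolding bounded_iff by auto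
  obtain QM where QM: "\<And>t. t \<ge> 0 \<Longrightarrow> norm (Q t) \<le> QM" using Q(1) unfolding bounded_iff by auto
  interpret riccati_data R \<omega> V Q vm VM qm QM Tm TM
    by unfold_locales (use R_rot R_ode vm qm VM QM timer in auto)
  obtain \<eta>star kRstar where star: "0 < \<eta>star" "0 < kRstar" and att: "\<And>kR. 0 < kR \<and> kR < kRstar \<Longrightarrow>
    (\<exists>C \<rho>. 0 \<le> C \<and> 0 < \<rho> \<and> \<rho> < 1 \<and> (\<forall>t W \<eta>. attitude_run ?M kR Tm TM t W \<eta> \<and>
       rot_norm (W 0 (t 0)) \<le> \<epsilon> * sqrt (varsigma ?M) \<and> norm (\<eta> 0) \<le> \<eta>star \<longrightarrow>
       (\<forall>j. \<forall>s\<in>{t j..t (Suc j)}. (rot_norm (W j s))\<^sup>2 + (norm (\<eta> j))\<^sup>2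
          \<le> C * \<rho> ^ j * ((rot_norm (W 0 (t 0)))\<^sup>2 + (norm (\<eta> 0))\<^sup>2))))"
    using attitude_run_decay[OF M_sym M_pd timer \<epsilon>] by blast
  show ?case
  proof (rule exI[of _ \<eta>star], rule exI[of _ kRstar], intro conjI star allI impI)
    fix kR assume kR: "0 < kR \<and> kR < kRstar"
    \<comment> \<open>Only here, because \<open>kR\<close> is a parameter of this locale while the
      thresholds had to be fixed before it.\<close>
    interpret h2_system R \<omega> V Q vm VM qm QM Tm TM g ?M kR
      by unfold_locales (use \<omega> V in auto)
    obtain C \<rho> where C: "0 \<le> C" and \<rho>: "0 < \<rho>" "\<rho> < 1" and attC: "\<And>t W \<eta> j s. \<lbrakk>attitude_run ?M kR Tm TM t W \<eta>;
       rot_norm (W 0 (t 0)) \<le> \<epsilon> * sqrt (varsigma ?M); norm (\<eta> 0) \<le> \<eta>star; s \<in> {t j..t (Suc j)}\<rbrakk> \<Longrightarrow>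
       (rot_norm (W j s))\<^sup>2 + (norm (\<eta> j))\<^sup>2 \<le> C * \<rho> ^ j * ((rot_norm (W 0 (t 0)))\<^sup>2 + (norm (\<eta> 0))\<^sup>2)"
      using att[OF kR] by blast
    \<comment> \<open>The gain from the attitude decay to the squared perturbation.\<close>
    define G where "G = 32 * (norm g)\<^sup>2 * C"
    have G: "0 \<le> G" using C by (simp add: G_def)
    obtain B r where B: "0 \<le> B" and r: "\<rho> \<le> r" "r < 1" and kal: "\<forall>t P X \<delta> m.
        riccati_run R \<omega> V Q vm VM qm QM Tm TM t P P0 \<and>
        (\<forall>j. \<forall>s\<in>{t j..t (Suc j)}. (X j has_vector_derivative (A_mat (\<omega> s) *v X j s + \<delta> j s)) (at s within {t j..t (Suc j)})) \<and>
        (\<forall>j. X (Suc j) (t (Suc j)) = (mat 1 - gain (P j (t (Suc j))) (Q (t (Suc j))) ** C_mat) *v X j (t (Suc j))) \<and>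
        (\<forall>j. \<forall>s\<in>{t j..t (Suc j)}. (norm (\<delta> j s))\<^sup>2 \<le> G * \<rho> ^ j * m) \<and> (norm (X 0 0))\<^sup>2 \<le> m \<longrightarrow>
        (\<forall>j. \<forall>s\<in>{t j..t (Suc j)}. (norm (X j s))\<^sup>2 \<le> B * r ^ j * m)"
      using riccati_run_error_decay[OF P0 \<rho> G]
    proof (elim exE conjE, goal_cases)
      case (1 C r)
      show ?case by (rule 1(1)[OF 1(2-5)])
    qed
    have r0: "0 < r" using \<rho> r by simp
    define K where "K = C + B + 1"
    have K: "0 < K" using C B by (simp add: K_def)
    \<comment> \<open>Chosen so that one jump together with at most \<open>TM\<close> units of flow
      costs the factor \<open>sqrt r\<close>; the root appears because the bounds so far concern
      squared norms.\<close>
    define lam where "lam = - ln (sqrt r) / (TM + 1)"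
    have TM1: "0 < TM + 1" using timer by simp
    have lam: "0 < lam" using r r0 TM1 by (simp add: lam_def ln_sqrt divide_neg_pos)
    have elam: "exp (- lam * (TM + 1)) = sqrt r" using r0 TM1 by (simp add: lam_def)
    \<comment> \<open>The division by \<open>sqrt r\<close> accounts for the current, possibly
      incomplete interval: \<open>t + j\<close> is bounded by
      \<open>(TM + 1) * (j + 1)\<close>.\<close>
    define \<kappa> where "\<kappa> = sqrt K / sqrt r"
    have \<kappa>: "0 < \<kappa>" using K r0 by (simp add: \<kappa>_def)
    show "\<exists>\<kappa> lam. 0 < \<kappa> \<and> 0 < lam \<and>
            (\<forall>E x Rt0 \<eta>0 X0 \<tau>0.
              h2_maximal_solution g R \<omega> V Q P0 ?M Tm TM kR E x \<and>
              x (0, 0) = (Rt0, \<eta>0, X0, \<tau>0) \<and>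
              rot_norm Rt0 \<le> \<epsilon> * sqrt (varsigma ?M) \<and>
              norm \<eta>0 \<le> \<eta>star
              \<longrightarrow> complete_domain E \<and>
                  (\<forall>(t, j)\<in>E. h2_dist (x (t, j)) \<le> \<kappa> * exp (- lam * (t + real j)) * h2_dist (x (0, 0))))"
    proof (rule exI[of _ \<kappa>], rule exI[of _ lam], intro conjI \<kappa> lam allI impI, goal_cases)
      case (1 E x Rt0 \<eta>0 X0 \<tau>0)
      obtain t :: "nat \<Rightarrow> real" where "t 0 = 0" "incseq t" "E = (\<Union>j. {t j..t (Suc j)} \<times> {j})"
        by (rule maximal_solution_domain[OF 1[THEN conjunct1]])
      then show ?case by (intro complete_domain_unbounded_jumps)
    next
      case (2 E x Rt0 \<eta>0 X0 \<tau>0)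
      note max = 2[THEN conjunct1] and x0 = 2[THEN conjunct2, THEN conjunct1]
        and Rt0 = 2[THEN conjunct2, THEN conjunct2, THEN conjunct1] and \<eta>0 = 2[THEN conjunct2, THEN conjunct2, THEN conjunct2]
      obtain t :: "nat \<Rightarrow> real" where t: "t 0 = 0" "incseq t" and E: "E = (\<Union>j. {t j..t (Suc j)} \<times> {j})"
        by (rule maximal_solution_domain[OF max])
      obtain P where P: "P (0, 0) = P0" "solution_pair E x P"
        using max unfolding h2_maximal_solution_def h2_solution_iff by blast
      note run = solution_run[OF P(2) P(1) P0 t E]
      define d where "d = (rot_norm Rt0)\<^sup>2 + (norm \<eta>0)\<^sup>2"
      \<comment> \<open>The squared initial distance. The attitude bound involves only
        \<open>d\<close>; the bound on \<open>X\<close> needs all of \<open>m\<close>.\<close>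
      define m where "m = d + (norm X0)\<^sup>2"
      have d0: "0 \<le> d" "d \<le> m" "0 \<le> m" by (auto simp: d_def m_def)
      have tn: "0 \<le> t j" for j using incseqD[OF t(2), of 0 j] t by simp
      have tj: "t j \<le> real j * TM" for j
      proof (induction j)
        case (Suc j)
        then show ?case using run(7)[of j] by (simp add: algebra_simps)
      qed (simp add: t)
      have a: "(rot_norm (fst (x (s, j))))\<^sup>2 + (norm (fst (snd (x (t j, j)))))\<^sup>2 \<le> C * \<rho> ^ j * d"
        if s: "s \<in> {t j..t (Suc j)}" for s j
        using attC[OF run(1) _ _ s] Rt0 \<eta>0 by (simp add: t x0 d_def)
      have dr: "(norm (drift (\<lambda>s. fst (x (s, j))) s))\<^sup>2 \<le> G * \<rho> ^ j * m" if s: "s \<in> {t j..t (Suc j)}" for j s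
      proof -
        have s0: "0 \<le> s" using s tn[of j] by simp
        have "(norm (drift (\<lambda>s. fst (x (s, j))) s))\<^sup>2 \<le> 32 * (norm g)\<^sup>2 * (rot_norm (fst (x (s, j))))\<^sup>2"
          by (rule norm_drift_le[where W="\<lambda>s. fst (x (s, j))", OF s0 run(6)[OF s]])
        also have "\<dots> \<le> 32 * (norm g)\<^sup>2 * (C * \<rho> ^ j * d)"
          using a[OF s] by (intro mult_left_mono) (auto intro: order_trans[rotated])
        also have "\<dots> \<le> G * \<rho> ^ j * m"
          unfolding G_def using d0 C \<rho> by (simp add: mult.assoc mult_left_mono)
        finally show ?thesis .
      qed
      have "\<forall>j. \<forall>s\<in>{t j..t (Suc j)}. (norm (fst (snd (snd (x (s, j))))))\<^sup>2 \<le> B * r ^ j * m"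
      proof (rule kal[THEN spec[of _ t], THEN spec[of _ "\<lambda>j s. P (s, j)"], THEN spec[of _ "\<lambda>j s. fst (snd (snd (x (s, j))))"],
          THEN spec[of _ "\<lambda>j. drift (\<lambda>s. fst (x (s, j)))"], THEN spec[of _ m], THEN mp], intro conjI allI ballI)
        show "(norm (fst (snd (snd (x (0, 0))))))\<^sup>2 \<le> m" using d0 by (simp add: x0 m_def)
      qed (use run(2,3,4) dr in auto)
      then have b: "(norm (fst (snd (snd (x (s, j))))))\<^sup>2 \<le> B * r ^ j * m" if "s \<in> {t j..t (Suc j)}" for s j
        using that by blast
      show ?case
      proof (intro ballI, clarify)
        fix s j assume "(s, j) \<in> E"
        then have s: "s \<in> {t j..t (Suc j)}" by (auto simp: E)
        obtain W h X \<tau> where x: "x (s, j) = (W, h, X, \<tau>)" by (cases "x (s, j)") auto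
        have "(rot_norm W)\<^sup>2 + (norm h)\<^sup>2 \<le> C * \<rho> ^ j * d" using a[OF s] run(5)[OF s] by (simp add: x)
        also have "\<dots> \<le> C * r ^ j * m" using C d0 \<rho> r by (intro mult_mono mult_left_mono power_mono) auto
        finally have "(rot_norm W)\<^sup>2 + (norm h)\<^sup>2 + (norm X)\<^sup>2 \<le> C * r ^ j * m + B * r ^ j * m"
          using b[OF s] by (simp add: x)
        also have "\<dots> \<le> K * r ^ j * m" using r0 d0 by (simp add: K_def algebra_simps)
        finally have "h2_dist (x (s, j)) \<le> sqrt (K * r ^ j * m)"
          by (simp add: h2_dist_def x)
        also have "\<dots> = sqrt K * sqrt r ^ j * h2_dist (x (0, 0))"
          by (simp add: h2_dist_def x0 m_def d_def real_sqrt_mult real_sqrt_power)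
        also have "\<dots> \<le> \<kappa> * exp (- lam * (s + real j)) * h2_dist (x (0, 0))"
        proof (rule mult_right_mono)
          have "s \<le> real (Suc j) * TM" using s tj[of "Suc j"] by simp
          then have "s + real j \<le> (TM + 1) * real (Suc j)" by (simp add: algebra_simps)
          then have "lam * (s + real j) \<le> lam * ((TM + 1) * real (Suc j))" using lam by (intro mult_left_mono) auto
          then have e1: "exp (real (Suc j) * (- lam * (TM + 1))) \<le> exp (- lam * (s + real j))"
            by (simp add: algebra_simps)
          have e2: "exp (real (Suc j) * (- lam * (TM + 1))) = sqrt r ^ Suc j"
            unfolding exp_of_nat_mult elam ..
          have "\<kappa> * sqrt r ^ Suc j \<le> \<kappa> * exp (- lam * (s + real j))"
            using e1[unfolded e2] \<kappa> by (rule mult_left_mono[OF _ less_imp_le])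
          then show "sqrt K * sqrt r ^ j \<le> \<kappa> * exp (- lam * (s + real j))"
            using r0 by (simp add: \<kappa>_def)
        qed (simp add: h2_dist_def x0)
        finally show "h2_dist (x (s, j)) \<le> \<kappa> * exp (- lam * (s + real j)) * h2_dist (x (0, 0))" .
      qed
    qed
  qed
qed

end
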